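(* Let $S=\mathbb{C}[x,y,z]$ and for parameters $(s,t)$ put $$Q'_{(s,t)}=xyz\,(x+y+z)(x+y+tz)(tx+sy+tz)(y+z)\big(x+(s-t)y\big)\big((-s+t+1)x+(-s+t)z\big)(x+sy+tz)\cdot A_{(s,t)}\cdot B_{(s,t)},$$ where $$A_{(s,t)}=(-st^2+st+t^3-t)x+(-st+t^2)y+(-st^2+t^3)z,$$ $$B_{(s,t)}=(s^2t-st^2-2st+t^2+t)x+(s^3t-s^3-2s^2t^2+s^2t+s^2+st^3-st)y+(s^2t-2st^2+t^3)z.$$ Let $\mathcal{L}_{12}^1$ be the arrangement of $12$ lines in the projective plane given by $Q'_{(-3,3)}=0$, and let $\mathcal{L}_{12}^2$ be the arrangement of $12$ lines given by $Q'_{(s',t')}=0$ with $s'=(1-\sqrt3)(\sqrt3-3)$ and $t'=\sqrt3-1$. Then the intersection lattices of $\mathcal{L}_{12}^1$ and $\mathcal{L}_{12}^2$ are isomorphic, while the modules $\mathrm{AR}$ have minimal graded free resolutions of the form $$0\to S(-10)\to S(-8)\oplus S(-7)\oplus S(-6)\to \mathrm{AR}(Q'_{(-3,3)})\to 0,$$ $$0\to S(-10)\oplus S(-9)\to S(-9)\oplus S(-8)\oplus S(-7)\oplus S(-6)\to \mathrm{AR}(Q'_{(s',t')})\to 0.$$ In particular, $\mathcal{L}_{12}^1$ and $\mathcal{L}_{12}^2$ have the same combinatorics but different $\mathrm{AR}$ modules, i.e. they form a Ziegler pair (2nd variant).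
   Context: For a homogeneous polynomial $f\in S=\mathbb{C}[x,y,z]$ defining a reduced plane curve, $\mathrm{AR}(f)=\{(a,b,c)\in S^{\oplus 3}: a\,\partial_x f+b\,\partial_y f+c\,\partial_z f=0\}$, a graded $S$-module whose degree $r$ part consists of triples of forms of degree $r$. The intersection lattice $L(\mathcal{L})$ of a line arrangement $\mathcal{L}\subset\mathbb{P}^2_{\mathbb{C}}$ is the set of all non-empty intersections of (sub)families of lines of $\mathcal{L}$, ordered by reverse inclusion ($X\le Y$ iff $Y\subset X$). Two line arrangements in $\mathbb{P}^2_{\mathbb{C}}$ form a Ziegler pair (2nd variant) if their intersection lattices are isomorphic but they have different $\mathrm{AR}$ modules of algebraic relations; here the $\mathrm{AR}$ modules differ in that their minimal graded free resolutions have different graded Betti numbers. *)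

theory Defs
  imports "HOL-Analysis.Analysis" "HOL-Library.Poly_Mapping"
begin

section \<open>The graded ring \<open>S = \<complex>[x,y,z]\<close>\<close>

text \<open>The variables \<open>x, y, z\<close> are indexed by the elements \<open>1, 2, 3\<close> of the three-element
  type \<^typ>\<open>3\<close>, as for the coordinates of vectors in \<^typ>\<open>complex ^ 3\<close>.\<close>

type_synonym poly3 = "(3 \<Rightarrow>\<^sub>0 nat) \<Rightarrow>\<^sub>0 complex"

definition Const :: "complex \<Rightarrow> poly3" where
  "Const c = Poly_Mapping.single 0 c"

definition Var :: "3 \<Rightarrow> poly3" where
  "Var i = Poly_Mapping.single (Poly_Mapping.single i 1) 1"

definition mono_deg :: "(3 \<Rightarrow>\<^sub>0 nat) \<Rightarrow> nat" where
  "mono_deg m = (\<Sum>i\<in>UNIV. Poly_Mapping.lookup m i)"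

definition is_form :: "nat \<Rightarrow> poly3 \<Rightarrow> bool" where
  "is_form d f \<longleftrightarrow> (\<forall>m\<in>Poly_Mapping.keys f. mono_deg m = d)"

definition eval_poly3 :: "poly3 \<Rightarrow> complex ^ 3 \<Rightarrow> complex" where
  "eval_poly3 f v =
     (\<Sum>m\<in>Poly_Mapping.keys f. Poly_Mapping.lookup f m * (\<Prod>i\<in>UNIV. (v $ i) ^ Poly_Mapping.lookup m i))"

text \<open>If \<open>x\<^sub>i\<close> does not occur in \<open>m\<close>, the truncated \<open>m - single i 1\<close> is irrelevant, since the
  coefficient vanishes.\<close>

definition partial_deriv :: "3 \<Rightarrow> poly3 \<Rightarrow> poly3" where
  "partial_deriv i f =
     (\<Sum>m\<in>Poly_Mapping.keys f.
        Poly_Mapping.single (m - Poly_Mapping.single i 1)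
          (of_nat (Poly_Mapping.lookup m i) * Poly_Mapping.lookup f m))"

definition irrelevant_ideal :: "poly3 set" where
  "irrelevant_ideal = {p. Poly_Mapping.lookup p 0 = 0}"


section \<open>Graded free modules and minimal graded free resolutions\<close>

text \<open>A list \<open>[d\<^sub>0, \<dots>, d\<^sub>k]\<close> stands for the graded free module
  \<open>S(-d\<^sub>0) \<oplus> \<dots> \<oplus> S(-d\<^sub>k)\<close>, and the empty list for the zero module. The component of degree \<open>r\<close>
  of \<open>S(-d)\<close> consists of the forms of degree \<open>r - d\<close>; it is zero for \<open>r < d\<close>.\<close>

definition free_module :: "nat list \<Rightarrow> (nat \<Rightarrow> poly3) set" where
  "free_module ds = {a. \<forall>i\<ge>length ds. a i = 0}"

definition twist_part :: "nat \<Rightarrow> nat \<Rightarrow> poly3 set" where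
  "twist_part d r = {p. \<forall>m\<in>Poly_Mapping.keys p. mono_deg m + d = r}"

definition graded_part :: "nat list \<Rightarrow> nat \<Rightarrow> (nat \<Rightarrow> poly3) set" where
  "graded_part ds r = {a \<in> free_module ds. \<forall>i<length ds. a i \<in> twist_part (ds ! i) r}"

definition graded_hom ::
    "nat list \<Rightarrow> nat list \<Rightarrow> ((nat \<Rightarrow> poly3) \<Rightarrow> (nat \<Rightarrow> poly3)) \<Rightarrow> bool" where
  "graded_hom ds es \<phi> \<longleftrightarrow>
     \<phi> ` free_module ds \<subseteq> free_module es \<and>
     (\<forall>a\<in>free_module ds. \<forall>b\<in>free_module ds. \<phi> (\<lambda>i. a i + b i) = (\<lambda>i. \<phi> a i + \<phi> b i)) \<and>
     (\<forall>p. \<forall>a\<in>free_module ds. \<phi> (\<lambda>i. p * a i) = (\<lambda>i. p * \<phi> a i)) \<and>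
     (\<forall>r. \<phi> ` graded_part ds r \<subseteq> graded_part es r)"

text \<open>Here \<open>M\<close> is a graded submodule of the graded free module given by \<open>es\<close>, the \<open>i\<close>-th module
  of the resolution is the one given by \<open>F i\<close>, \<open>\<phi> 0\<close> is the augmentation onto \<open>M\<close>, and
  \<open>\<phi> (Suc i)\<close> is the differential from the module \<open>F (Suc i)\<close> to the module \<open>F i\<close>.\<close>

definition minimal_graded_free_resolution ::
    "nat list \<Rightarrow> (nat \<Rightarrow> poly3) set \<Rightarrow> (nat \<Rightarrow> nat list)
      \<Rightarrow> (nat \<Rightarrow> (nat \<Rightarrow> poly3) \<Rightarrow> (nat \<Rightarrow> poly3)) \<Rightarrow> bool" where
  "minimal_graded_free_resolution es M F \<phi> \<longleftrightarrow>
     graded_hom (F 0) es (\<phi> 0) \<and>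
     \<phi> 0 ` free_module (F 0) = M \<and>
     (\<forall>i. graded_hom (F (Suc i)) (F i) (\<phi> (Suc i)) \<and>
          \<phi> (Suc i) ` free_module (F (Suc i)) = {a \<in> free_module (F i). \<phi> i a = (\<lambda>_. 0)} \<and>
          (\<forall>a\<in>free_module (F (Suc i)). \<forall>k. \<phi> (Suc i) a k \<in> irrelevant_ideal))"

definition resolution_of_form :: "nat list \<Rightarrow> (nat \<Rightarrow> poly3) set \<Rightarrow> nat list list \<Rightarrow> bool" where
  "resolution_of_form es M dss \<longleftrightarrow>
     (\<exists>\<phi>. minimal_graded_free_resolution es M (\<lambda>i. if i < length dss then dss ! i else []) \<phi>)"

text \<open>The number of summands \<open>S(-j)\<close> in the \<open>i\<close>-th module of a minimal graded free resolution;
  it does not depend on the resolution.\<close>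

definition graded_betti :: "nat list \<Rightarrow> (nat \<Rightarrow> poly3) set \<Rightarrow> nat \<Rightarrow> nat \<Rightarrow> nat" where
  "graded_betti es M i j =
     (THE n. \<exists>F \<phi>. minimal_graded_free_resolution es M F \<phi> \<and> count_list (F i) j = n)"


section \<open>The module of algebraic relations\<close>

text \<open>\<open>AR f\<close> is a graded submodule of \<open>S\<^sup>3 = free_module [0, 0, 0]\<close>.\<close>

definition AR :: "poly3 \<Rightarrow> (nat \<Rightarrow> poly3) set" where
  "AR f = {a \<in> free_module [0, 0, 0].
     a 0 * partial_deriv 1 f + a 1 * partial_deriv 2 f + a 2 * partial_deriv 3 f = 0}"


section \<open>Line arrangements in the complex projective plane\<close>

definition proj_plane :: "(complex ^ 3) set set" where
  "proj_plane = {vec.span {v} | v. v \<noteq> 0}"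

definition zero_locus :: "poly3 \<Rightarrow> (complex ^ 3) set set" where
  "zero_locus f = {p \<in> proj_plane. \<forall>v\<in>p. eval_poly3 f v = 0}"

definition proj_lines :: "(complex ^ 3) set set set" where
  "proj_lines = {zero_locus l | l. is_form 1 l \<and> l \<noteq> 0}"

definition lines_of :: "poly3 \<Rightarrow> (complex ^ 3) set set set" where
  "lines_of f = {L \<in> proj_lines. L \<subseteq> zero_locus f}"

text \<open>The curve \<open>f = 0\<close> is the union of \<open>n\<close> distinct lines. As \<open>n\<close> is also the degree of \<open>f\<close>, the
  curve is reduced.\<close>

definition defines_line_arrangement :: "nat \<Rightarrow> poly3 \<Rightarrow> bool" where
  "defines_line_arrangement n f \<longleftrightarrow>
     is_form n f \<and> card (lines_of f) = n \<and> zero_locus f = \<Union>(lines_of f)"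

text \<open>The empty subfamily contributes the whole plane, the least element for reverse inclusion.\<close>

definition intersection_lattice :: "(complex ^ 3) set set set \<Rightarrow> (complex ^ 3) set set set" where
  "intersection_lattice A = {proj_plane \<inter> \<Inter>B | B. B \<subseteq> A \<and> proj_plane \<inter> \<Inter>B \<noteq> {}}"

definition isomorphic_lattices ::
    "(complex ^ 3) set set set \<Rightarrow> (complex ^ 3) set set set \<Rightarrow> bool" where
  "isomorphic_lattices A B \<longleftrightarrow>
     (\<exists>h. bij_betw h (intersection_lattice A) (intersection_lattice B) \<and>
          (\<forall>X\<in>intersection_lattice A. \<forall>Y\<in>intersection_lattice A. Y \<subseteq> X \<longleftrightarrow> h Y \<subseteq> h X))"

definition ziegler_pair2 :: "poly3 \<Rightarrow> poly3 \<Rightarrow> bool" where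
  "ziegler_pair2 f g \<longleftrightarrow>
     (\<exists>n>0. defines_line_arrangement n f) \<and> (\<exists>n>0. defines_line_arrangement n g) \<and>
     isomorphic_lattices (lines_of f) (lines_of g) \<and>
     (\<exists>i j. graded_betti [0, 0, 0] (AR f) i j \<noteq> graded_betti [0, 0, 0] (AR g) i j)"


section \<open>The family of arrangements\<close>

definition A_form :: "complex \<Rightarrow> complex \<Rightarrow> poly3" where
  "A_form s t =
     Const (- s * t^2 + s * t + t^3 - t) * Var 1
       + Const (- s * t + t^2) * Var 2
       + Const (- s * t^2 + t^3) * Var 3"

definition B_form :: "complex \<Rightarrow> complex \<Rightarrow> poly3" where
  "B_form s t =
     Const (s^2 * t - s * t^2 - 2 * s * t + t^2 + t) * Var 1
       + Const (s^3 * t - s^3 - 2 * s^2 * t^2 + s^2 * t + s^2 + s * t^3 - s * t) * Var 2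
       + Const (s^2 * t - 2 * s * t^2 + t^3) * Var 3"

definition Q' :: "complex \<Rightarrow> complex \<Rightarrow> poly3" where
  "Q' s t =
     (let x = Var 1; y = Var 2; z = Var 3 in
       x * y * z * (x + y + z) * (x + y + Const t * z) * (Const t * x + Const s * y + Const t * z)
       * (y + z) * (x + Const (s - t) * y) * (Const (- s + t + 1) * x + Const (- s + t) * z)
       * (x + Const s * y + Const t * z) * A_form s t * B_form s t)"

end

theory Submission
  imports Defs
begin

text \<open>Let \<open>f\<close> be a product of distinct lines. Two algebraic relations \<open>\<rho>, \<sigma>\<close> among the partial
  derivatives of \<open>f\<close> are orthogonal to the gradient, hence \<open>\<rho> \<times> \<sigma>\<close> is parallel to it. Saito's
  argument makes the factor a polynomial: a relation is a derivation killing \<open>f\<close>, so every linear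
  factor \<open>\<alpha>\<close> of \<open>f\<close> divides \<open>\<rho>(\<alpha>)\<close>; therefore \<open>\<alpha>\<close>, and then \<open>f\<close> itself, divides the
  determinant of the Euler field, \<open>\<rho>\<close> and \<open>\<sigma>\<close>, and Euler's formula gives
  \<open>\<rho> \<times> \<sigma> = k \<nabla>f\<close> (\<open>cross_relations\<close>).

  Now let \<open>\<rho>\<^sub>0, \<dots>, \<rho>\<^sub>3\<close> satisfy two linear relations, the columns of a \<open>4 \<times> 2\<close> matrix, such that
  \<open>\<rho>\<^sub>2 \<times> \<rho>\<^sub>3\<close> is a nonzero constant times the complementary minor times \<open>\<nabla>f\<close>. For any algebraic
  relation \<open>\<rho>\<close> write \<open>\<rho> \<times> \<rho>\<^sub>i = g\<^sub>i \<nabla>f\<close>. The vector \<open>g\<close> is annihilated by the transposed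
  matrix. If the ideal of \<open>2 \<times> 2\<close> minors contains powers of \<open>x\<close>, \<open>y\<close> and \<open>z\<close>, then the
  Buchsbaum-Rim complex \<open>S\<^sup>2 \<rightarrow> S\<^sup>4 \<rightarrow> S\<^sup>4 \<rightarrow> S\<^sup>2\<close> of the matrix is exact except
  at its right end (\<open>exact_1\<close>, \<open>exact_2\<close>, \<open>columns_inj\<close>), so \<open>g\<close> comes from a vector \<open>u\<close>, and \<open>\<rho>\<close> is a constant times \<open>\<Sum> u\<^sub>i \<rho>\<^sub>i\<close>
  (\<open>generated\<close>). The same complex shows that the two columns generate all relations among the
  \<open>\<rho>\<^sub>i\<close> (\<open>kernel\<close>). In this way a free resolution is certified by a few polynomial identities,
  with no Groebner basis and no Hilbert function.

  All data have coefficients in \<open>\<int>[\<surd>3]\<close>, and the identities are checked by computing with lists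
  of integers. For the second arrangement the \<open>\<rho>\<^sub>i\<close> have degrees \<open>9, 8, 7, 6\<close> and the columns
  degrees \<open>10\<close> and \<open>9\<close>. The first one has three generators of degrees \<open>8, 7, 6\<close> and one
  relation of degree \<open>10\<close>; it fits the same pattern with \<open>\<rho>\<^sub>0 = 0\<close> and the trivial relation
  \<open>1 \<cdot> \<rho>\<^sub>0 = 0\<close>.

  The graded Betti numbers differ because the number of generators of degree \<open>9\<close> in a minimal
  resolution is determined by the module (\<open>graded_betti_0\<close>): it is \<open>0\<close> for the first arrangement
  and \<open>1\<close> for the second. The lattices are isomorphic because the intersection lattice is
  determined by the concurrent triples of lines (\<open>isomorphic_lattices_of_pencils\<close>), and those are
  the same for both arrangements when the lines are numbered in the order of the factors.\<close>

section \<open>Polynomials in three variables\<close>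

abbreviation lookup where "lookup \<equiv> Poly_Mapping.lookup"
abbreviation keys where "keys \<equiv> Poly_Mapping.keys"
abbreviation single where "single \<equiv> Poly_Mapping.single"

lemma poly_sum_single: "p = (\<Sum>m\<in>keys p. single m (lookup p m))"
proof (rule poly_mapping_eqI)
  fix k
  have "lookup (\<Sum>m\<in>keys p. single m (lookup p m)) k
      = (\<Sum>m\<in>keys p. if m = k then lookup p m else 0)"
    by (simp add: lookup_sum lookup_single when_def)
  also have "\<dots> = lookup p k" by (simp add: sum.delta in_keys_iff)
  finally show "lookup p k = lookup (\<Sum>m\<in>keys p. single m (lookup p m)) k" by simp
qed

lemma poly_induct [case_names single plus]:
  fixes p :: "'a \<Rightarrow>\<^sub>0 'b::comm_monoid_add"
  assumes "\<And>m c. P (single m c)" and "\<And>p q. P p \<Longrightarrow> P q \<Longrightarrow> P (p + q)"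
  shows "P p"
proof -
  have "P (\<Sum>m\<in>A. single m (lookup p m))" if "finite A" for A
    using that
  proof induction
    case empty
    show ?case using assms(1)[of undefined 0] by simp
  next
    case (insert x F)
    then show ?case using assms by simp
  qed
  from this[of "keys p"] show ?thesis using poly_sum_single[of p] by simp
qed

lemma Const_add: "Const (a + b) = Const a + Const b"
  by (simp add: Const_def single_add)
lemma Const_mult: "Const (a * b) = Const a * Const b"
  by (simp add: Const_def mult_single)
lemma Const_0 [simp]: "Const 0 = 0" by (simp add: Const_def)
lemma Const_1 [simp]: "Const 1 = 1" by (simp add: Const_def)
lemma Const_uminus: "Const (- a) = - Const a"
  by (simp add: Const_def single_uminus)
lemma Const_diff: "Const (a - b) = Const a - Const b"
  by (simp add: Const_def single_diff)
lemma Const_eq_0 [simp]: "Const c = 0 \<longleftrightarrow> c = 0"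
  by (metis Const_def lookup_single_eq lookup_zero single_zero)
lemma Const_of_nat: "Const (of_nat n) = of_nat n"
  by (induction n) (simp_all add: Const_add)

lemma Const_inverse: "c \<noteq> 0 \<Longrightarrow> Const (1 / c) * Const c = 1"
  by (simp flip: Const_mult)

lemma Const_mult_dvd: "c \<noteq> 0 \<Longrightarrow> Const c * p dvd q \<longleftrightarrow> p dvd q"
proof
  assume "c \<noteq> 0" "p dvd q"
  then obtain k where "q = p * k" by blast
  then have "q = Const c * p * (Const (1 / c) * k)"
    using Const_inverse[OF \<open>c \<noteq> 0\<close>] by algebra
  then show "Const c * p dvd q" by simp
qed (blast intro: dvd_mult_right)

lemma dvd_Const_mult: "c \<noteq> 0 \<Longrightarrow> p dvd Const c * q \<longleftrightarrow> p dvd q"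
proof
  assume "c \<noteq> 0" "p dvd Const c * q"
  then obtain k where "Const c * q = p * k" by blast
  then have "q = p * (Const (1 / c) * k)"
    using Const_inverse[OF \<open>c \<noteq> 0\<close>] by algebra
  then show "p dvd q" by simp
qed simp


subsection \<open>Substitution\<close>

text \<open>Evaluation at a point and substitution of polynomials for the variables are both instances: the
  first maps coefficients to themselves, the second to constant polynomials.\<close>

definition insertion :: "(complex \<Rightarrow> 'a::comm_ring_1) \<Rightarrow> (3 \<Rightarrow> 'a) \<Rightarrow> poly3 \<Rightarrow> 'a" where
  "insertion h u p = (\<Sum>m\<in>keys p. h (lookup p m) * (\<Prod>i\<in>UNIV. u i ^ lookup m i))"

locale coeff_hom =
  fixes h :: "complex \<Rightarrow> 'a::comm_ring_1" and u :: "3 \<Rightarrow> 'a"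
  assumes h_add: "h (a + b) = h a + h b"
    and h_mult: "h (a * b) = h a * h b"
    and h_one: "h 1 = 1"
begin

lemma h_zero: "h 0 = 0"
  using h_add[of 0 0] by simp

lemma insertion_superset:
  assumes "finite A" "keys p \<subseteq> A"
  shows "insertion h u p = (\<Sum>m\<in>A. h (lookup p m) * (\<Prod>i\<in>UNIV. u i ^ lookup m i))"
  unfolding insertion_def
  by (rule sum.mono_neutral_left) (use assms in \<open>auto simp: in_keys_iff h_zero\<close>)

lemma insertion_add: "insertion h u (p + q) = insertion h u p + insertion h u q"
proof -
  let ?A = "keys p \<union> keys q"
  have "keys (p + q) \<subseteq> ?A" by (rule Poly_Mapping.keys_add)
  then show ?thesis
    using insertion_superset[of ?A p] insertion_superset[of ?A q]
      insertion_superset[of ?A "p + q"]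
    by (simp add: lookup_add h_add distrib_right sum.distrib)
qed

lemma insertion_single:
  "insertion h u (single m c) = h c * (\<Prod>i\<in>UNIV. u i ^ lookup m i)"
  by (cases "c = 0") (simp_all add: insertion_def h_zero)

lemma insertion_mult: "insertion h u (p * q) = insertion h u p * insertion h u q"
proof (induction p rule: poly_induct)
  case (single m c)
  show ?case
  proof (induction q rule: poly_induct)
    case (single n d)
    show ?case
      by (simp add: mult_single insertion_single h_mult lookup_add power_add prod.distrib mult_ac)
  next
    case (plus p q)
    then show ?case by (simp add: insertion_add distrib_left)
  qed
next
  case (plus p q)
  then show ?case by (simp add: insertion_add distrib_right)
qed

lemma insertion_Const [simp]: "insertion h u (Const c) = h c"
  by (simp add: Const_def insertion_single)

lemma insertion_one [simp]: "insertion h u 1 = 1"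
  using insertion_Const[of 1] by (simp add: h_one)

lemma insertion_zero [simp]: "insertion h u 0 = 0"
  using insertion_Const[of 0] by (simp add: h_zero)

lemma insertion_Var [simp]: "insertion h u (Var k) = u k"
proof -
  have "(\<Prod>i\<in>UNIV. u i ^ (if k = i then Suc 0 else 0)) = (\<Prod>i\<in>UNIV. if k = i then u i else 1)"
    by (rule prod.cong) auto
  also have "\<dots> = u k" by simp
  finally show ?thesis
    by (simp add: Var_def insertion_single h_one lookup_single when_def)
qed

lemma insertion_prod: "insertion h u (prod f A) = (\<Prod>i\<in>A. insertion h u (f i))"
  by (induction A rule: infinite_finite_induct) (simp_all add: insertion_mult)

lemma insertion_sum: "insertion h u (sum f A) = (\<Sum>i\<in>A. insertion h u (f i))"
  by (induction A rule: infinite_finite_induct) (simp_all add: insertion_add)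

end

interpretation evaluation: coeff_hom "\<lambda>c. c" "\<lambda>i. v $ i" for v :: "complex ^ 3"
  by unfold_locales auto

lemma eval_poly3_insertion: "eval_poly3 p v = insertion (\<lambda>c. c) (\<lambda>i. v $ i) p"
  by (simp add: eval_poly3_def insertion_def)

lemma eval_poly3_mult: "eval_poly3 (p * q) v = eval_poly3 p v * eval_poly3 q v"
  unfolding eval_poly3_insertion by (rule evaluation.insertion_mult)

lemma eval_poly3_Const [simp]: "eval_poly3 (Const c) v = c"
  by (simp add: eval_poly3_insertion)

lemma eval_poly3_one [simp]: "eval_poly3 1 v = 1"
  by (simp add: eval_poly3_insertion)

lemma eval_poly3_prod: "eval_poly3 (prod g A) v = (\<Prod>i\<in>A. eval_poly3 (g i) v)"
  by (simp add: eval_poly3_insertion evaluation.insertion_prod)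

lemma eval_poly3_add: "eval_poly3 (p + q) v = eval_poly3 p v + eval_poly3 q v"
  unfolding eval_poly3_insertion by (rule evaluation.insertion_add)

lemma eval_poly3_zero: "eval_poly3 0 v = 0"
  unfolding eval_poly3_insertion by simp

lemma eval_poly3_Var: "eval_poly3 (Var i) v = v $ i"
  unfolding eval_poly3_insertion by simp

lemma eval_poly3_power: "eval_poly3 (p ^ n) v = eval_poly3 p v ^ n"
  by (induction n) (simp_all add: eval_poly3_mult)

interpretation substitution: coeff_hom Const u for u :: "3 \<Rightarrow> poly3"
  by unfold_locales (auto simp: Const_add Const_mult)

lemma single_eq_prod: "single m c = Const c * (\<Prod>i\<in>UNIV. Var i ^ lookup m i)"
proof -
  have pow: "Var i ^ n = single (single i n) 1" for i n
    by (induction n) (simp_all add: Var_def mult_single flip: single_add)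
  have "m = single 1 (lookup m 1) + single 2 (lookup m 2) + single 3 (lookup m 3)"
  proof (rule poly_mapping_eqI)
    fix k :: 3
    show "lookup m k = lookup (single 1 (lookup m 1) + single 2 (lookup m 2) + single 3 (lookup m 3)) k"
      using exhaust_3[of k] by (auto simp: lookup_add lookup_single)
  qed
  then have "single m (1::complex)
      = single (single 1 (lookup m 1) + single 2 (lookup m 2) + single 3 (lookup m 3)) 1"
    by (rule arg_cong)
  also have "\<dots> = (\<Prod>i\<in>UNIV. Var i ^ lookup m i)"
    by (simp only: pow UNIV_3) (simp add: mult_single add.assoc)
  finally have "single m (1::complex) = (\<Prod>i\<in>UNIV. Var i ^ lookup m i)" .
  moreover have "single m c = Const c * single m 1"
    by (simp add: Const_def mult_single)
  ultimately show ?thesis by simp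
qed

lemma poly3_induct [case_names Const Var add mult]:
  assumes "\<And>c. P (Const c)" "\<And>i. P (Var i)"
    and "\<And>p q. P p \<Longrightarrow> P q \<Longrightarrow> P (p + q)" and "\<And>p q. P p \<Longrightarrow> P q \<Longrightarrow> P (p * q)"
  shows "P p"
proof (induction p rule: poly_induct)
  case (single m c)
  have pow: "P (Var i ^ n)" for i n
    using assms(1)[of 1] by (induction n) (auto intro: assms)
  have "P (\<Prod>i\<in>A. Var i ^ lookup m i)" if "finite A" for A
    using that assms(1)[of 1] by induction (auto intro: assms pow)
  then show ?case using assms by (simp add: single_eq_prod)
qed (rule assms)


subsection \<open>Forms\<close>

lemma mono_deg_add [simp]: "mono_deg (m + n) = mono_deg m + mono_deg n"
  by (simp add: mono_deg_def lookup_add sum.distrib)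

lemma mono_deg_0 [simp]: "mono_deg 0 = 0"
  by (simp add: mono_deg_def)

lemma mono_deg_single [simp]: "mono_deg (single i n) = n"
  by (simp add: mono_deg_def lookup_single when_def)

lemma is_form_0 [simp]: "is_form d 0"
  by (simp add: is_form_def)

lemma is_form_Const [simp]: "is_form 0 (Const c)"
  by (cases "c = 0") (simp_all add: is_form_def Const_def)

lemma is_form_Var [simp]: "is_form 1 (Var i)"
  by (simp add: is_form_def Var_def)

lemma is_form_add: "is_form d p \<Longrightarrow> is_form d q \<Longrightarrow> is_form d (p + q)"
  unfolding is_form_def using Poly_Mapping.keys_add[of p q] by blast

lemma is_form_mult: "is_form d p \<Longrightarrow> is_form e q \<Longrightarrow> is_form (d + e) (p * q)"
  unfolding is_form_def using Poly_Mapping.keys_mult[of p q] by fastforce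

lemma is_form_sum: "(\<And>i. i \<in> A \<Longrightarrow> is_form d (f i)) \<Longrightarrow> is_form d (sum f A)"
  by (induction A rule: infinite_finite_induct) (auto intro: is_form_add)

lemma is_form_power: "is_form d p \<Longrightarrow> is_form (n * d) (p ^ n)"
proof (induction n)
  case 0
  show ?case using is_form_Const[of 1] by simp
next
  case (Suc n)
  then show ?case using is_form_mult[of d p "n * d" "p ^ n"] by simp
qed


subsection \<open>Partial derivatives\<close>

lemma partial_deriv_superset:
  assumes "finite A" "keys p \<subseteq> A"
  shows "partial_deriv i p = (\<Sum>m\<in>A. single (m - single i 1) (of_nat (lookup m i) * lookup p m))"
  unfolding partial_deriv_def
  by (rule sum.mono_neutral_left) (use assms in \<open>auto simp: in_keys_iff\<close>)

lemma partial_deriv_add: "partial_deriv i (p + q) = partial_deriv i p + partial_deriv i q"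
proof -
  let ?A = "keys p \<union> keys q"
  have "keys (p + q) \<subseteq> ?A" by (rule Poly_Mapping.keys_add)
  then show ?thesis
    using partial_deriv_superset[of ?A p] partial_deriv_superset[of ?A q]
      partial_deriv_superset[of ?A "p + q"]
    by (simp add: lookup_add distrib_left single_add sum.distrib)
qed

lemma partial_deriv_single:
  "partial_deriv i (single m c) = single (m - single i 1) (of_nat (lookup m i) * c)"
  by (cases "c = 0") (simp_all add: partial_deriv_def)

lemma partial_deriv_mult:
  "partial_deriv i (p * q) = partial_deriv i p * q + p * partial_deriv i q"
proof (induction p rule: poly_induct)
  case (single m c)
  show ?case
  proof (induction q rule: poly_induct)
    case (single n d)
    have shift: "single (m + n - single i 1) (of_nat (lookup m i) * e) = 
        single (m - single i 1 + n) (of_nat (lookup m i) * e)" for m n and e :: complex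
    proof (cases "lookup m i = 0")
      case False
      have "m + n - single i 1 = m - single i 1 + n"
      proof (rule poly_mapping_eqI)
        fix k
        show "lookup (m + n - single i 1) k = lookup (m - single i 1 + n) k"
          using False by (cases "k = i") (auto simp: lookup_add lookup_minus lookup_single)
      qed
      then show ?thesis by simp
    qed simp
    have "partial_deriv i (single m c * single n d)
        = single (m + n - single i 1) (of_nat (lookup m i) * (c * d))
          + single (m + n - single i 1) (of_nat (lookup n i) * (c * d))"
      by (simp add: mult_single partial_deriv_single lookup_add distrib_right single_add)
    also have "\<dots> = single (m - single i 1 + n) (of_nat (lookup m i) * (c * d))
          + single (n - single i 1 + m) (of_nat (lookup n i) * (c * d))"
      using shift[of m n "c * d"] shift[of n m "c * d"] by (simp add: add.commute)
    also have "\<dots> = partial_deriv i (single m c) * single n d + single m c * partial_deriv i (single n d)"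
      by (simp add: mult_single partial_deriv_single mult_ac add.commute)
    finally show ?case .
  next
    case (plus p q)
    then show ?case by (simp add: partial_deriv_add distrib_left)
  qed
next
  case (plus p q)
  then show ?case by (simp add: partial_deriv_add distrib_right)
qed

lemma partial_deriv_Const [simp]: "partial_deriv i (Const c) = 0"
  by (simp add: Const_def partial_deriv_single)

lemma partial_deriv_Var: "partial_deriv i (Var j) = (if i = j then 1 else 0)"
  by (simp add: Var_def partial_deriv_single lookup_single when_def)

lemma partial_deriv_sum: "partial_deriv i (sum f A) = (\<Sum>j\<in>A. partial_deriv i (f j))"
  using partial_deriv_Const[of i 0]
  by (induction A rule: infinite_finite_induct) (simp_all add: partial_deriv_add)


section \<open>Linear forms\<close>

definition lin :: "complex ^ 3 \<Rightarrow> poly3" where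
  "lin l = (\<Sum>i\<in>UNIV. Const (l $ i) * Var i)"

lemma is_form_lin: "is_form 1 (lin l)"
  unfolding lin_def
  using is_form_mult[OF is_form_Const is_form_Var] by (auto intro!: is_form_sum)

lemma partial_deriv_lin: "partial_deriv i (lin l) = Const (l $ i)"
  by (simp add: lin_def partial_deriv_sum partial_deriv_mult partial_deriv_Var if_distrib
      cong: if_cong)

lemma eval_lin: "eval_poly3 (lin l) v = (\<Sum>i\<in>UNIV. l $ i * v $ i)"
  by (simp add: eval_poly3_insertion lin_def evaluation.insertion_sum evaluation.insertion_mult)

lemma lin_eq_0_iff: "lin l = 0 \<longleftrightarrow> l = 0"
proof
  assume "lin l = 0"
  then have "Const (l $ i) = 0" for i
    using partial_deriv_lin[of i l] partial_deriv_Const[of i 0] by simp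
  then show "l = 0" by (simp add: vec_eq_iff)
qed (simp add: lin_def)

text \<open>Modulo a linear form with nonzero coefficient at \<open>x\<^sub>k\<close> the variable \<open>x\<^sub>k\<close> can be eliminated;
  the ring endomorphism that does so has the multiples of the linear form as its kernel.\<close>

definition eliminate :: "complex ^ 3 \<Rightarrow> 3 \<Rightarrow> poly3 \<Rightarrow> poly3" where
  "eliminate l k = insertion Const (\<lambda>i. if i = k then Var k - Const (1 / l $ k) * lin l else Var i)"

lemma eliminate_lin: "eliminate l k (lin m) = lin m - Const (m $ k / l $ k) * lin l"
proof -
  have "eliminate l k (lin m) = (\<Sum>i\<in>UNIV. Const (m $ i) * eliminate l k (Var i))"
    by (simp add: lin_def[of m] eliminate_def substitution.insertion_sum substitution.insertion_mult)
  also have "\<dots> = (\<Sum>i\<in>UNIV. Const (m $ i) * Var i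
      - (if i = k then Const (m $ k) * Const (1 / l $ k) * lin l else 0))"
    by (intro sum.cong) (auto simp: eliminate_def algebra_simps)
  also have "\<dots> = lin m - Const (m $ k) * Const (1 / l $ k) * lin l"
    by (simp add: sum_subtractf lin_def[of m])
  finally show ?thesis by (simp flip: Const_mult)
qed

lemma dvd_diff_eliminate: "lin l dvd p - eliminate l k p"
proof (induction p rule: poly3_induct)
  case (mult p q)
  have "p * q - eliminate l k (p * q) = p * (q - eliminate l k q) + (p - eliminate l k p) * eliminate l k q"
    by (simp add: eliminate_def substitution.insertion_mult algebra_simps)
  then show ?case using mult by simp
next
  case (add p q)
  have "p + q - eliminate l k (p + q) = (p - eliminate l k p) + (q - eliminate l k q)"
    by (simp add: eliminate_def substitution.insertion_add)
  then show ?case using add by (metis dvd_add)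
qed (simp_all add: eliminate_def)

lemma lin_dvd_iff: "l $ k \<noteq> 0 \<Longrightarrow> lin l dvd p \<longleftrightarrow> eliminate l k p = 0"
proof
  assume "l $ k \<noteq> 0" "lin l dvd p"
  then show "eliminate l k p = 0"
    using eliminate_lin[of l k l] by (auto simp: dvd_def eliminate_def substitution.insertion_mult)
next
  assume "eliminate l k p = 0"
  then show "lin l dvd p" using dvd_diff_eliminate[of l p k] by simp
qed

text \<open>Eliminating a variable is a homomorphism to a domain with kernel generated by the linear form.\<close>

lemma lin_prime: "l \<noteq> 0 \<Longrightarrow> lin l dvd p * q \<Longrightarrow> lin l dvd p \<or> lin l dvd q"
proof -
  assume "l \<noteq> 0" "lin l dvd p * q"
  then obtain k where "l $ k \<noteq> 0" by (auto simp: vec_eq_iff)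
  then show ?thesis
    using \<open>lin l dvd p * q\<close> by (simp add: lin_dvd_iff eliminate_def substitution.insertion_mult)
qed

text \<open>The coordinates of \<open>cross u v\<close> are the \<open>2\<close>-by-\<open>2\<close> minors of the matrix with rows \<open>u, v\<close>.\<close>

definition cross :: "'a::comm_ring ^ 3 \<Rightarrow> 'a ^ 3 \<Rightarrow> 'a ^ 3" where
  "cross u v = vector [u $ 2 * v $ 3 - u $ 3 * v $ 2,
                       u $ 3 * v $ 1 - u $ 1 * v $ 3,
                       u $ 1 * v $ 2 - u $ 2 * v $ 1]"

lemma cross_nth [simp]:
  "cross u v $ 1 = u $ 2 * v $ 3 - u $ 3 * v $ 2"
  "cross u v $ 2 = u $ 3 * v $ 1 - u $ 1 * v $ 3"
  "cross u v $ 3 = u $ 1 * v $ 2 - u $ 2 * v $ 1"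
  by (simp_all add: cross_def vector_3)

lemma lin_dvd_lin:
  assumes "lin l dvd lin m" shows "cross l m = 0"
proof (cases "l = 0")
  case True
  then show ?thesis by (simp add: cross_def vec_eq_iff forall_3)
next
  case False
  then obtain k where k: "l $ k \<noteq> 0" by (auto simp: vec_eq_iff)
  then have e: "lin m = Const (m $ k / l $ k) * lin l"
    using assms eliminate_lin[of l k m] by (simp add: lin_dvd_iff)
  have "m $ i = m $ k / l $ k * l $ i" for i
  proof -
    have "Const (m $ i) = Const (m $ k / l $ k) * Const (l $ i)"
      using arg_cong[OF e, of "partial_deriv i"]
      by (simp add: partial_deriv_lin partial_deriv_mult)
    also have "\<dots> = Const (m $ k / l $ k * l $ i)" by (rule Const_mult[symmetric])
    finally show ?thesis
      by (metis Const_diff Const_eq_0 eq_iff_diff_eq_0)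
  qed
  then obtain t where "\<And>i. m $ i = t * l $ i" by blast
  then show ?thesis by (simp add: vec_eq_iff forall_3)
qed


section \<open>Algebraic relations among the partial derivatives of a product of lines\<close>

definition grad :: "poly3 \<Rightarrow> poly3 ^ 3" where
  "grad f = (\<chi> i. partial_deriv i f)"

definition dot :: "poly3 ^ 3 \<Rightarrow> poly3 ^ 3 \<Rightarrow> poly3" where
  "dot u v = (\<Sum>i\<in>UNIV. u $ i * v $ i)"

definition euler :: "poly3 ^ 3" where
  "euler = (\<chi> i. Var i)"

lemma dot_3: "dot u v = u $ 1 * v $ 1 + u $ 2 * v $ 2 + u $ 3 * v $ 3"
  by (simp add: dot_def sum_3)

lemma dot_grad_mult: "dot u (grad (p * q)) = dot u (grad p) * q + p * dot u (grad q)"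
  by (simp add: dot_3 grad_def partial_deriv_mult algebra_simps)

lemma dot_grad_Const: "dot u (grad (Const c)) = 0"
  by (simp add: dot_3 grad_def)

lemma dot_grad_lin: "dot u (grad (lin l)) = (\<Sum>i\<in>UNIV. Const (l $ i) * u $ i)"
  by (simp add: dot_def grad_def partial_deriv_lin mult.commute)

lemma dot_euler_lin: "dot euler (grad (lin l)) = lin l"
  unfolding dot_grad_lin by (simp add: lin_def euler_def)

lemma dot_euler_prod:
  "finite I \<Longrightarrow> dot euler (grad (\<Prod>i\<in>I. lin (l i))) = of_nat (card I) * (\<Prod>i\<in>I. lin (l i))"
proof (induction I rule: finite_induct)
  case empty
  show ?case using dot_grad_Const[of euler 1] by simp
next
  case (insert i I)
  then show ?case by (simp add: dot_grad_mult dot_euler_lin algebra_simps)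
qed

text \<open>The determinant of the Euler field and \<open>u, v\<close>. Combining its rows with the coefficients of the
  linear form \<open>\<alpha>\<close> gives the row \<open>\<alpha>, u(\<alpha>), v(\<alpha>)\<close>, all of whose entries are divisible by \<open>\<alpha>\<close>.\<close>

lemma det_dvd:
  assumes "l \<noteq> 0" "lin l dvd dot u (grad (lin l))" "lin l dvd dot v (grad (lin l))"
  shows "lin l dvd dot euler (cross u v)"
proof -
  obtain a where a: "dot u (grad (lin l)) = lin l * a" using assms(2) by blast
  obtain b where b: "dot v (grad (lin l)) = lin l * b" using assms(3) by blast
  let ?c = "\<lambda>i. Const (l $ i)"
  have a: "?c 1 * u $ 1 + ?c 2 * u $ 2 + ?c 3 * u $ 3 = lin l * a"
    using a by (simp add: dot_grad_lin sum_3)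
  have b: "?c 1 * v $ 1 + ?c 2 * v $ 2 + ?c 3 * v $ 3 = lin l * b"
    using b by (simp add: dot_grad_lin sum_3)
  have e: "?c 1 * euler $ 1 + ?c 2 * euler $ 2 + ?c 3 * euler $ 3 = lin l"
    by (simp add: lin_def euler_def sum_3)
  obtain k where k: "l $ k \<noteq> 0" using \<open>l \<noteq> 0\<close> by (auto simp: vec_eq_iff)
  have d: "dot euler (cross u v) = euler $ 1 * (u $ 2 * v $ 3 - u $ 3 * v $ 2)
      + euler $ 2 * (u $ 3 * v $ 1 - u $ 1 * v $ 3) + euler $ 3 * (u $ 1 * v $ 2 - u $ 2 * v $ 1)"
    by (simp add: dot_3)
  have "\<exists>w. ?c k * dot euler (cross u v) = lin l * w"
  proof -
    consider "k = 1" | "k = 2" | "k = 3" using exhaust_3[of k] by blast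
    then show ?thesis
    proof cases
      case 1
      have "?c 1 * dot euler (cross u v) = lin l * ((u $ 2 * v $ 3 - u $ 3 * v $ 2)
        + a * (v $ 2 * euler $ 3 - v $ 3 * euler $ 2) + b * (euler $ 2 * u $ 3 - euler $ 3 * u $ 2))"
        unfolding d using a b e by algebra
      then show ?thesis using 1 by blast
    next
      case 2
      have "?c 2 * dot euler (cross u v) = lin l * ((u $ 3 * v $ 1 - u $ 1 * v $ 3)
        + a * (v $ 3 * euler $ 1 - v $ 1 * euler $ 3) + b * (euler $ 3 * u $ 1 - euler $ 1 * u $ 3))"
        unfolding d using a b e by algebra
      then show ?thesis using 2 by blast
    next
      case 3
      have "?c 3 * dot euler (cross u v) = lin l * ((u $ 1 * v $ 2 - u $ 2 * v $ 1)
        + a * (v $ 1 * euler $ 2 - v $ 2 * euler $ 1) + b * (euler $ 1 * u $ 2 - euler $ 2 * u $ 1))"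
        unfolding d using a b e by algebra
      then show ?thesis using 3 by blast
    qed
  qed
  then have "lin l dvd ?c k * dot euler (cross u v)" unfolding dvd_def .
  then show ?thesis using dvd_Const_mult[OF k] by blast
qed

locale line_product =
  fixes n :: nat and l :: "nat \<Rightarrow> complex ^ 3" and c :: complex and f :: poly3
  assumes n_pos: "n > 0" and c_nz: "c \<noteq> 0"
    and distinct: "\<And>i j. i < n \<Longrightarrow> j < n \<Longrightarrow> i \<noteq> j \<Longrightarrow> cross (l i) (l j) \<noteq> 0"
    and l_nz: "\<And>i. i < n \<Longrightarrow> l i \<noteq> 0"
    and f_eq: "f = Const c * (\<Prod>i<n. lin (l i))"
begin

lemma lin_not_dvd_prod:
  assumes "i < n" "finite J" "J \<subseteq> {..<n} - {i}"
  shows "\<not> lin (l i) dvd (\<Prod>j\<in>J. lin (l j))"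
  using assms(2,3)
proof (induction J rule: finite_induct)
  case empty
  show ?case
  proof
    assume "lin (l i) dvd (\<Prod>j\<in>{}. lin (l j))"
    then obtain k where k: "1 = lin (l i) * k" by (auto simp: dvd_def)
    have "eval_poly3 1 0 = eval_poly3 (lin (l i)) 0 * eval_poly3 k 0"
      unfolding k by (rule eval_poly3_mult)
    then show False by (simp add: eval_lin)
  qed
next
  case (insert j J)
  have "\<not> lin (l i) dvd lin (l j)" using lin_dvd_lin distinct[of i j] insert assms(1) by auto
  then show ?case using insert lin_prime[OF l_nz[OF assms(1)]] by auto
qed

lemma prod_dvd:
  assumes "\<And>i. i < n \<Longrightarrow> lin (l i) dvd p" shows "f dvd p"
proof -
  have "(\<Prod>i<k. lin (l i)) dvd p" if "k \<le> n" for k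
    using that
  proof (induction k)
    case (Suc k)
    then obtain q where q: "p = (\<Prod>i<k. lin (l i)) * q" by auto
    have "\<not> lin (l k) dvd (\<Prod>i<k. lin (l i))"
      by (rule lin_not_dvd_prod) (use Suc in auto)
    then have "lin (l k) dvd q"
      using q assms[of k] lin_prime[of "l k"] l_nz[of k] Suc by auto
    then show ?case using q by (auto simp: mult_ac)
  qed simp
  from this[of n] show ?thesis by (simp add: f_eq Const_mult_dvd c_nz)
qed

lemma f_nz: "f \<noteq> 0"
  by (simp add: f_eq c_nz lin_eq_0_iff l_nz)

lemma dot_euler_f: "dot euler (grad f) = of_nat n * f"
  using dot_euler_prod[of "{..<n}" l] by (simp add: f_eq dot_grad_mult dot_grad_Const)

text \<open>Split \<open>f = \<alpha> g\<close>. From \<open>u(f) = 0\<close> the prime \<open>\<alpha>\<close> divides \<open>u(\<alpha>) g\<close>, but not \<open>g\<close>, which is a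
  product of other lines. So \<open>u\<close> is a logarithmic derivation.\<close>

lemma relation_log:
  assumes "dot u (grad f) = 0" "i < n"
  shows "lin (l i) dvd dot u (grad (lin (l i)))"
proof -
  let ?g = "\<Prod>j\<in>{..<n} - {i}. lin (l j)"
  have "f = Const c * (lin (l i) * ?g)"
    unfolding f_eq using assms(2) by (simp add: prod.remove[of _ i])
  then have "Const c * (dot u (grad (lin (l i))) * ?g + lin (l i) * dot u (grad ?g)) = 0"
    using assms(1) by (simp add: dot_grad_mult dot_grad_Const)
  then have "dot u (grad (lin (l i))) * ?g + lin (l i) * dot u (grad ?g) = 0"
    using c_nz by simp
  then have "dot u (grad (lin (l i))) * ?g = lin (l i) * (- dot u (grad ?g))"
    by (simp add: eq_neg_iff_add_eq_0)
  then have "lin (l i) dvd dot u (grad (lin (l i))) * ?g" by simp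
  moreover have "\<not> lin (l i) dvd ?g" by (rule lin_not_dvd_prod) (use assms in auto)
  ultimately show ?thesis using lin_prime[OF l_nz[OF assms(2)]] by blast
qed

lemma grad_nz: "grad f \<noteq> 0"
proof
  assume "grad f = 0"
  then have "of_nat n * f = 0" using dot_euler_f by (simp add: dot_3)
  then show False using f_nz n_pos by simp
qed

text \<open>Saito's criterion in the form needed for algebraic relations: the quotient of the determinant by
  \<open>f\<close> is, up to the degree of \<open>f\<close>, the factor between the cross product and the gradient.\<close>

lemma cross_relations:
  assumes u: "dot u (grad f) = 0" and v: "dot v (grad f) = 0"
  shows "\<exists>k. \<forall>i. cross u v $ i = k * grad f $ i"
proof -
  have "f dvd dot euler (cross u v)"
    by (intro prod_dvd det_dvd relation_log u v l_nz)
  then obtain k where k: "dot euler (cross u v) = f * k" by blast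
  let ?w = "cross u v" and ?g = "grad f"
  have par: "?g $ i * ?w $ j = ?g $ j * ?w $ i" for i j
  proof -
    have "?g $ 1 * ?w $ 2 = ?g $ 2 * ?w $ 1" "?g $ 1 * ?w $ 3 = ?g $ 3 * ?w $ 1"
      "?g $ 2 * ?w $ 3 = ?g $ 3 * ?w $ 2"
      using u v unfolding dot_3 cross_nth by algebra+
    then show ?thesis using exhaust_3[of i] exhaust_3[of j] by auto
  qed
  have "?w $ i = Const (1 / of_nat n) * k * ?g $ i" for i
  proof -
    have "of_nat n * f * ?w $ i = dot euler ?g * ?w $ i" by (simp add: dot_euler_f)
    also have "\<dots> = dot euler ?w * ?g $ i"
      using par[of 1 i] par[of 2 i] par[of 3 i] unfolding dot_3 by algebra
    also have "\<dots> = f * (k * ?g $ i)" by (simp add: k)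
    finally have "f * (of_nat n * ?w $ i) = f * (k * ?g $ i)" by (simp add: mult_ac)
    then have "of_nat n * ?w $ i = k * ?g $ i" using f_nz by simp
    moreover have "Const (1 / of_nat n) * of_nat n = 1"
      using Const_inverse[of "of_nat n"] n_pos by (simp add: Const_of_nat)
    ultimately show ?thesis by algebra
  qed
  then show ?thesis by blast
qed

end


section \<open>The Buchsbaum-Rim complex of a matrix with two columns\<close>

lemma sum_4: "(\<Sum>j<4. h j) = h 0 + h 1 + h 2 + h (3::nat)"
  by (simp add: eval_nat_numeral add.assoc)

lemma all_less_4: "(\<forall>i<4. P i) \<longleftrightarrow> P 0 \<and> P 1 \<and> P 2 \<and> P (3::nat)"
  by (auto simp: eval_nat_numeral less_Suc_eq)

text \<open>The matrix has rows \<open>(b i, e i)\<close> for \<open>i < 4\<close>. The maps of the complex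
  \<open>S\<^sup>2 \<rightarrow> S\<^sup>4 \<rightarrow> S\<^sup>4 \<rightarrow> S\<^sup>2\<close> are \<open>columns\<close> (the matrix), \<open>alternating\<close> (the skew-symmetric
  matrix of complementary minors) and the pairings with \<open>b\<close> and \<open>e\<close> (the transposed matrix).\<close>

locale two_columns =
  fixes b e :: "nat \<Rightarrow> poly3"
begin

definition minor :: "nat \<Rightarrow> nat \<Rightarrow> poly3" where
  "minor i j = b i * e j - b j * e i"

definition minor_ideal :: "poly3 set" where
  "minor_ideal = {p. \<exists>c :: nat \<Rightarrow> poly3. p = c 0 * minor 0 1 + c 1 * minor 0 2 + c 2 * minor 0 3
     + c 3 * minor 1 2 + c 4 * minor 1 3 + c 5 * minor 2 3}"

definition columns :: "poly3 \<Rightarrow> poly3 \<Rightarrow> nat \<Rightarrow> poly3" where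
  "columns v v' i = b i * v + e i * v'"

definition alternating :: "(nat \<Rightarrow> poly3) \<Rightarrow> nat \<Rightarrow> poly3" where
  "alternating w i = (if i = 0 then minor 3 2 * w 1 + minor 1 3 * w 2 + minor 2 1 * w 3
    else if i = 1 then minor 2 3 * w 0 + minor 3 0 * w 2 + minor 0 2 * w 3
    else if i = 2 then minor 3 1 * w 0 + minor 0 3 * w 1 + minor 1 0 * w 3
    else if i = 3 then minor 1 2 * w 0 + minor 2 0 * w 1 + minor 0 1 * w 2
    else 0)"

lemma alternating_simps:
  "alternating w 0 = minor 3 2 * w 1 + minor 1 3 * w 2 + minor 2 1 * w 3"
  "alternating w 1 = minor 2 3 * w 0 + minor 3 0 * w 2 + minor 0 2 * w 3"
  "alternating w 2 = minor 3 1 * w 0 + minor 0 3 * w 1 + minor 1 0 * w 3"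
  "alternating w 3 = minor 1 2 * w 0 + minor 2 0 * w 1 + minor 0 1 * w 2"
  by (simp_all add: alternating_def)

lemma minor_swap:
  "minor 3 2 = - minor 2 3" "minor 3 1 = - minor 1 3" "minor 2 1 = - minor 1 2"
  "minor 3 (Suc 0) = - minor (Suc 0) 3" "minor 2 (Suc 0) = - minor (Suc 0) 2"
  "minor 1 0 = - minor 0 1" "minor (Suc 0) 0 = - minor 0 (Suc 0)" "minor 2 0 = - minor 0 2" "minor 3 0 = - minor 0 3"
  by (simp_all add: minor_def)

lemma minor_same: "minor i i = 0"
  by (simp add: minor_def)

lemma alternating_columns: "i < 4 \<Longrightarrow> alternating (columns v v') i = 0"
proof -
  have "\<forall>i<4. alternating (columns v v') i = 0"
    unfolding all_less_4 alternating_simps by (simp add: minor_def columns_def algebra_simps)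
  then show "i < 4 \<Longrightarrow> alternating (columns v v') i = 0" by blast
qed

lemma minor_ideal_mult:
  assumes "p \<in> minor_ideal" shows "a * p \<in> minor_ideal"
proof -
  obtain c :: "nat \<Rightarrow> poly3" where "p = c 0 * minor 0 1 + c 1 * minor 0 2 + c 2 * minor 0 3
     + c 3 * minor 1 2 + c 4 * minor 1 3 + c 5 * minor 2 3"
    using assms unfolding minor_ideal_def by blast
  then have "a * p = (a * c 0) * minor 0 1 + (a * c 1) * minor 0 2 + (a * c 2) * minor 0 3
     + (a * c 3) * minor 1 2 + (a * c 4) * minor 1 3 + (a * c 5) * minor 2 3"
    by (simp add: algebra_simps)
  then show ?thesis
    unfolding minor_ideal_def mem_Collect_eq by (rule exI[of _ "\<lambda>i. a * c i"])
qed

lemma minor_ideal_induct [consumes 1, case_names add mult m01 m02 m03 m12 m13 m23]: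
  assumes p: "p \<in> minor_ideal"
    and add: "\<And>p q. P p \<Longrightarrow> P q \<Longrightarrow> P (p + q)" and mult: "\<And>a p. P p \<Longrightarrow> P (a * p)"
    and min: "P (minor 0 1)" "P (minor 0 2)" "P (minor 0 3)" "P (minor 1 2)" "P (minor 1 3)" "P (minor 2 3)"
  shows "P p"
  using p unfolding minor_ideal_def by (elim CollectE exE, hypsubst) (intro add mult min)

lemma exists_alternatingI:
  assumes "h 0 = minor 3 2 * w1 + minor 1 3 * w2 + minor 2 1 * w3"
    "h 1 = minor 2 3 * w0 + minor 3 0 * w2 + minor 0 2 * w3"
    "h 2 = minor 3 1 * w0 + minor 0 3 * w1 + minor 1 0 * w3"
    "h 3 = minor 1 2 * w0 + minor 2 0 * w1 + minor 0 1 * w2"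
  shows "\<exists>w. \<forall>i<4. h i = alternating w i"
proof -
  let ?w = "\<lambda>i. if i = 0 then w0 else if i = 1 then w1 else if i = 2 then w2 else w3"
  have "\<forall>i<4. h i = alternating ?w i"
    unfolding all_less_4 alternating_simps using assms by simp
  then show ?thesis by blast
qed

text \<open>Each minor is null-homotopic on the complex, by Cramer's rule; so the ideal of minors annihilates
  the homology at every place. This lemma and the next two say so for the three places, the last
  two modulo an ideal. The minor on the rows other than \<open>k\<close> and \<open>m\<close>, multiplied by
  a cycle \<open>g\<close>, is up to sign the image of the vector with entries \<open>g m\<close> and \<open>- g k\<close> in the rows
  \<open>k\<close> and \<open>m\<close>.\<close>

lemma minor_ideal_kills_H1:
  assumes g: "(\<Sum>i<4. b i * g i) = 0" "(\<Sum>i<4. e i * g i) = 0" and p: "p \<in> minor_ideal"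
  shows "\<exists>w. \<forall>i<4. p * g i = alternating w i"
proof -
  have "(\<Sum>j<4. minor i j * g j) = b i * (\<Sum>j<4. e j * g j) - e i * (\<Sum>j<4. b j * g j)" for i
    by (simp add: minor_def sum_distrib_left sum_subtractf algebra_simps)
  then have "(\<Sum>j<4. minor i j * g j) = 0" for i using g by simp
  from this[of 0] this[of 1] this[of 2] this[of 3]
  have K: "minor 0 1 * g 1 + minor 0 2 * g 2 + minor 0 3 * g 3 = 0"
    "minor 1 2 * g 2 + minor 1 3 * g 3 = minor 0 1 * g 0"
    "minor 2 3 * g 3 = minor 0 2 * g 0 + minor 1 2 * g 1"
    "minor 1 3 * g 1 + minor 2 3 * g 2 = - (minor 0 3 * g 0)"
    by (simp_all add: sum_4 minor_swap minor_same algebra_simps)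
  show ?thesis
    using p
  proof (induction rule: minor_ideal_induct)
    case (add p q)
    then obtain w w' where w: "\<forall>i<4. p * g i = alternating w i" and w': "\<forall>i<4. q * g i = alternating w' i" by blast
    have "\<forall>i<4. (p + q) * g i = alternating (\<lambda>i. w i + w' i) i"
      using w w' unfolding all_less_4 alternating_simps by (simp add: algebra_simps)
    then show ?case by (rule exI[of _ "\<lambda>i. w i + w' i"])
  next
    case (mult a p)
    then obtain w where w: "\<forall>i<4. p * g i = alternating w i" by blast
    have "\<forall>i<4. (a * p) * g i = alternating (\<lambda>i. a * w i) i"
      using w unfolding all_less_4 alternating_simps by (simp add: algebra_simps)
    then show ?case by (rule exI[of _ "\<lambda>i. a * w i"])
  next
    case m01
    show ?case
      by (rule exists_alternatingI[of _ 0 "g 3" "- g 2" 0], unfold minor_swap minor_same,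
          use K(2) in algebra, use K(1) in algebra, algebra, algebra)
  next
    case m02
    show ?case
      by (rule exists_alternatingI[of _ "- g 3" 0 "g 1" 0], unfold minor_swap minor_same,
          use K(3) in algebra, algebra, use K(1) in algebra, algebra)
  next
    case m03
    show ?case
      by (rule exists_alternatingI[of _ "g 2" "- g 1" 0 0], unfold minor_swap minor_same,
          use K(4) in algebra, algebra, algebra, use K(1) in algebra)
  next
    case m12
    show ?case
      by (rule exists_alternatingI[of _ 0 0 "- g 0" "g 3"], unfold minor_swap minor_same,
          algebra, use K(3) in algebra, use K(2) in algebra, algebra)
  next
    case m13
    show ?case
      by (rule exists_alternatingI[of _ 0 "g 0" 0 "- g 2"], unfold minor_swap minor_same,
          algebra, use K(4) in algebra, algebra, use K(2) in algebra)
  next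
    case m23
    show ?case
      by (rule exists_alternatingI[of _ "- g 0" 0 0 "g 1"], unfold minor_swap minor_same,
          algebra, algebra, use K(4) in algebra, use K(3) in algebra)
  qed
qed

lemma minor_ideal_kills_H2:
  assumes w: "\<And>i. i < 4 \<Longrightarrow> x dvd alternating w i" and p: "p \<in> minor_ideal"
  shows "\<exists>v v'. \<forall>i<4. x dvd p * w i - columns v v' i"
proof -
  have "\<exists>q. i < 4 \<longrightarrow> alternating w i = x * q" for i using w by (auto simp: dvd_def)
  then obtain q where "\<And>i. i < 4 \<Longrightarrow> alternating w i = x * q i" by metis
  from this[of 0] this[of 1] this[of 2] this[of 3]
  have "alternating w 0 = x * q 0" "alternating w 1 = x * q 1" "alternating w 2 = x * q 2" "alternating w 3 = x * q 3" by simp_all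
  note q = this[unfolded alternating_simps minor_def]
  have dvd: "p = x * r \<Longrightarrow> x dvd p" for p r by simp
  show ?thesis
    using p
  proof (induction rule: minor_ideal_induct)
    case (add p q)
    then obtain v v' u u' where v: "\<forall>i<4. x dvd p * w i - columns v v' i"
      and u: "\<forall>i<4. x dvd q * w i - columns u u' i" by blast
    have "\<forall>i<4. x dvd (p + q) * w i - columns (v + u) (v' + u') i"
    proof (intro allI impI)
      fix i :: nat assume "i < 4"
      then have "x dvd (p * w i - columns v v' i) + (q * w i - columns u u' i)"
        using v u by (intro dvd_add) auto
      then show "x dvd (p + q) * w i - columns (v + u) (v' + u') i"
        by (simp add: columns_def algebra_simps)
    qed
    then show ?case by blast
  next
    case (mult a p)
    then obtain v v' where v: "\<forall>i<4. x dvd p * w i - columns v v' i" by blast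
    have "\<forall>i<4. x dvd a * p * w i - columns (a * v) (a * v') i"
    proof (intro allI impI)
      fix i :: nat assume "i < 4"
      then have "x dvd a * (p * w i - columns v v' i)" using v by auto
      then show "x dvd a * p * w i - columns (a * v) (a * v') i"
        by (simp add: columns_def algebra_simps)
    qed
    then show ?case by blast
  next
    case m01
    show ?case
      by (rule exI[of _ "w 0 * e 1 - w 1 * e 0"], rule exI[of _ "b 0 * w 1 - b 1 * w 0"])
        (unfold all_less_4 columns_def minor_def, intro conjI, rule dvd[of _ 0], algebra,
          rule dvd[of _ 0], algebra, rule dvd[of _ "q 3"], use q in algebra, rule dvd[of _ "- q 2"], use q in algebra)
  next
    case m02
    show ?case
      by (rule exI[of _ "w 0 * e 2 - w 2 * e 0"], rule exI[of _ "b 0 * w 2 - b 2 * w 0"])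
        (unfold all_less_4 columns_def minor_def, intro conjI, rule dvd[of _ 0], algebra,
          rule dvd[of _ "- q 3"], use q in algebra, rule dvd[of _ 0], algebra, rule dvd[of _ "q 1"], use q in algebra)
  next
    case m03
    show ?case
      by (rule exI[of _ "w 0 * e 3 - w 3 * e 0"], rule exI[of _ "b 0 * w 3 - b 3 * w 0"])
        (unfold all_less_4 columns_def minor_def, intro conjI, rule dvd[of _ 0], algebra,
          rule dvd[of _ "q 2"], use q in algebra, rule dvd[of _ "- q 1"], use q in algebra, rule dvd[of _ 0], algebra)
  next
    case m12
    show ?case
      by (rule exI[of _ "w 1 * e 2 - w 2 * e 1"], rule exI[of _ "b 1 * w 2 - b 2 * w 1"])
        (unfold all_less_4 columns_def minor_def, intro conjI, rule dvd[of _ "q 3"], use q in algebra,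
          rule dvd[of _ 0], algebra, rule dvd[of _ 0], algebra, rule dvd[of _ "- q 0"], use q in algebra)
  next
    case m13
    show ?case
      by (rule exI[of _ "w 1 * e 3 - w 3 * e 1"], rule exI[of _ "b 1 * w 3 - b 3 * w 1"])
        (unfold all_less_4 columns_def minor_def, intro conjI, rule dvd[of _ "- q 2"], use q in algebra,
          rule dvd[of _ 0], algebra, rule dvd[of _ "q 0"], use q in algebra, rule dvd[of _ 0], algebra)
  next
    case m23
    show ?case
      by (rule exI[of _ "w 2 * e 3 - w 3 * e 2"], rule exI[of _ "b 2 * w 3 - b 3 * w 2"])
        (unfold all_less_4 columns_def minor_def, intro conjI, rule dvd[of _ "q 1"], use q in algebra,
          rule dvd[of _ "- q 0"], use q in algebra, rule dvd[of _ 0], algebra, rule dvd[of _ 0], algebra)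
  qed
qed

lemma minor_ideal_kills_H3:
  assumes J: "\<And>p q. p \<in> J \<Longrightarrow> q \<in> J \<Longrightarrow> p + q \<in> J" "\<And>a p. p \<in> J \<Longrightarrow> a * p \<in> J"
    and v: "\<And>i. i < 4 \<Longrightarrow> columns v v' i \<in> J" and p: "p \<in> minor_ideal"
  shows "p * v \<in> J \<and> p * v' \<in> J"
proof -
  have m: "minor i j * v \<in> J \<and> minor i j * v' \<in> J" if "i < 4" "j < 4" for i j
  proof -
    have eqs: "minor i j * v = e j * columns v v' i + (- e i) * columns v v' j"
      "minor i j * v' = (- b j) * columns v v' i + b i * columns v v' j"
      by (simp_all add: minor_def columns_def algebra_simps)
    have "columns v v' i \<in> J" "columns v v' j \<in> J" by (simp_all add: v that)
    then show ?thesis unfolding eqs by (intro conjI J)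
  qed
  show ?thesis
    using p
  proof (induction rule: minor_ideal_induct)
    case (add p q)
    then show ?case by (simp add: distrib_right J)
  next
    case (mult a p)
    then show ?case by (simp add: mult.assoc J)
  qed (rule m; simp)+
qed

lemma columns_inj:
  assumes "minor 0 1 \<noteq> 0" "\<And>i. i < 4 \<Longrightarrow> columns v v' i = 0"
  shows "v = 0 \<and> v' = 0"
proof -
  have "minor 0 1 \<in> minor_ideal"
    unfolding minor_ideal_def mem_Collect_eq
    by (rule exI[of _ "\<lambda>i. if i = 0 then 1 else 0"]) simp
  then show ?thesis using minor_ideal_kills_H3[of "{0}" v v' "minor 0 1"] assms by auto
qed

text \<open>Divisibility by \<open>x\<close> is lifted along \<open>y\<close>: since \<open>x\<close> annihilates the homology, \<open>x w\<close> is in the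
  image, say of \<open>(v, v')\<close>; as \<open>y\<close> annihilates the homology modulo \<open>x\<close> and is a nonzerodivisor
  there, \<open>x\<close> divides \<open>v\<close> and \<open>v'\<close> and can be cancelled.\<close>

lemma exact_2:
  assumes x: "x \<in> minor_ideal" "x \<noteq> 0" and y: "y \<in> minor_ideal" "\<And>p. x dvd y * p \<Longrightarrow> x dvd p"
    and w: "\<And>i. i < 4 \<Longrightarrow> alternating w i = 0"
  shows "\<exists>v v'. \<forall>i<4. w i = columns v v' i"
proof -
  have "\<exists>v v'. \<forall>i<4. 0 dvd x * w i - columns v v' i"
    by (rule minor_ideal_kills_H2[OF _ x(1)]) (simp add: w)
  then obtain v v' where "\<forall>i<4. 0 dvd x * w i - columns v v' i" by blast
  then have v: "columns v v' i = x * w i" if "i < 4" for i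
    using that by simp
  have "y * v \<in> {p. x dvd p} \<and> y * v' \<in> {p. x dvd p}"
  proof (rule minor_ideal_kills_H3[OF _ _ _ y(1)])
    fix i :: nat assume "i < 4"
    then show "columns v v' i \<in> {p. x dvd p}" by (simp add: v)
  qed auto
  then have "x dvd v" "x dvd v'" using y(2)[of v] y(2)[of v'] by blast+
  then obtain u u' where "v = x * u" "v' = x * u'" by (auto simp: dvd_def)
  then have "x * w i = x * columns u u' i" if "i < 4" for i
    unfolding v[OF that, symmetric] by (simp add: columns_def algebra_simps)
  then have "\<forall>i<4. w i = columns u u' i" using x(2) by simp
  then show ?thesis by blast
qed

text \<open>One place further to the right one more element of a regular sequence is used: \<open>x g\<close> is the image
  of some \<open>w\<close>, which modulo \<open>x\<close> is a cycle, so \<open>y w\<close> is the image of some \<open>(v, v')\<close> modulo \<open>x\<close>.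
  That pair is a cycle modulo \<open>x\<close> and \<open>y\<close>, hence vanishes there by means of \<open>z\<close>. Correcting \<open>w\<close>
  accordingly makes it divisible by \<open>x\<close>, and \<open>x\<close> can be cancelled.\<close>

lemma exact_1:
  assumes x: "x \<in> minor_ideal" "x \<noteq> 0" and y: "y \<in> minor_ideal" "\<And>p. x dvd y * p \<Longrightarrow> x dvd p"
    and z: "z \<in> minor_ideal" "\<And>p. \<exists>r s. z * p = x * r + y * s \<Longrightarrow> \<exists>r s. p = x * r + y * s"
    and g: "(\<Sum>i<4. b i * g i) = 0" "(\<Sum>i<4. e i * g i) = 0"
  shows "\<exists>u. \<forall>i<4. g i = alternating u i"
proof -
  obtain w where w: "\<forall>i<4. x * g i = alternating w i" using minor_ideal_kills_H1[OF g x(1)] by (rule exE)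
  have "x dvd alternating w i" if "i < 4" for i
    unfolding w[rule_format, OF that, symmetric] by (rule dvd_triv_left)
  then obtain v v' where v: "\<forall>i<4. x dvd y * w i - columns v v' i"
    using minor_ideal_kills_H2[of x w y] y(1) by blast
  let ?J = "{p. \<exists>r s. p = x * r + y * s}"
  have "z * v \<in> ?J \<and> z * v' \<in> ?J"
  proof (rule minor_ideal_kills_H3[OF _ _ _ z(1)])
    fix i :: nat assume "i < 4"
    then obtain q where "y * w i - columns v v' i = x * q" using v by (auto simp: dvd_def)
    then have "columns v v' i = x * (- q) + y * w i" by algebra
    then show "columns v v' i \<in> ?J" by blast
  next
    fix p q assume "p \<in> ?J" "q \<in> ?J"
    then obtain r s r' s' where "p = x * r + y * s" "q = x * r' + y * s'" by blast
    then have "p + q = x * (r + r') + y * (s + s')" by algebra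
    then show "p + q \<in> ?J" by blast
  next
    fix a p assume "p \<in> ?J"
    then obtain r s where "p = x * r + y * s" by blast
    then have "a * p = x * (a * r) + y * (a * s)" by algebra
    then show "a * p \<in> ?J" by blast
  qed
  then have "\<exists>r s. z * v = x * r + y * s" "\<exists>r s. z * v' = x * r + y * s" by simp_all
  from z(2)[OF this(1)] z(2)[OF this(2)]
  obtain r s r' s' where r: "v = x * r + y * s" "v' = x * r' + y * s'" by blast
  have "x dvd w i - columns s s' i" if i: "i < 4" for i
  proof (rule y(2))
    have "y * (w i - columns s s' i) = (y * w i - columns v v' i) + x * columns r r' i"
      unfolding columns_def r by algebra
    then show "x dvd y * (w i - columns s s' i)" using v i by auto
  qed
  then have "\<forall>i. \<exists>q. i < 4 \<longrightarrow> w i - columns s s' i = x * q" unfolding dvd_def by blast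
  then obtain u where "\<forall>i. i < 4 \<longrightarrow> w i - columns s s' i = x * u i" by (rule choice[THEN exE])
  then have u: "w i = columns s s' i + x * u i" if "i < 4" for i
    using that by (simp add: diff_eq_eq add.commute)
  have w': "w 0 = columns s s' 0 + x * u 0" "w 1 = columns s s' 1 + x * u 1"
    "w 2 = columns s s' 2 + x * u 2" "w 3 = columns s s' 3 + x * u 3"
    by (rule u; simp)+
  have "g i = alternating u i" if i: "i < 4" for i
  proof -
    have "\<forall>i<4. alternating w i = alternating (columns s s') i + x * alternating u i"
      unfolding all_less_4 alternating_simps w' by (intro conjI; algebra)
    then have "alternating w i = x * alternating u i" using i alternating_columns[OF i] by simp
    moreover have "x * g i = alternating w i" using w i by blast
    ultimately have "x * g i = x * alternating u i" by (rule trans[rotated])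
    then show ?thesis using x(2) by simp
  qed
  then show ?thesis by blast
qed

end


section \<open>Powers of the variables\<close>

lemma Var_power: "Var i ^ n = single (single i n) 1"
  by (induction n) (simp_all add: Var_def mult_single flip: single_add)

lemma lookup_monom_mult: "lookup (single t 1 * p) (t + m) = lookup (p::poly3) m"
proof (induction p rule: poly_induct)
  case (single n c)
  then show ?case by (simp add: mult_single lookup_single when_def)
next
  case (plus p q)
  then show ?case by (simp add: distrib_left lookup_add)
qed

lemma keys_monom_mult: "keys (single t 1 * p) = (\<lambda>m. t + m) ` keys (p::poly3)"
proof
  have "keys (single t (1::complex) * p) \<subseteq> {a + b |a b. a \<in> keys (single t (1::complex)) \<and> b \<in> keys p}"
    by (rule Poly_Mapping.keys_mult)
  then show "keys (single t 1 * p) \<subseteq> (\<lambda>m. t + m) ` keys p" by auto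
  show "(\<lambda>m. t + m) ` keys p \<subseteq> keys (single t 1 * p)"
    by (auto simp: in_keys_iff lookup_monom_mult)
qed

text \<open>Membership in a monomial ideal is decided monomial by monomial, which makes powers of distinct
  variables a regular sequence.\<close>

lemma monom_ideal_iff:
  fixes p :: poly3
  shows "(\<exists>r s. p = single t 1 * r + single t' 1 * s) \<longleftrightarrow> (\<forall>m\<in>keys p. (\<exists>n. m = t + n) \<or> (\<exists>n. m = t' + n))"
proof
  assume "\<exists>r s. p = single t 1 * r + single t' 1 * s"
  then obtain r s where p: "p = single t 1 * r + single t' 1 * s" by blast
  show "\<forall>m\<in>keys p. (\<exists>n. m = t + n) \<or> (\<exists>n. m = t' + n)"
    unfolding p using Poly_Mapping.keys_add[of "single t 1 * r" "single t' 1 * s"]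
    by (auto simp: keys_monom_mult)
next
  assume k: "\<forall>m\<in>keys p. (\<exists>n. m = t + n) \<or> (\<exists>n. m = t' + n)"
  have "\<exists>r s. (\<Sum>m\<in>A. single m (lookup p m)) = single t 1 * r + single t' 1 * s"
    if "finite A" "A \<subseteq> keys p" for A
    using that
  proof (induction A rule: finite_induct)
    case empty
    show ?case by (rule exI[of _ 0], rule exI[of _ 0]) simp
  next
    case (insert m A)
    then obtain r s where rs: "(\<Sum>m\<in>A. single m (lookup p m)) = single t 1 * r + single t' 1 * s"
      by auto
    have "m \<in> keys p" using insert by simp
    with k consider n where "m = t + n" | n where "m = t' + n" by blast
    then show ?case
    proof cases
      case 1
      then have "single m (lookup p m) = single t 1 * single n (lookup p m)"
        by (simp add: mult_single)
      then have "(\<Sum>m\<in>insert m A. single m (lookup p m))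
          = single t 1 * (single n (lookup p m) + r) + single t' 1 * s"
        using insert rs by (simp add: distrib_left add.assoc)
      then show ?thesis by blast
    next
      case 2
      then have "single m (lookup p m) = single t' 1 * single n (lookup p m)"
        by (simp add: mult_single)
      then have "(\<Sum>m\<in>insert m A. single m (lookup p m))
          = single t 1 * r + single t' 1 * (single n (lookup p m) + s)"
        using insert rs by (simp add: distrib_left add_ac)
      then show ?thesis by blast
    qed
  qed
  from this[of "keys p"] show "\<exists>r s. p = single t 1 * r + single t' 1 * s"
    using poly_sum_single[of p] by simp
qed

lemma single_le_iff: "(\<exists>n. m = single i a + n) \<longleftrightarrow> a \<le> lookup m i" for m :: "3 \<Rightarrow>\<^sub>0 nat"
proof
  assume "a \<le> lookup m i"
  then have "m = single i a + (m - single i a)"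
    by (intro poly_mapping_eqI) (auto simp: lookup_add lookup_minus lookup_single when_def)
  then show "\<exists>n. m = single i a + n" by blast
qed (auto simp: lookup_add)

lemma Var_power_ideal_iff:
  "(\<exists>r s. p = Var i ^ a * r + Var j ^ b * s) \<longleftrightarrow> (\<forall>m\<in>keys p. a \<le> lookup m i \<or> b \<le> lookup m j)"
  by (simp add: Var_power monom_ideal_iff single_le_iff)

lemma Var_power_dvd_iff: "Var i ^ a dvd p \<longleftrightarrow> (\<forall>m\<in>keys p. a \<le> lookup m i)"
proof -
  have "Var i ^ a dvd p \<longleftrightarrow> (\<exists>r s. p = Var i ^ a * r + Var i ^ a * s)"
  proof
    assume "Var i ^ a dvd p"
    then obtain r where "p = Var i ^ a * r + Var i ^ a * 0" by (auto simp: dvd_def)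
    then show "\<exists>r s. p = Var i ^ a * r + Var i ^ a * s" by blast
  qed auto
  then show ?thesis using Var_power_ideal_iff[of p i a i a] by simp
qed

lemma Var_power_regular_2:
  "i \<noteq> j \<Longrightarrow> Var i ^ a dvd Var j ^ b * p \<Longrightarrow> Var i ^ a dvd p"
  by (auto simp: Var_power_dvd_iff Var_power[of j] keys_monom_mult lookup_add lookup_single)

lemma Var_power_regular_3:
  assumes "i \<noteq> k" "j \<noteq> k" "\<exists>r s. Var k ^ c * p = Var i ^ a * r + Var j ^ b * s"
  shows "\<exists>r s. p = Var i ^ a * r + Var j ^ b * s"
  using assms unfolding Var_power_ideal_iff
  by (auto simp: Var_power[of k] keys_monom_mult lookup_add lookup_single)

lemma Var_power_nz: "Var i ^ a \<noteq> 0"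
  unfolding Var_power by (metis lookup_single_eq lookup_zero one_neq_zero)

section \<open>Generation by four relations\<close>

lemma cross_nth_obtain:
  obtains i j where "\<And>u v. cross u v $ k = u $ i * v $ j - u $ j * v $ i"
  using exhaust_3[of k] cross_nth by metis

text \<open>Only the product \<open>\<rho> 2 \<times> \<rho> 3\<close> is required to be known. That the \<open>\<rho> i\<close> are algebraic relations at
  all, and what their other products are, follows from it by means of the two linear relations.\<close>

locale relation_data = line_product n l c f + two_columns b e
  for n l c f b e +
  fixes \<rho> :: "nat \<Rightarrow> poly3 ^ 3" and \<kappa> :: complex and q1 q2 q3 :: nat
  assumes rel_b: "\<And>k. (\<Sum>i<4. b i * \<rho> i $ k) = 0"
    and rel_e: "\<And>k. (\<Sum>i<4. e i * \<rho> i $ k) = 0"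
    and cross_23: "\<And>k. cross (\<rho> 2) (\<rho> 3) $ k = Const \<kappa> * minor 0 1 * grad f $ k"
    and \<kappa>_nz: "\<kappa> \<noteq> 0" and minor_nz: "minor 0 1 \<noteq> 0"
    and pow: "Var 1 ^ q1 \<in> minor_ideal" "Var 2 ^ q2 \<in> minor_ideal" "Var 3 ^ q3 \<in> minor_ideal"
begin

text \<open>Cramer's rule for the two linear relations.\<close>

lemma generator_0_eq: "minor 0 1 * \<rho> 0 $ k = minor 1 2 * \<rho> 2 $ k + minor 1 3 * \<rho> 3 $ k"
  and generator_1_eq: "minor 0 1 * \<rho> 1 $ k = minor 2 0 * \<rho> 2 $ k + minor 3 0 * \<rho> 3 $ k"
proof -
  have b: "b 0 * \<rho> 0 $ k + b 1 * \<rho> 1 $ k + b 2 * \<rho> 2 $ k + b 3 * \<rho> 3 $ k = 0"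
    using rel_b[of k] by (simp add: sum_4)
  have e: "e 0 * \<rho> 0 $ k + e 1 * \<rho> 1 $ k + e 2 * \<rho> 2 $ k + e 3 * \<rho> 3 $ k = 0"
    using rel_e[of k] by (simp add: sum_4)
  have "minor 0 1 * \<rho> 0 $ k - (minor 1 2 * \<rho> 2 $ k + minor 1 3 * \<rho> 3 $ k)
      = e 1 * (b 0 * \<rho> 0 $ k + b 1 * \<rho> 1 $ k + b 2 * \<rho> 2 $ k + b 3 * \<rho> 3 $ k)
        - b 1 * (e 0 * \<rho> 0 $ k + e 1 * \<rho> 1 $ k + e 2 * \<rho> 2 $ k + e 3 * \<rho> 3 $ k)"
    unfolding minor_def by algebra
  then show "minor 0 1 * \<rho> 0 $ k = minor 1 2 * \<rho> 2 $ k + minor 1 3 * \<rho> 3 $ k"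
    unfolding b e by simp
  have "minor 0 1 * \<rho> 1 $ k - (minor 2 0 * \<rho> 2 $ k + minor 3 0 * \<rho> 3 $ k)
      = b 0 * (e 0 * \<rho> 0 $ k + e 1 * \<rho> 1 $ k + e 2 * \<rho> 2 $ k + e 3 * \<rho> 3 $ k)
        - e 0 * (b 0 * \<rho> 0 $ k + b 1 * \<rho> 1 $ k + b 2 * \<rho> 2 $ k + b 3 * \<rho> 3 $ k)"
    unfolding minor_def by algebra
  then show "minor 0 1 * \<rho> 1 $ k = minor 2 0 * \<rho> 2 $ k + minor 3 0 * \<rho> 3 $ k"
    unfolding b e by simp
qed

lemma dot_\<rho>:
  assumes "i < 4" shows "dot (\<rho> i) (grad f) = 0"
proof -
  have "Const \<kappa> * minor 0 1 * dot (\<rho> 2) (grad f) = dot (\<rho> 2) (cross (\<rho> 2) (\<rho> 3))"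
    "Const \<kappa> * minor 0 1 * dot (\<rho> 3) (grad f) = dot (\<rho> 3) (cross (\<rho> 2) (\<rho> 3))"
    unfolding dot_3 cross_23 by algebra+
  moreover have "dot (\<rho> 2) (cross (\<rho> 2) (\<rho> 3)) = 0" "dot (\<rho> 3) (cross (\<rho> 2) (\<rho> 3)) = 0"
    unfolding dot_3 cross_nth by algebra+
  ultimately have d: "dot (\<rho> 2) (grad f) = 0" "dot (\<rho> 3) (grad f) = 0"
    using \<kappa>_nz minor_nz by simp_all
  have "minor 0 1 * dot (\<rho> 0) (grad f) = minor 1 2 * dot (\<rho> 2) (grad f) + minor 1 3 * dot (\<rho> 3) (grad f)"
    using generator_0_eq[of 1] generator_0_eq[of 2] generator_0_eq[of 3] unfolding dot_3 by algebra
  moreover have "minor 0 1 * dot (\<rho> 1) (grad f) = minor 2 0 * dot (\<rho> 2) (grad f) + minor 3 0 * dot (\<rho> 3) (grad f)"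
    using generator_1_eq[of 1] generator_1_eq[of 2] generator_1_eq[of 3] unfolding dot_3 by algebra
  ultimately have "\<forall>i<4. dot (\<rho> i) (grad f) = 0"
    using d minor_nz unfolding all_less_4 by simp
  then show ?thesis using assms by blast
qed

text \<open>The vectors \<open>\<rho> 2\<close> and \<open>\<rho> 3\<close> are linearly independent over the field of fractions.\<close>

lemma parallel_eq_0:
  assumes "\<And>k. cross t (\<rho> 2) $ k = 0" "\<And>k. cross t (\<rho> 3) $ k = 0"
  shows "t = 0"
proof -
  obtain k where "grad f $ k \<noteq> 0" using grad_nz by (auto simp: vec_eq_iff)
  then have "cross (\<rho> 2) (\<rho> 3) $ k \<noteq> 0"
    using cross_23 \<kappa>_nz minor_nz by simp
  moreover have "t $ i * cross (\<rho> 2) (\<rho> 3) $ k = 0" for i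
  proof -
    have p: "t $ i * \<rho> 2 $ j = t $ j * \<rho> 2 $ i" for i j
      using assms(1)[of 1] assms(1)[of 2] assms(1)[of 3] exhaust_3[of i] exhaust_3[of j] by auto
    have p': "t $ i * \<rho> 3 $ j = t $ j * \<rho> 3 $ i" for i j
      using assms(2)[of 1] assms(2)[of 2] assms(2)[of 3] exhaust_3[of i] exhaust_3[of j] by auto
    have "t $ i * (\<rho> 2 $ j * \<rho> 3 $ m - \<rho> 2 $ m * \<rho> 3 $ j) = 0" for j m
      using p[of i j] p[of i m] p'[of j m] by algebra
    then show ?thesis using cross_nth_obtain[of k] by metis
  qed
  ultimately show ?thesis by (simp add: vec_eq_iff)
qed

text \<open>Over the field of fractions \<open>u\<close> is a combination of \<open>\<rho> 2\<close> and \<open>\<rho> 3\<close> with numerators \<open>g 3\<close> and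
  \<open>- g 2\<close> and denominator \<open>\<kappa>\<close> times a minor. Writing \<open>g\<close> as the image of \<open>a\<close> under the alternating
  matrix turns the numerators into that minor times a combination of all four \<open>\<rho> i\<close>.\<close>

lemma generated:
  assumes u: "dot u (grad f) = 0"
  shows "\<exists>a. \<forall>k. u $ k = (\<Sum>i<4. a i * \<rho> i $ k)"
proof -
  have "\<forall>i. \<exists>g. i < 4 \<longrightarrow> (\<forall>k. cross u (\<rho> i) $ k = g * grad f $ k)"
    using cross_relations[OF u dot_\<rho>] by blast
  then obtain g where "\<forall>i. i < 4 \<longrightarrow> (\<forall>k. cross u (\<rho> i) $ k = g i * grad f $ k)"
    by (rule choice[THEN exE])
  then have g: "cross u (\<rho> i) $ k = g i * grad f $ k" if "i < 4" for i k using that by blast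
  have syz: "(\<Sum>i<4. d i * g i) = 0" if d: "\<And>k. (\<Sum>i<4. d i * \<rho> i $ k) = 0" for d
  proof -
    have d: "d 0 * \<rho> 0 $ k + d 1 * \<rho> 1 $ k + d 2 * \<rho> 2 $ k + d 3 * \<rho> 3 $ k = 0" for k
      using d[of k] by (simp add: sum_4)
    have "d 0 * cross u (\<rho> 0) $ k + d 1 * cross u (\<rho> 1) $ k + d 2 * cross u (\<rho> 2) $ k
        + d 3 * cross u (\<rho> 3) $ k = 0" for k
    proof -
      have "d 0 * (u $ i * \<rho> 0 $ j - u $ j * \<rho> 0 $ i) + d 1 * (u $ i * \<rho> 1 $ j - u $ j * \<rho> 1 $ i)
        + d 2 * (u $ i * \<rho> 2 $ j - u $ j * \<rho> 2 $ i) + d 3 * (u $ i * \<rho> 3 $ j - u $ j * \<rho> 3 $ i)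
        = u $ i * (d 0 * \<rho> 0 $ j + d 1 * \<rho> 1 $ j + d 2 * \<rho> 2 $ j + d 3 * \<rho> 3 $ j)
        - u $ j * (d 0 * \<rho> 0 $ i + d 1 * \<rho> 1 $ i + d 2 * \<rho> 2 $ i + d 3 * \<rho> 3 $ i)" for i j
        by algebra
      then show ?thesis using exhaust_3[of k] unfolding d by auto
    qed
    then have "(\<Sum>i<4. d i * g i) * grad f $ k = 0" for k
      by (simp add: g sum_4 algebra_simps)
    then show ?thesis using grad_nz by (auto simp: vec_eq_iff)
  qed
  have "\<exists>a. \<forall>i<4. g i = alternating a i"
  proof (rule exact_1[OF pow(1) Var_power_nz pow(3) _ pow(2)])
    show "\<exists>r s. p = Var 1 ^ q1 * r + Var 3 ^ q3 * s"
      if "\<exists>r s. Var 2 ^ q2 * p = Var 1 ^ q1 * r + Var 3 ^ q3 * s" for p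
      using that by (rule Var_power_regular_3[rotated 2]) simp_all
    show "Var 1 ^ q1 dvd p" if "Var 1 ^ q1 dvd Var 3 ^ q3 * p" for p
      using that by (rule Var_power_regular_2[rotated]) simp
  qed (use syz rel_b rel_e in blast)+
  then obtain a where a: "\<forall>i<4. g i = alternating a i" by (rule exE)
  \<comment> \<open>Cramer's rule predicts \<open>w = 0\<close>.\<close>
  define w where "w = (\<chi> k. Const \<kappa> * minor 0 1 * u $ k - g 3 * \<rho> 2 $ k + g 2 * \<rho> 3 $ k)"
  have c: "cross w (\<rho> 2) $ k = 0 \<and> cross w (\<rho> 3) $ k = 0" for k
  proof -
    obtain i j where ij: "\<And>u v :: poly3 ^ 3. cross u v $ k = u $ i * v $ j - u $ j * v $ i"
      by (rule cross_nth_obtain[where 'a = poly3, of k]) blast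
    have "u $ i * \<rho> 3 $ j - u $ j * \<rho> 3 $ i = g 3 * grad f $ k"
      "u $ i * \<rho> 2 $ j - u $ j * \<rho> 2 $ i = g 2 * grad f $ k"
      "\<rho> 2 $ i * \<rho> 3 $ j - \<rho> 2 $ j * \<rho> 3 $ i = Const \<kappa> * minor 0 1 * grad f $ k"
      using g[of 2 k] g[of 3 k] cross_23[of k] unfolding ij by simp_all
    then show ?thesis unfolding ij w_def vec_lambda_beta by algebra
  qed
  have "w = 0" by (rule parallel_eq_0) (use c in blast)+
  then have w: "Const \<kappa> * minor 0 1 * u $ k - g 3 * \<rho> 2 $ k + g 2 * \<rho> 3 $ k = 0" for k
    unfolding w_def vec_eq_iff by simp
  have "u $ k = (\<Sum>i<4. Const (1 / \<kappa>) * a i * \<rho> i $ k)" for k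
  proof -
    have g2: "g 2 = minor 3 1 * a 0 + minor 0 3 * a 1 + minor 1 0 * a 3"
      "g 3 = minor 1 2 * a 0 + minor 2 0 * a 1 + minor 0 1 * a 2"
      using a by (simp_all add: all_less_4 alternating_simps)
    have "minor 0 1 * (Const \<kappa> * u $ k - (\<Sum>i<4. a i * \<rho> i $ k))
      = Const \<kappa> * minor 0 1 * u $ k - g 3 * \<rho> 2 $ k + g 2 * \<rho> 3 $ k
       - a 0 * (minor 0 1 * \<rho> 0 $ k - (minor 1 2 * \<rho> 2 $ k + minor 1 3 * \<rho> 3 $ k))
       - a 1 * (minor 0 1 * \<rho> 1 $ k - (minor 2 0 * \<rho> 2 $ k + minor 3 0 * \<rho> 3 $ k))"
      unfolding g2 sum_4 minor_swap by algebra
    then have "minor 0 1 * (Const \<kappa> * u $ k - (\<Sum>i<4. a i * \<rho> i $ k)) = 0"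
      unfolding w generator_0_eq generator_1_eq by simp
    then have "(\<Sum>i<4. a i * \<rho> i $ k) = Const \<kappa> * u $ k" using minor_nz by simp
    then have "(\<Sum>i<4. Const (1 / \<kappa>) * a i * \<rho> i $ k) = Const (1 / \<kappa>) * Const \<kappa> * u $ k"
      by (simp add: mult.assoc flip: sum_distrib_left)
    then show ?thesis using Const_inverse[OF \<kappa>_nz] by simp
  qed
  then show ?thesis by (intro exI allI)
qed

text \<open>Eliminating \<open>\<rho> 0\<close> and \<open>\<rho> 1\<close> from \<open>\<Sum> a\<^sub>i \<rho>\<^sub>i = 0\<close> leaves a relation between \<open>\<rho> 2\<close> and \<open>\<rho> 3\<close>
  whose coefficients are entries of \<open>alternating a\<close>. They vanish by independence, and the other two
  entries are determined by them.\<close>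

lemma kernel:
  assumes a: "\<And>k. (\<Sum>i<4. a i * \<rho> i $ k) = 0"
  shows "\<exists>v v'. \<forall>i<4. a i = columns v v' i"
proof (rule exact_2[OF pow(1) Var_power_nz pow(3)])
  show "Var 1 ^ q1 dvd p" if "Var 1 ^ q1 dvd Var 3 ^ q3 * p" for p
    using that by (rule Var_power_regular_2[rotated]) simp
  have lin_comb: "alternating a 3 * \<rho> 2 $ k = alternating a 2 * \<rho> 3 $ k" for k
  proof -
    have s: "a 0 * \<rho> 0 $ k + a 1 * \<rho> 1 $ k + a 2 * \<rho> 2 $ k + a 3 * \<rho> 3 $ k = 0"
      using a[of k] by (simp add: sum_4)
    have "alternating a 3 * \<rho> 2 $ k - alternating a 2 * \<rho> 3 $ k
      = minor 0 1 * (a 0 * \<rho> 0 $ k + a 1 * \<rho> 1 $ k + a 2 * \<rho> 2 $ k + a 3 * \<rho> 3 $ k)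
       - a 0 * (minor 0 1 * \<rho> 0 $ k - (minor 1 2 * \<rho> 2 $ k + minor 1 3 * \<rho> 3 $ k))
       - a 1 * (minor 0 1 * \<rho> 1 $ k - (minor 2 0 * \<rho> 2 $ k + minor 3 0 * \<rho> 3 $ k))"
      unfolding alternating_simps minor_swap by algebra
    then show ?thesis unfolding s generator_0_eq generator_1_eq by simp
  qed
  obtain k where "grad f $ k \<noteq> 0" using grad_nz by (auto simp: vec_eq_iff)
  then have nz: "cross (\<rho> 2) (\<rho> 3) $ k \<noteq> 0"
    using cross_23 \<kappa>_nz minor_nz by simp
  have "alternating a 3 * (\<rho> 2 $ i * \<rho> 3 $ j - \<rho> 2 $ j * \<rho> 3 $ i) = 0"
    "alternating a 2 * (\<rho> 2 $ i * \<rho> 3 $ j - \<rho> 2 $ j * \<rho> 3 $ i) = 0" for i j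
    using lin_comb[of i] lin_comb[of j] by algebra+
  then have "alternating a 3 * cross (\<rho> 2) (\<rho> 3) $ k = 0" "alternating a 2 * cross (\<rho> 2) (\<rho> 3) $ k = 0"
    using cross_nth_obtain[of k] by metis+
  then have z: "alternating a 3 = 0" "alternating a 2 = 0" using nz by simp_all
  have "minor 0 1 * alternating a 0 = minor 1 2 * alternating a 2 + minor 1 3 * alternating a 3"
    "minor 0 1 * alternating a 1 = - (minor 0 2 * alternating a 2 + minor 0 3 * alternating a 3)"
    unfolding alternating_simps minor_def by algebra+
  then have "\<forall>i<4. alternating a i = 0"
    using z minor_nz unfolding all_less_4 by simp
  then show "alternating a i = 0" if "i < 4" for i using that by blast
qed

end


section \<open>Graded free resolutions\<close>

subsection \<open>Homogeneous components\<close>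

text \<open>The part of a polynomial that lies in degree \<open>r\<close> when it is regarded as an element of \<open>S(-d)\<close>.\<close>

definition component :: "nat \<Rightarrow> nat \<Rightarrow> poly3 \<Rightarrow> poly3" where
  "component d r p = Poly_Mapping.mapp (\<lambda>m c. if mono_deg m + d = r then c else 0) p"

lemma lookup_component:
  "lookup (component d r p) m = (if mono_deg m + d = r then lookup p m else 0)"
  by (auto simp: component_def lookup_mapp when_def in_keys_iff)

lemma component_add: "component d r (p + q) = component d r p + component d r q"
  by (rule poly_mapping_eqI) (simp add: lookup_component lookup_add)

lemma component_sum: "component d r (sum f A) = (\<Sum>i\<in>A. component d r (f i))"
proof (induction A rule: infinite_finite_induct)
  case empty
  show ?case by (rule poly_mapping_eqI) (simp add: lookup_component)
next
  case (infinite A)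
  then show ?case by simp (rule poly_mapping_eqI, simp add: lookup_component)
qed (simp add: component_add)

lemma component_in_twist_part: "component d r p \<in> twist_part d r"
  by (auto simp: twist_part_def in_keys_iff lookup_component split: if_splits)

lemma component_twist_part: "p \<in> twist_part d r \<Longrightarrow> component d r p = p"
  by (rule poly_mapping_eqI) (auto simp: twist_part_def lookup_component in_keys_iff)

lemma component_twist_part_neq: "p \<in> twist_part d s \<Longrightarrow> r \<noteq> s \<Longrightarrow> component d r p = 0"
  by (rule poly_mapping_eqI) (auto simp: twist_part_def lookup_component in_keys_iff)

lemma twist_part_mult: "p \<in> twist_part d r \<Longrightarrow> q \<in> twist_part e d \<Longrightarrow> p * q \<in> twist_part e r"
  unfolding twist_part_def using Poly_Mapping.keys_mult[of p q] by fastforce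

lemma twist_part_0 [simp]: "0 \<in> twist_part d r"
  by (simp add: twist_part_def)

lemma twist_part_add: "p \<in> twist_part d r \<Longrightarrow> q \<in> twist_part d r \<Longrightarrow> p + q \<in> twist_part d r"
  unfolding twist_part_def using Poly_Mapping.keys_add[of p q] by blast

lemma twist_part_sum: "(\<And>i. i \<in> A \<Longrightarrow> f i \<in> twist_part d r) \<Longrightarrow> sum f A \<in> twist_part d r"
  by (induction A rule: infinite_finite_induct) (auto intro: twist_part_add)

lemma component_mult:
  assumes q: "q \<in> twist_part e d" shows "component e r (p * q) = component d r p * q"
proof (induction p rule: poly_induct)
  case (single m c)
  let ?s = "mono_deg m + d"
  have "single m c \<in> twist_part d ?s" by (simp add: twist_part_def)
  then show ?case
    using q by (cases "r = ?s")
      (simp_all add: component_twist_part component_twist_part_neq[of _ d ?s]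
        component_twist_part_neq[OF twist_part_mult, of _ d ?s] twist_part_mult)
next
  case (plus p q)
  then show ?case by (simp add: component_add distrib_right)
qed

lemma lookup_0_mult: "lookup (p * q) 0 = lookup p 0 * lookup (q :: poly3) 0"
proof -
  have eq: "eval_poly3 s 0 = lookup s 0" for s
  proof (induction s rule: poly_induct)
    case (single m c)
    show ?case
    proof (cases "m = 0")
      case False
      then obtain i where "lookup m i \<noteq> 0" by (metis lookup_zero poly_mapping_eqI)
      then have "(\<Prod>i\<in>UNIV. (0::complex) ^ lookup m i) = 0" by (auto intro!: prod_zero)
      then show ?thesis
        unfolding eval_poly3_insertion evaluation.insertion_single using False by (simp add: lookup_single)
    next
      case True
      then show ?thesis unfolding eval_poly3_insertion evaluation.insertion_single by simp
    qed
  next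
    case (plus p q)
    then show ?case unfolding eval_poly3_insertion evaluation.insertion_add by (simp add: lookup_add)
  qed
  show ?thesis unfolding eq[symmetric] by (rule eval_poly3_mult)
qed

lemma irrelevant_ideal_mult: "p \<in> irrelevant_ideal \<Longrightarrow> p * q \<in> irrelevant_ideal"
  by (simp add: irrelevant_ideal_def lookup_0_mult)

lemma irrelevant_ideal_sum: "(\<And>i. i \<in> A \<Longrightarrow> f i \<in> irrelevant_ideal) \<Longrightarrow> sum f A \<in> irrelevant_ideal"
  by (simp add: irrelevant_ideal_def lookup_sum)


subsection \<open>Graded homomorphisms as matrices\<close>

definition matrix_map :: "nat \<Rightarrow> nat \<Rightarrow> (nat \<Rightarrow> nat \<Rightarrow> poly3) \<Rightarrow> (nat \<Rightarrow> poly3) \<Rightarrow> nat \<Rightarrow> poly3" where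
  "matrix_map m n A a k = (if k < n then \<Sum>i<m. a i * A i k else 0)"

lemma graded_hom_matrix_map:
  assumes "\<And>i k. i < length ds \<Longrightarrow> k < length es \<Longrightarrow> A i k \<in> twist_part (es ! k) (ds ! i)"
  shows "graded_hom ds es (matrix_map (length ds) (length es) A)"
  unfolding graded_hom_def
proof (intro conjI ballI allI)
  fix r
  show "matrix_map (length ds) (length es) A ` graded_part ds r \<subseteq> graded_part es r"
    by (auto simp: graded_part_def free_module_def matrix_map_def
        intro!: twist_part_sum twist_part_mult[OF _ assms])
qed (auto simp: free_module_def matrix_map_def algebra_simps sum.distrib sum_distrib_left)

definition unit_vec :: "nat \<Rightarrow> nat \<Rightarrow> poly3" where
  "unit_vec i k = (if k = i then 1 else 0)"

lemma unit_vec_graded: "i < length ds \<Longrightarrow> unit_vec i \<in> graded_part ds (ds ! i)"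
  by (auto simp: graded_part_def free_module_def unit_vec_def twist_part_def)

lemma graded_hom_matrix:
  assumes "graded_hom ds es \<phi>" "a \<in> free_module ds"
  shows "\<phi> a k = (\<Sum>i<length ds. a i * \<phi> (unit_vec i) k)"
proof -
  have add: "\<phi> (\<lambda>i. u i + v i) = (\<lambda>i. \<phi> u i + \<phi> v i)"
    if "u \<in> free_module ds" "v \<in> free_module ds" for u v
    using assms(1) that by (simp add: graded_hom_def)
  have scale: "\<phi> (\<lambda>i. p * u i) = (\<lambda>i. p * \<phi> u i)" if "u \<in> free_module ds" for p u
    using assms(1) that by (simp add: graded_hom_def)
  have unit: "unit_vec i \<in> free_module ds" if "i < length ds" for i
    using that by (auto simp: free_module_def unit_vec_def)
  have "\<phi> (\<lambda>i. if i < n then a i else 0) = (\<lambda>k. \<Sum>i<n. a i * \<phi> (unit_vec i) k)"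
    if "n \<le> length ds" for n
    using that
  proof (induction n)
    case 0
    have "\<phi> (\<lambda>i. 0 * a i) = (\<lambda>i. 0 * \<phi> a i)" using assms(2) by (rule scale)
    then show ?case by simp
  next
    case (Suc n)
    have "(\<lambda>i. if i < Suc n then a i else 0)
        = (\<lambda>i. (if i < n then a i else 0) + a n * unit_vec n i)"
      by (auto simp: unit_vec_def less_Suc_eq)
    moreover have "(\<lambda>i. if i < n then a i else 0) \<in> free_module ds"
      "(\<lambda>i. a n * unit_vec n i) \<in> free_module ds"
      using Suc.prems by (auto simp: free_module_def unit_vec_def)
    ultimately have "\<phi> (\<lambda>i. if i < Suc n then a i else 0)
        = (\<lambda>i. \<phi> (\<lambda>i. if i < n then a i else 0) i + a n * \<phi> (unit_vec n) i)"
      using add[of "\<lambda>i. if i < n then a i else 0" "\<lambda>i. a n * unit_vec n i"]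
        scale[OF unit, of n "a n"] Suc.prems by simp
    then show ?case using Suc by simp
  qed
  from this[of "length ds"] have "\<phi> (\<lambda>i. if i < length ds then a i else 0)
      = (\<lambda>k. \<Sum>i<length ds. a i * \<phi> (unit_vec i) k)" by simp
  moreover have "(\<lambda>i. if i < length ds then a i else 0) = a"
    using assms(2) by (auto simp: free_module_def)
  ultimately show ?thesis by simp
qed

text \<open>A graded map respects homogeneous components, so the component of degree \<open>r\<close> of any preimage is
  again a preimage.\<close>

lemma homogeneous_lift:
  assumes \<phi>: "graded_hom ds es \<phi>" and a: "a \<in> free_module ds" "\<phi> a \<in> graded_part es r"
  shows "\<exists>b\<in>graded_part ds r. \<phi> b = \<phi> a"
proof -
  define b where "b i = (if i < length ds then component (ds ! i) r (a i) else 0)" for i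
  have b: "b \<in> graded_part ds r"
    by (simp add: b_def graded_part_def free_module_def component_in_twist_part)
  then have b': "b \<in> free_module ds" by (simp add: graded_part_def)
  have "\<phi> b k = \<phi> a k" for k
  proof (cases "k < length es")
    case True
    have twist: "\<phi> (unit_vec i) k \<in> twist_part (es ! k) (ds ! i)" if "i < length ds" for i
      using \<phi> unit_vec_graded[OF that] True unfolding graded_hom_def graded_part_def[of es] by blast
    then have "\<phi> b k = component (es ! k) r (\<phi> a k)"
      unfolding graded_hom_matrix[OF \<phi> b'] graded_hom_matrix[OF \<phi> a(1)] component_sum
    proof (intro sum.cong refl)
      fix i assume "i \<in> {..<length ds}"
      then show "b i * \<phi> (unit_vec i) k = component (es ! k) r (a i * \<phi> (unit_vec i) k)"
        using component_mult[of "\<phi> (unit_vec i) k" "es ! k" "ds ! i" r "a i"] twist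
        by (simp add: b_def)
    qed
    then show ?thesis using a(2) True by (simp add: graded_part_def component_twist_part)
  next
    case False
    have "\<phi> b \<in> free_module es" "\<phi> a \<in> free_module es"
      using \<phi> b' a(1) by (auto simp: graded_hom_def)
    then show ?thesis using False by (simp add: free_module_def)
  qed
  then show ?thesis using b by blast
qed


subsection \<open>A resolution of length two\<close>

lemma resolution_of_form_matrices:
  fixes G R :: "nat \<Rightarrow> nat \<Rightarrow> poly3"
  assumes G: "\<And>i k. i < length ds \<Longrightarrow> k < length xs \<Longrightarrow> G i k \<in> twist_part (xs ! k) (ds ! i)"
    and R: "\<And>j i. j < length es \<Longrightarrow> i < length ds \<Longrightarrow> R j i \<in> twist_part (ds ! i) (es ! j)"
    and minimal: "\<And>j i. j < length es \<Longrightarrow> i < length ds \<Longrightarrow> R j i \<in> irrelevant_ideal"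
    and gen: "M = matrix_map (length ds) (length xs) G ` free_module ds"
    and ker: "\<And>a. a \<in> free_module ds \<Longrightarrow> (\<forall>k<length xs. (\<Sum>i<length ds. a i * G i k) = 0) \<longleftrightarrow>
        (\<exists>c\<in>free_module es. \<forall>i<length ds. a i = (\<Sum>j<length es. c j * R j i))"
    and inj: "\<And>c. c \<in> free_module es \<Longrightarrow> (\<forall>i<length ds. (\<Sum>j<length es. c j * R j i) = 0) \<Longrightarrow> c = (\<lambda>_. 0)"
  shows "resolution_of_form xs M [ds, es]"
proof -
  define F where "F i = (if i < length [ds, es] then [ds, es] ! i else [])" for i
  define \<phi> where "\<phi> n = (if n = 0 then matrix_map (length ds) (length xs) G
      else if n = 1 then matrix_map (length es) (length ds) R else (\<lambda>_ _. 0))" for n :: nat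
  have F: "F 0 = ds" "F (Suc 0) = es" "F (Suc (Suc i)) = []" for i by (simp_all add: F_def)
  have \<phi>: "\<phi> 0 = matrix_map (length ds) (length xs) G"
    "\<phi> (Suc 0) = matrix_map (length es) (length ds) R" "\<phi> (Suc (Suc i)) = (\<lambda>_ _. 0)" for i
    by (simp_all add: \<phi>_def)
  have zero: "(\<lambda>_. 0) \<in> free_module xs" for xs by (simp add: free_module_def)
  have Nil: "free_module [] = {\<lambda>_. 0}" by (auto simp: free_module_def)
  have "graded_hom (F (Suc i)) (F i) (\<phi> (Suc i)) \<and>
          \<phi> (Suc i) ` free_module (F (Suc i)) = {a \<in> free_module (F i). \<phi> i a = (\<lambda>_. 0)} \<and>
          (\<forall>a\<in>free_module (F (Suc i)). \<forall>k. \<phi> (Suc i) a k \<in> irrelevant_ideal)" for i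
  proof -
    consider "i = 0" | "i = 1" | k where "i = Suc (Suc k)"
      by (metis One_nat_def not0_implies_Suc)
    then show ?thesis
    proof cases
      case 1
      have "(\<exists>c\<in>free_module es. a = matrix_map (length es) (length ds) R c) \<longleftrightarrow>
          a \<in> free_module ds \<and> matrix_map (length ds) (length xs) G a = (\<lambda>_. 0)" for a
      proof -
        have "(\<exists>c\<in>free_module es. a = matrix_map (length es) (length ds) R c) \<longleftrightarrow>
          a \<in> free_module ds \<and> (\<exists>c\<in>free_module es. \<forall>i<length ds. a i = (\<Sum>j<length es. c j * R j i))"
        proof -
          have "a = matrix_map (length es) (length ds) R c \<longleftrightarrow>
            a \<in> free_module ds \<and> (\<forall>i<length ds. a i = (\<Sum>j<length es. c j * R j i))" for c
            unfolding free_module_def matrix_map_def fun_eq_iff by (auto simp: not_less)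
          then show ?thesis by blast
        qed
        also have "\<dots> \<longleftrightarrow> a \<in> free_module ds \<and> (\<forall>k<length xs. (\<Sum>i<length ds. a i * G i k) = 0)"
          using ker by blast
        also have "\<dots> \<longleftrightarrow> a \<in> free_module ds \<and> matrix_map (length ds) (length xs) G a = (\<lambda>_. 0)"
          by (auto simp: matrix_map_def fun_eq_iff)
        finally show ?thesis .
      qed
      then have "matrix_map (length es) (length ds) R ` free_module es
          = {a \<in> free_module ds. matrix_map (length ds) (length xs) G a = (\<lambda>_. 0)}"
        by blast
      moreover have "matrix_map (length es) (length ds) R a k \<in> irrelevant_ideal" for a k
      proof (cases "k < length ds")
        case True
        have "a j * R j k \<in> irrelevant_ideal" if "j < length es" for j
          using irrelevant_ideal_mult[OF minimal[OF that True]] by (simp add: mult.commute)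
        then show ?thesis using True by (auto simp: matrix_map_def intro!: irrelevant_ideal_sum)
      qed (simp add: matrix_map_def irrelevant_ideal_def)
      moreover have "graded_hom es ds (matrix_map (length es) (length ds) R)"
        by (rule graded_hom_matrix_map) (rule R)
      ultimately show ?thesis using 1 by (simp add: F \<phi>)
    next
      case 2
      have "a = (\<lambda>_. 0)" if "a \<in> free_module es" "matrix_map (length es) (length ds) R a = (\<lambda>_. 0)" for a
      proof (rule inj[OF that(1)], intro allI impI)
        fix i assume "i < length ds"
        then show "(\<Sum>j<length es. a j * R j i) = 0"
          using fun_cong[OF that(2), of i] by (simp add: matrix_map_def)
      qed
      moreover have "matrix_map (length es) (length ds) R (\<lambda>_. 0) = (\<lambda>_. 0)"
        by (simp add: matrix_map_def fun_eq_iff)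
      ultimately have "{a \<in> free_module es. matrix_map (length es) (length ds) R a = (\<lambda>_. 0)} = {\<lambda>_. 0}"
        using zero by blast
      then show ?thesis
        using 2 by (simp add: F \<phi> Nil graded_hom_def graded_part_def irrelevant_ideal_def zero)
    next
      case (3 k)
      have "\<phi> (Suc (Suc k)) = (\<lambda>_ _. 0)" "\<phi> (Suc i) = (\<lambda>_ _. 0)" "F i = []" "F (Suc i) = []"
        using 3 by (simp_all add: F \<phi>)
      then show ?thesis
        using 3 by (simp add: Nil graded_hom_def graded_part_def irrelevant_ideal_def)
    qed
  qed
  moreover have "graded_hom ds xs (matrix_map (length ds) (length xs) G)"
    by (rule graded_hom_matrix_map) (rule G)
  ultimately have "minimal_graded_free_resolution xs M F \<phi>"
    unfolding minimal_graded_free_resolution_def by (simp add: F(1) \<phi>(1) gen)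
  then show ?thesis unfolding resolution_of_form_def F_def by blast
qed


subsection \<open>The degrees of the generators\<close>

lemma homogeneous_system:
  fixes A :: "'a \<Rightarrow> 'b \<Rightarrow> 'c::field"
  assumes "finite K" "finite I" "card K < card I"
  shows "\<exists>c. (\<exists>i\<in>I. c i \<noteq> 0) \<and> (\<forall>k\<in>K. (\<Sum>i\<in>I. c i * A i k) = 0)"
  using assms
proof (induction K arbitrary: I A rule: finite_induct)
  case empty
  then have "I \<noteq> {}" by auto
  then show ?case by (intro exI[of _ "\<lambda>_. 1"]) auto
next
  case (insert k K)
  show ?case
  proof (cases "\<forall>i\<in>I. A i k = 0")
    case True
    have "card K < card I" using insert by simp
    then show ?thesis using insert.IH[OF insert.prems(1)] True by fastforce
  next
    case False
    then obtain j where j: "j \<in> I" "A j k \<noteq> 0" by blast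
    let ?I = "I - {j}"
    have "card K < card ?I" using insert j by simp
    then obtain c where c: "\<exists>i\<in>?I. c i \<noteq> 0"
      "\<forall>m\<in>K. (\<Sum>i\<in>?I. c i * (A i m - A i k / A j k * A j m)) = 0"
      using insert.IH[of ?I "\<lambda>i m. A i m - A i k / A j k * A j m"] insert.prems(1) by auto
    define s where "s = (\<Sum>i\<in>?I. c i * A i k)"
    define c' where "c' = c(j := - s / A j k)"
    have sum: "(\<Sum>i\<in>I. c' i * A i m) = (\<Sum>i\<in>?I. c i * A i m) - s / A j k * A j m" for m
      unfolding sum.remove[OF insert.prems(1) j(1)] by (simp add: c'_def)
    have "(\<Sum>i\<in>I. c' i * A i m) = 0" if "m \<in> insert k K" for m
    proof (cases "m = k")
      case True
      then show ?thesis using j by (simp add: sum s_def)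
    next
      case False
      then have "(\<Sum>i\<in>?I. c i * (A i m - A i k / A j k * A j m)) = 0" using c that by blast
      moreover have "(\<Sum>i\<in>?I. c i * (A i m - A i k / A j k * A j m))
          = (\<Sum>i\<in>?I. c i * A i m) - s / A j k * A j m"
        by (simp add: s_def sum_distrib_right sum_divide_distrib sum_subtractf right_diff_distrib mult.assoc)
      ultimately show ?thesis by (simp add: sum)
    qed
    moreover have "\<exists>i\<in>I. c' i \<noteq> 0" using c(1) by (auto simp: c'_def)
    ultimately show ?thesis by blast
  qed
qed

lemma count_list_card: "count_list xs j = card {i. i < length xs \<and> xs ! i = j}"
  by (simp add: count_list_eq_length_filter length_filter_conv_card eq_commute)

text \<open>Nakayama's argument. Lift the generators of degree \<open>j\<close> of the first resolution to homogeneous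
  elements of the second one and take the constant coefficients at its generators of degree \<open>j\<close>. If
  the first resolution had more of them, some nontrivial combination \<open>\<Sum> c i * unit_vec i\<close> would
  have a lift \<open>u\<close> with all entries in the irrelevant ideal. Writing the generators of the second
  resolution in terms of the first then gives an element of the kernel of the augmentation with the
  constant coefficient \<open>c i\<close>, although that kernel lies in the irrelevant ideal by minimality.\<close>

lemma generator_count_le:
  assumes res: "minimal_graded_free_resolution xs M F \<phi>" "minimal_graded_free_resolution xs M F' \<phi>'"
  shows "count_list (F 0) j \<le> count_list (F' 0) j"
proof (rule ccontr)
  let ?I = "{i. i < length (F 0) \<and> F 0 ! i = j}" and ?K = "{i. i < length (F' 0) \<and> F' 0 ! i = j}"
  assume "\<not> count_list (F 0) j \<le> count_list (F' 0) j"
  then have card: "card ?K < card ?I" by (simp add: count_list_card)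
  have \<phi>: "graded_hom (F 0) xs (\<phi> 0)" "\<phi> 0 ` free_module (F 0) = M"
    using res(1) unfolding minimal_graded_free_resolution_def by blast+
  have ker: "a k \<in> irrelevant_ideal" if "a \<in> free_module (F 0)" "\<phi> 0 a = (\<lambda>_. 0)" for a k
  proof -
    have "a \<in> \<phi> (Suc 0) ` free_module (F (Suc 0))"
      using res(1) that unfolding minimal_graded_free_resolution_def by blast
    then show ?thesis using res(1) unfolding minimal_graded_free_resolution_def by blast
  qed
  have \<phi>': "graded_hom (F' 0) xs (\<phi>' 0)" "\<phi>' 0 ` free_module (F' 0) = M"
    using res(2) unfolding minimal_graded_free_resolution_def by blast+
  have unit: "unit_vec i \<in> free_module ds" if "i < length ds" for i ds
    using unit_vec_graded[OF that] by (simp add: graded_part_def)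
  have "\<exists>b. i \<in> ?I \<longrightarrow> b \<in> graded_part (F' 0) j \<and> \<phi>' 0 b = \<phi> 0 (unit_vec i)" for i
  proof (cases "i \<in> ?I")
    case True
    have "\<phi> 0 ` graded_part (F 0) j \<subseteq> graded_part xs j"
      using \<phi>(1) by (simp add: graded_hom_def)
    moreover have "unit_vec i \<in> graded_part (F 0) j"
      using unit_vec_graded[of i "F 0"] True by auto
    ultimately have "\<phi> 0 (unit_vec i) \<in> graded_part xs j" by blast
    moreover obtain a where "a \<in> free_module (F' 0)" "\<phi>' 0 a = \<phi> 0 (unit_vec i)"
      using \<phi>(2) \<phi>'(2) unit[of i "F 0"] True by (metis (no_types, lifting) imageE imageI mem_Collect_eq)
    ultimately show ?thesis using homogeneous_lift[OF \<phi>'(1), of a j] by metis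
  qed blast
  then have "\<exists>b. \<forall>i. i \<in> ?I \<longrightarrow> b i \<in> graded_part (F' 0) j \<and> \<phi>' 0 (b i) = \<phi> 0 (unit_vec i)"
    by (intro choice allI)
  then obtain b where "\<forall>i. i \<in> ?I \<longrightarrow> b i \<in> graded_part (F' 0) j \<and> \<phi>' 0 (b i) = \<phi> 0 (unit_vec i)"
    by (rule exE)
  then have b: "b i \<in> graded_part (F' 0) j" "\<phi>' 0 (b i) = \<phi> 0 (unit_vec i)" if "i \<in> ?I" for i
    using that by blast+
  have "\<exists>c. (\<exists>i\<in>?I. c i \<noteq> 0) \<and> (\<forall>k\<in>?K. (\<Sum>i\<in>?I. c i * lookup (b i k) 0) = 0)"
    by (rule homogeneous_system[OF _ _ card]) simp_all
  then obtain c where c: "\<exists>i\<in>?I. c i \<noteq> 0" "\<forall>k\<in>?K. (\<Sum>i\<in>?I. c i * lookup (b i k) 0) = 0"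
    by (elim exE conjE)
  define u where "u k = (\<Sum>i\<in>?I. Const (c i) * b i k)" for k
  have u_irr: "u k \<in> irrelevant_ideal" for k
  proof -
    have "lookup (u k) 0 = (\<Sum>i\<in>?I. c i * lookup (b i k) 0)"
      by (simp add: u_def lookup_sum lookup_0_mult Const_def)
    also have "\<dots> = 0"
    proof (cases "k \<in> ?K")
      case False
      have "lookup (b i k) 0 = 0" if "i \<in> ?I" for i
      proof (cases "k < length (F' 0)")
        case True
        then have "b i k \<in> twist_part (F' 0 ! k) j" "F' 0 ! k \<noteq> j"
          using b(1)[OF that] False by (auto simp: graded_part_def)
        then have "0 \<notin> keys (b i k)" by (auto simp: twist_part_def)
        then show ?thesis by (simp add: in_keys_iff)
      qed (use b(1)[OF that] in \<open>simp add: graded_part_def free_module_def\<close>)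
      then show ?thesis by simp
    qed (use c(2) in blast)
    finally show ?thesis by (simp add: irrelevant_ideal_def)
  qed
  have "\<exists>w. k < length (F' 0) \<longrightarrow> w \<in> free_module (F 0) \<and> \<phi> 0 w = \<phi>' 0 (unit_vec k)" for k
    using \<phi>(2) \<phi>'(2) unit[of k "F' 0"] by (metis imageE imageI)
  then have "\<exists>w. \<forall>k. k < length (F' 0) \<longrightarrow> w k \<in> free_module (F 0) \<and> \<phi> 0 (w k) = \<phi>' 0 (unit_vec k)"
    by (intro choice allI)
  then obtain w where "\<forall>k. k < length (F' 0) \<longrightarrow> w k \<in> free_module (F 0) \<and> \<phi> 0 (w k) = \<phi>' 0 (unit_vec k)"
    by (rule exE)
  then have w: "w k \<in> free_module (F 0)" "\<phi> 0 (w k) = \<phi>' 0 (unit_vec k)" if "k < length (F' 0)" for k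
    using that by blast+
  define v where "v m = (if m \<in> ?I then Const (c m) else 0) - (\<Sum>k<length (F' 0). u k * w k m)" for m
  have v: "v \<in> free_module (F 0)"
    using w(1) by (auto simp: v_def free_module_def)
  have "\<phi> 0 v m = 0" for m
  proof -
    have "\<phi> 0 v m = (\<Sum>i<length (F 0). (if i \<in> ?I then Const (c i) else 0) * \<phi> 0 (unit_vec i) m)
        - (\<Sum>i<length (F 0). \<Sum>k<length (F' 0). u k * (w k i * \<phi> 0 (unit_vec i) m))"
      unfolding graded_hom_matrix[OF \<phi>(1) v]
      by (simp add: v_def left_diff_distrib sum_subtractf sum_distrib_right mult.assoc)
    also have "(\<Sum>i<length (F 0). (if i \<in> ?I then Const (c i) else 0) * \<phi> 0 (unit_vec i) m)
        = (\<Sum>i\<in>?I. Const (c i) * \<phi> 0 (unit_vec i) m)"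
      by (rule sum.mono_neutral_cong_right) auto
    also have "\<dots> = (\<Sum>i\<in>?I. \<Sum>k<length (F' 0). Const (c i) * (b i k * \<phi>' 0 (unit_vec k) m))"
    proof (rule sum.cong[OF refl])
      fix i assume i: "i \<in> ?I"
      have "b i \<in> free_module (F' 0)" using b(1)[OF i] by (simp add: graded_part_def)
      then show "Const (c i) * \<phi> 0 (unit_vec i) m
          = (\<Sum>k<length (F' 0). Const (c i) * (b i k * \<phi>' 0 (unit_vec k) m))"
        unfolding b(2)[OF i, symmetric] by (simp add: graded_hom_matrix[OF \<phi>'(1)] sum_distrib_left)
    qed
    also have "\<dots> = (\<Sum>k<length (F' 0). u k * \<phi>' 0 (unit_vec k) m)"
      unfolding u_def sum_distrib_right by (subst sum.swap) (simp add: mult.assoc)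
    also have "(\<Sum>i<length (F 0). \<Sum>k<length (F' 0). u k * (w k i * \<phi> 0 (unit_vec i) m))
        = (\<Sum>k<length (F' 0). u k * \<phi>' 0 (unit_vec k) m)"
    proof (subst sum.swap, rule sum.cong[OF refl])
      fix k assume k: "k \<in> {..<length (F' 0)}"
      then show "(\<Sum>i<length (F 0). u k * (w k i * \<phi> 0 (unit_vec i) m)) = u k * \<phi>' 0 (unit_vec k) m"
        using w(1)[of k] w(2)[of k, symmetric]
        by (simp add: graded_hom_matrix[OF \<phi>(1)] sum_distrib_left)
    qed
    finally show ?thesis by simp
  qed
  then have v_irr: "v m \<in> irrelevant_ideal" for m using ker[OF v] by blast
  obtain i where i: "i \<in> ?I" "c i \<noteq> 0" using c(1) by blast
  have "v i = Const (c i) - (\<Sum>k<length (F' 0). u k * w k i)" using i(1) by (simp add: v_def)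
  then have "lookup (Const (c i) - (\<Sum>k<length (F' 0). u k * w k i)) 0 = 0"
    using v_irr[of i] by (simp add: irrelevant_ideal_def)
  moreover have "lookup (\<Sum>k<length (F' 0). u k * w k i) 0 = 0"
    using u_irr by (simp add: irrelevant_ideal_def lookup_sum lookup_0_mult)
  ultimately show False using i by (simp add: lookup_minus Const_def)
qed

lemma graded_betti_0:
  assumes "resolution_of_form xs M (ds # dss)"
  shows "graded_betti xs M 0 j = count_list ds j"
proof -
  obtain \<phi> where "minimal_graded_free_resolution xs M
      (\<lambda>i. if i < length (ds # dss) then (ds # dss) ! i else []) \<phi>"
    using assms unfolding resolution_of_form_def by blast
  moreover define F where "F = (\<lambda>i. if i < length (ds # dss) then (ds # dss) ! i else [])"
  ultimately have F: "minimal_graded_free_resolution xs M F \<phi>" "F 0 = ds" by simp_all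
  have "count_list (F' 0) j = count_list ds j"
    if "minimal_graded_free_resolution xs M F' \<phi>'" for F' \<phi>'
    using generator_count_le[OF F(1) that, of j] generator_count_le[OF that F(1), of j] F(2)
    by simp
  then show ?thesis unfolding graded_betti_def using F by (intro the_equality) blast+
qed


section \<open>Lines in the projective plane\<close>

definition pairing :: "complex ^ 3 \<Rightarrow> complex ^ 3 \<Rightarrow> complex" where
  "pairing l v = l $ 1 * v $ 1 + l $ 2 * v $ 2 + l $ 3 * v $ 3"

definition line :: "complex ^ 3 \<Rightarrow> (complex ^ 3) set set" where
  "line l = zero_locus (lin l)"

lemma eval_lin_pairing: "eval_poly3 (lin l) v = pairing l v"
  by (simp add: eval_lin pairing_def sum_3)

lemma pairing_scale: "pairing l (c *s v) = c * pairing l v" "pairing (c *s l) v = c * pairing l v"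
  by (simp_all add: pairing_def algebra_simps)

lemma pairing_add: "pairing l (v + w) = pairing l v + pairing l w"
  by (simp add: pairing_def algebra_simps)

lemma span_in_zero_locus:
  assumes "v \<noteq> 0"
  shows "vec.span {v} \<in> zero_locus f \<longleftrightarrow> (\<forall>c. eval_poly3 f (c *s v) = 0)"
  using assms by (auto simp: zero_locus_def proj_plane_def vec.span_singleton)

lemma span_in_line: "v \<noteq> 0 \<Longrightarrow> vec.span {v} \<in> line l \<longleftrightarrow> pairing l v = 0"
  unfolding line_def span_in_zero_locus eval_lin_pairing pairing_scale
  by (metis mult_zero_right mult_1)

lemma line_scale: "c \<noteq> 0 \<Longrightarrow> line (c *s l) = line l"
  by (simp add: line_def zero_locus_def eval_lin_pairing pairing_scale)

lemma span_scale:
  fixes p :: "complex ^ 3"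
  assumes "c \<noteq> 0" shows "vec.span {c *s p} = vec.span {p}"
proof -
  have "k *s (c *s p) = (k * c) *s p" "k *s p = (k / c) *s (c *s p)" for k
    using assms by (simp_all add: vec_eq_iff)
  then show ?thesis unfolding vec.span_singleton by blast
qed

lemma proj_plane_cases:
  assumes "p \<in> proj_plane" obtains v where "v \<noteq> 0" "p = vec.span {v}"
  using assms by (auto simp: proj_plane_def)

lemma line_subset_plane: "line l \<subseteq> proj_plane"
  by (auto simp: line_def zero_locus_def)

lemma is_form_1_lin:
  assumes "is_form 1 g" shows "\<exists>l. g = lin l"
proof -
  define l where "l = (\<chi> i. lookup g (single i 1))"
  have "lookup g m = lookup (lin l) m" for m
  proof (cases "mono_deg m = 1")
    case True
    then have deg: "lookup m 1 + lookup m 2 + lookup m 3 = 1" by (simp add: mono_deg_def sum_3)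
    have "\<exists>i. m = single i 1"
    proof -
      consider "lookup m 1 = 1" "lookup m 2 = 0" "lookup m 3 = 0"
        | "lookup m 1 = 0" "lookup m 2 = 1" "lookup m 3 = 0"
        | "lookup m 1 = 0" "lookup m 2 = 0" "lookup m 3 = 1" using deg by linarith
      then show ?thesis
      proof cases
        case 1
        have "m = single 1 1"
          by (rule poly_mapping_eqI) (metis 1 exhaust_3 lookup_single_eq lookup_single_not_eq)
        then show ?thesis by blast
      next
        case 2
        have "m = single 2 1"
          by (rule poly_mapping_eqI) (metis 2 exhaust_3 lookup_single_eq lookup_single_not_eq)
        then show ?thesis by blast
      next
        case 3
        have "m = single 3 1"
          by (rule poly_mapping_eqI) (metis 3 exhaust_3 lookup_single_eq lookup_single_not_eq)
        then show ?thesis by blast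
      qed
    qed
    then obtain i where m: "m = single i 1" by blast
    have "lookup (Const (l $ j) * Var j) m = (if j = i then l $ i else 0)" for j
    proof -
      have "single j (1::nat) = single i 1 \<longleftrightarrow> j = i"
        by (metis lookup_single_eq lookup_single_not_eq zero_neq_one)
      then show ?thesis by (simp add: Const_def Var_def mult_single lookup_single m when_def)
    qed
    then show ?thesis by (simp add: lin_def lookup_sum) (simp add: l_def m)
  next
    case False
    then have "m \<notin> keys g" "m \<notin> keys (lin l)"
      using assms is_form_lin[of l] unfolding is_form_def by blast+
    then show ?thesis by (simp add: in_keys_iff)
  qed
  then have "g = lin l" by (rule poly_mapping_eqI)
  then show ?thesis by blast
qed

lemma proj_lines_eq: "proj_lines = {line l | l. l \<noteq> 0}"
  unfolding proj_lines_def line_def using is_form_1_lin is_form_lin lin_eq_0_iff by metis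

lemma cross_eq_0_scale:
  fixes a m :: "complex ^ 3"
  assumes "cross a m = 0" "m \<noteq> 0" shows "\<exists>c. a = c *s m"
proof -
  obtain k where k: "m $ k \<noteq> 0" using assms(2) by (auto simp: vec_eq_iff)
  have "cross a m $ 1 = 0" "cross a m $ 2 = 0" "cross a m $ 3 = 0" using assms(1) by simp_all
  then have "a $ i * m $ k = a $ k * m $ i" for i
    using exhaust_3[of i] exhaust_3[of k] by auto
  then have "a $ i = ((a $ k / m $ k) *s m) $ i" for i
    using k by (simp only: vector_smult_component times_divide_eq_left eq_divide_eq simp_thms if_True)
  then have "a = (a $ k / m $ k) *s m" unfolding vec_eq_iff by blast
  then show ?thesis by blast
qed

lemma cross_perp:
  fixes u v a :: "complex ^ 3"
  assumes "pairing a u = 0" "pairing a v = 0"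
  shows "cross a (cross u v) = 0"
  using assms unfolding pairing_def vec_eq_iff forall_3 cross_nth zero_index by algebra

lemma pairing_commute: "pairing a b = pairing b a"
  by (simp add: pairing_def mult.commute)

lemma pairing_cross: "pairing a (cross a b) = 0" "pairing b (cross a b) = 0"
  unfolding pairing_def cross_nth by algebra+

lemma two_points:
  assumes "m \<noteq> 0"
  shows "\<exists>u v. pairing m u = 0 \<and> pairing m v = 0 \<and> cross u v \<noteq> 0"
proof -
  obtain k where k: "m $ k \<noteq> 0" using assms by (auto simp: vec_eq_iff)
  consider "k = 1" | "k = 2" | "k = 3" using exhaust_3[of k] by blast
  then show ?thesis
  proof cases
    case 1
    have "cross (vector [- m $ 2, m $ 1, 0]) (vector [- m $ 3, 0, m $ 1]) $ 1 \<noteq> 0"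
      using k 1 by (simp add: vector_3)
    then show ?thesis
      by (intro exI[of _ "vector [- m $ 2, m $ 1, 0]"] exI[of _ "vector [- m $ 3, 0, m $ 1]"])
        (auto simp: pairing_def vector_3 simp del: cross_nth)
  next
    case 2
    have "cross (vector [m $ 2, - m $ 1, 0]) (vector [0, - m $ 3, m $ 2]) $ 2 \<noteq> 0"
      using k 2 by (simp add: vector_3)
    then show ?thesis
      by (intro exI[of _ "vector [m $ 2, - m $ 1, 0]"] exI[of _ "vector [0, - m $ 3, m $ 2]"])
        (auto simp: pairing_def vector_3 simp del: cross_nth)
  next
    case 3
    have "cross (vector [m $ 3, 0, - m $ 1]) (vector [0, m $ 3, - m $ 2]) $ 3 \<noteq> 0"
      using k 3 by (simp add: vector_3)
    then show ?thesis
      by (intro exI[of _ "vector [m $ 3, 0, - m $ 1]"] exI[of _ "vector [0, m $ 3, - m $ 2]"])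
        (auto simp: pairing_def vector_3 simp del: cross_nth)
  qed
qed

lemma cross_nz_imp:
  assumes "cross u v \<noteq> (0 :: complex ^ 3)" shows "u + c *s v \<noteq> 0" "v \<noteq> 0" "u \<noteq> 0"
proof -
  have "cross (u + c *s v) v = cross u v"
    by (simp add: vec_eq_iff forall_3 algebra_simps)
  moreover have "cross 0 v = 0" "cross u 0 = 0" by (simp_all add: vec_eq_iff forall_3)
  ultimately show "u + c *s v \<noteq> 0" "v \<noteq> 0" "u \<noteq> 0" using assms by metis+
qed

text \<open>A linear form vanishing at two independent points is a multiple of their cross product.\<close>

lemma two_points_determine:
  assumes "a \<noteq> 0" "m \<noteq> 0" "cross u v \<noteq> 0"
    "pairing a u = 0" "pairing a v = 0" "pairing m u = 0" "pairing m v = 0"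
  shows "\<exists>c. c \<noteq> 0 \<and> a = c *s m"
proof -
  obtain c d where "a = c *s cross u v" "m = d *s cross u v"
    using cross_eq_0_scale[OF cross_perp assms(3)] assms by metis
  then have "c \<noteq> 0" "d \<noteq> 0" "a = (c / d) *s m" using assms by auto
  then show ?thesis by (intro exI[of _ "c / d"]) simp
qed

lemma line_subset_imp:
  assumes "a \<noteq> 0" "m \<noteq> 0" "line m \<subseteq> line a"
  shows "\<exists>c. c \<noteq> 0 \<and> a = c *s m"
proof -
  obtain u v where uv: "pairing m u = 0" "pairing m v = 0" "cross u v \<noteq> 0"
    using two_points[OF assms(2)] by blast
  note nz = cross_nz_imp(2,3)[OF uv(3)]
  have "pairing a u = 0" "pairing a v = 0"
    using uv span_in_line[OF nz(1)] span_in_line[OF nz(2)] assms(3) by blast+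
  then show ?thesis using two_points_determine assms uv by blast
qed

context line_product
begin

lemma zero_locus_f: "zero_locus f = (\<Union>i<n. line (l i))"
proof -
  have "vec.span {v} \<in> zero_locus f \<longleftrightarrow> (\<exists>i<n. vec.span {v} \<in> line (l i))" if "v \<noteq> 0" for v
  proof -
    have "eval_poly3 f (k *s v) = c * (\<Prod>i<n. k * pairing (l i) v)" for k
      by (simp add: f_eq eval_poly3_mult eval_poly3_prod eval_lin_pairing pairing_scale)
    then have "(\<forall>k. eval_poly3 f (k *s v) = 0) \<longleftrightarrow> (\<exists>i<n. pairing (l i) v = 0)"
      using c_nz by (auto dest: spec[of _ 1])
    then show ?thesis using that by (simp add: span_in_zero_locus span_in_line)
  qed
  note span = this
  have sub: "zero_locus f \<subseteq> proj_plane" by (auto simp: zero_locus_def)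
  show ?thesis
  proof (intro set_eqI)
    fix p
    show "p \<in> zero_locus f \<longleftrightarrow> p \<in> (\<Union>i<n. line (l i))"
    proof (cases "p \<in> proj_plane")
      case True
      then obtain v where "v \<noteq> 0" "p = vec.span {v}" by (rule proj_plane_cases)
      then show ?thesis using span by auto
    next
      case False
      then have "p \<notin> zero_locus f" "\<And>i. p \<notin> line (l i)"
        using sub line_subset_plane by blast+
      then show ?thesis by blast
    qed
  qed
qed

text \<open>A line in the zero locus has infinitely many points, so one of the finitely many factors vanishes
  at two of them, and hence on the whole line.\<close>

lemma lines_of_f: "lines_of f = (\<lambda>i. line (l i)) ` {..<n}"
proof
  show "(\<lambda>i. line (l i)) ` {..<n} \<subseteq> lines_of f"
    using l_nz by (auto simp: lines_of_def proj_lines_eq zero_locus_f)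
  show "lines_of f \<subseteq> (\<lambda>i. line (l i)) ` {..<n}"
  proof
    fix L assume "L \<in> lines_of f"
    then obtain m where m: "m \<noteq> 0" "L = line m" "line m \<subseteq> zero_locus f"
      by (auto simp: lines_of_def proj_lines_eq)
    obtain u v where uv: "pairing m u = 0" "pairing m v = 0" "cross u v \<noteq> 0"
      using two_points[OF m(1)] by blast
    have "\<exists>i<n. pairing (l i) u = 0 \<and> pairing (l i) v = 0"
    proof (rule ccontr)
      assume neg: "\<not> (\<exists>i<n. pairing (l i) u = 0 \<and> pairing (l i) v = 0)"
      \<comment> \<open>The points \<open>u + t v\<close> lie on the line, and each factor vanishes at one of them at most.\<close>
      have "finite {t. pairing (l i) (u + t *s v) = 0}" if "i < n" for i
      proof (rule finite_subset)
        show "{t. pairing (l i) (u + t *s v) = 0} \<subseteq> {- pairing (l i) u / pairing (l i) v}"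
        proof
          fix t assume "t \<in> {t. pairing (l i) (u + t *s v) = 0}"
          then have t: "pairing (l i) u + t * pairing (l i) v = 0"
            by (simp add: pairing_add pairing_scale)
          then have "pairing (l i) v \<noteq> 0" using neg that by auto
          moreover have "t * pairing (l i) v = - pairing (l i) u" using t by algebra
          ultimately show "t \<in> {- pairing (l i) u / pairing (l i) v}" using nonzero_eq_divide_eq by blast
        qed
      qed simp
      then have "finite (\<Union>i<n. {t. pairing (l i) (u + t *s v) = 0})" by blast
      then have "(\<Union>i<n. {t. pairing (l i) (u + t *s v) = 0}) \<noteq> UNIV"
        using infinite_UNIV_char_0[where 'a = complex] by metis
      then obtain t where "t \<notin> (\<Union>i<n. {t. pairing (l i) (u + t *s v) = 0})" by blast
      then have t: "pairing (l i) (u + t *s v) \<noteq> 0" if "i < n" for i using that by blast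
      have "u + t *s v \<noteq> 0" using cross_nz_imp uv by blast
      note point = span_in_line[OF this]
      have "pairing m (u + t *s v) = 0" using uv by (simp add: pairing_add pairing_scale)
      then have "vec.span {u + t *s v} \<in> line m" using point by blast
      then have "vec.span {u + t *s v} \<in> zero_locus f" using m(3) by blast
      then obtain i where "i < n" "vec.span {u + t *s v} \<in> line (l i)"
        unfolding zero_locus_f by blast
      then show False using t point by blast
    qed
    then obtain i where i: "i < n" "pairing (l i) u = 0" "pairing (l i) v = 0" by blast
    then obtain c where "c \<noteq> 0" "m = c *s l i"
      using two_points_determine[OF m(1) l_nz[OF i(1)]] uv by blast
    then have "L = line (l i)" using m(2) by (simp add: line_scale)
    then show "L \<in> (\<lambda>i. line (l i)) ` {..<n}" using i(1) by blast
  qed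
qed

lemma line_subset_line_iff:
  assumes "i < n" "j < n" shows "line (l i) \<subseteq> line (l j) \<longleftrightarrow> i = j"
proof
  assume "line (l i) \<subseteq> line (l j)"
  then obtain c where "l j = c *s l i" using line_subset_imp l_nz assms by metis
  then have "cross (l i) (l j) = 0" by (simp add: vec_eq_iff forall_3)
  then show "i = j" using distinct assms by blast
qed simp

lemma is_form_f: "is_form n f"
proof -
  have "is_form k (\<Prod>i<k. lin (l i))" for k
  proof (induction k)
    case 0
    show ?case using is_form_Const[of 1] by simp
  next
    case (Suc k)
    then show ?case using is_form_mult[OF Suc is_form_lin] by simp
  qed
  then show ?thesis using is_form_mult[OF is_form_Const] unfolding f_eq by fastforce
qed

lemma line_arrangement: "defines_line_arrangement n f"
proof -
  have "inj_on (\<lambda>i. line (l i)) {..<n}"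
    using line_subset_line_iff by (auto simp: inj_on_def)
  then have "card (lines_of f) = n" by (simp add: lines_of_f card_image)
  then show ?thesis
    by (simp add: defines_line_arrangement_def is_form_f zero_locus_f lines_of_f)
qed


subsection \<open>The intersection lattice\<close>

text \<open>An element of the lattice is recovered from the set of lines containing it, so the lattice is
  isomorphic to the family of these sets, ordered by inclusion.\<close>

definition lines_through :: "(complex ^ 3) set set \<Rightarrow> nat set" where
  "lines_through X = {i. i < n \<and> X \<subseteq> line (l i)}"

abbreviation "lattice \<equiv> intersection_lattice (lines_of f)"

lemma in_latticeE:
  assumes "X \<in> lattice"
  obtains I where "I \<subseteq> {..<n}" "X = proj_plane \<inter> (\<Inter>i\<in>I. line (l i))" "X \<noteq> {}"
proof -
  obtain B where B: "B \<subseteq> (\<lambda>i. line (l i)) ` {..<n}" "X = proj_plane \<inter> \<Inter>B" "X \<noteq> {}"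
    using assms unfolding intersection_lattice_def lines_of_f mem_Collect_eq by (elim exE conjE) metis
  moreover obtain I where "I \<subseteq> {..<n}" "B = (\<lambda>i. line (l i)) ` I"
    using B(1) by (metis subset_image_iff)
  ultimately show thesis using that by metis
qed

lemma in_latticeI:
  assumes "I \<subseteq> {..<n}" "X = proj_plane \<inter> (\<Inter>i\<in>I. line (l i))" "X \<noteq> {}"
  shows "X \<in> lattice"
proof -
  have "(\<lambda>i. line (l i)) ` I \<subseteq> (\<lambda>i. line (l i)) ` {..<n}" using assms(1) by (rule image_mono)
  then show ?thesis
    unfolding intersection_lattice_def lines_of_f mem_Collect_eq
    by (intro exI[of _ "(\<lambda>i. line (l i)) ` I"] conjI) (use assms(2,3) in simp_all)
qed

lemma lattice_eq:
  assumes "X \<in> lattice" shows "X = proj_plane \<inter> (\<Inter>i\<in>lines_through X. line (l i))"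
proof -
  obtain I where I: "I \<subseteq> {..<n}" "X = proj_plane \<inter> (\<Inter>i\<in>I. line (l i))"
    using assms by (rule in_latticeE)
  have "I \<subseteq> lines_through X" unfolding I(2) lines_through_def using I(1) by blast
  then have "proj_plane \<inter> (\<Inter>i\<in>lines_through X. line (l i)) \<subseteq> X" unfolding I(2) by blast
  moreover have "X \<subseteq> proj_plane \<inter> (\<Inter>i\<in>lines_through X. line (l i))"
    using I(2) by (auto simp: lines_through_def)
  ultimately show ?thesis by (rule equalityI[rotated])
qed

lemma lattice_subset_iff:
  assumes "X \<in> lattice" "Y \<in> lattice"
  shows "Y \<subseteq> X \<longleftrightarrow> lines_through X \<subseteq> lines_through Y"
proof
  assume "lines_through X \<subseteq> lines_through Y"
  then show "Y \<subseteq> X" using lattice_eq[OF assms(1)] lattice_eq[OF assms(2)] by blast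
qed (auto simp: lines_through_def)

definition pencil :: "nat \<Rightarrow> nat \<Rightarrow> nat set" where
  "pencil i j = {k. k < n \<and> pairing (l k) (cross (l i) (l j)) = 0}"

lemma line_inter_line:
  assumes "i < n" "j < n" "i \<noteq> j"
  shows "line (l i) \<inter> line (l j) = {vec.span {cross (l i) (l j)}}"
proof -
  let ?p = "cross (l i) (l j)"
  have nz: "?p \<noteq> 0" using distinct assms by blast
  have same: "vec.span {v} = vec.span {?p}" if "v \<noteq> 0" "pairing (l i) v = 0" "pairing (l j) v = 0" for v
  proof -
    have "cross v ?p = 0" using that cross_perp pairing_commute by metis
    then obtain c where c: "v = c *s ?p" using cross_eq_0_scale nz by blast
    then have "c \<noteq> 0" using that by auto
    then show ?thesis using c span_scale by blast
  qed
  have "vec.span {?p} \<in> line (l i)" "vec.span {?p} \<in> line (l j)"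
    using span_in_line[OF nz] pairing_cross by blast+
  moreover have "p = vec.span {?p}" if p: "p \<in> line (l i)" "p \<in> line (l j)" for p
  proof -
    have "p \<in> proj_plane" using p(1) line_subset_plane by blast
    then obtain v where v: "v \<noteq> 0" "p = vec.span {v}" by (rule proj_plane_cases)
    then have "pairing (l i) v = 0" "pairing (l j) v = 0"
      using p span_in_line[OF v(1)] by simp_all
    then show ?thesis using same v by simp
  qed
  ultimately show ?thesis by blast
qed

text \<open>The whole plane, the lines and the intersection points give the three kinds of sets.\<close>

lemma lines_through_lattice:
  "lines_through ` lattice = {{}} \<union> {{i} | i. i < n} \<union> {pencil i j | i j. i < n \<and> j < n \<and> i \<noteq> j}"
proof -
  have plane: "lines_through proj_plane = {}"
  proof -
    have "\<not> proj_plane \<subseteq> line (l i)" if i: "i < n" for i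
    proof -
      obtain k where k: "l i $ k \<noteq> 0" using l_nz[OF i] by (auto simp: vec_eq_iff)
      have "pairing (l i) (axis k 1) = l i $ k"
        using exhaust_3[of k] by (auto simp: pairing_def axis_def)
      moreover have nz: "axis k 1 \<noteq> (0 :: complex ^ 3)" by (simp add: axis_eq_0_iff)
      ultimately have "vec.span {axis k 1} \<notin> line (l i)" using k by (simp add: span_in_line)
      moreover have "vec.span {axis k 1} \<in> proj_plane" using nz by (auto simp: proj_plane_def)
      ultimately show ?thesis by blast
    qed
    then show ?thesis by (auto simp: lines_through_def)
  qed
  have line: "lines_through (line (l i)) = {i}" if "i < n" for i
    using line_subset_line_iff that by (auto simp: lines_through_def)
  have point: "lines_through {vec.span {cross (l i) (l j)}} = pencil i j"
    if "i < n" "j < n" "i \<noteq> j" for i j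
    using span_in_line[OF distinct[OF that]] by (auto simp: lines_through_def pencil_def)
  have plane_in: "proj_plane \<in> lattice"
  proof -
    have "vec.span {axis 1 1} \<in> proj_plane" by (auto simp: proj_plane_def axis_eq_0_iff intro!: exI[of _ "axis 1 1"])
    then show ?thesis by (intro in_latticeI[of "{}"]) auto
  qed
  have line_in: "line (l i) \<in> lattice" if i: "i < n" for i
  proof -
    obtain u v where uv: "pairing (l i) u = 0" "cross u v \<noteq> 0"
      using two_points[OF l_nz[OF i]] by blast
    then have "vec.span {u} \<in> line (l i)" using cross_nz_imp span_in_line by blast
    then show ?thesis
      using i line_subset_plane[of "l i"] by (intro in_latticeI[of "{i}"]) auto
  qed
  have point_in: "{vec.span {cross (l i) (l j)}} \<in> lattice" if "i < n" "j < n" "i \<noteq> j" for i j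
    using that line_inter_line[OF that] line_subset_plane[of "l i"]
    by (intro in_latticeI[of "{i, j}"]) auto
  have "lines_through X = {} \<or> (\<exists>i<n. lines_through X = {i}) \<or>
      (\<exists>i j. i < n \<and> j < n \<and> i \<noteq> j \<and> lines_through X = pencil i j)" if X: "X \<in> lattice" for X
  proof -
    obtain I where I: "I \<subseteq> {..<n}" "X = proj_plane \<inter> (\<Inter>i\<in>I. line (l i))" "X \<noteq> {}"
      using X by (rule in_latticeE)
    consider "I = {}" | i where "I = {i}" | i j where "i \<in> I" "j \<in> I" "i \<noteq> j"
      by (metis insertI1 is_singletonI' is_singleton_the_elem)
    then show ?thesis
    proof cases
      case 1
      then show ?thesis using I plane by simp
    next
      case (2 i)
      then have "i < n" "X = line (l i)" using I line_subset_plane[of "l i"] by auto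
      then show ?thesis using line by blast
    next
      case (3 i j)
      then have ij: "i < n" "j < n" using I by auto
      have "X \<subseteq> line (l i) \<inter> line (l j)" using I(2) 3 by blast
      then have "X = {vec.span {cross (l i) (l j)}}"
        using I(3) line_inter_line[OF ij 3(3)] by (metis subset_singletonD)
      then show ?thesis using point[OF ij 3(3)] ij 3(3) by metis
    qed
  qed
  note cases = this
  show ?thesis
  proof (intro equalityI subsetI)
    fix F assume "F \<in> lines_through ` lattice"
    then obtain X where "X \<in> lattice" "F = lines_through X" by (rule imageE)
    then show "F \<in> {{}} \<union> {{i} | i. i < n} \<union> {pencil i j | i j. i < n \<and> j < n \<and> i \<noteq> j}"
      using cases[of X] by auto
  next
    fix F assume "F \<in> {{}} \<union> {{i} | i. i < n} \<union> {pencil i j | i j. i < n \<and> j < n \<and> i \<noteq> j}"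
    then consider "F = {}" | i where "i < n" "F = {i}"
      | i j where "i < n" "j < n" "i \<noteq> j" "F = pencil i j" by auto
    then show "F \<in> lines_through ` lattice"
    proof cases
      case 1
      then show ?thesis using plane plane_in by (metis imageI)
    next
      case 2
      then show ?thesis using line line_in by (metis imageI)
    next
      case 3
      then show ?thesis using point point_in by (metis imageI)
    qed
  qed
qed

end

lemma isomorphic_lattices_of_pencils:
  assumes f: "line_product n l c f" and g: "line_product n l' c' g"
    and same: "\<And>i j k. i < n \<Longrightarrow> j < n \<Longrightarrow> k < n \<Longrightarrow>
      pairing (l k) (cross (l i) (l j)) = 0 \<longleftrightarrow> pairing (l' k) (cross (l' i) (l' j)) = 0"
  shows "isomorphic_lattices (lines_of f) (lines_of g)"
proof -
  interpret f: line_product n l c f by fact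
  interpret g: line_product n l' c' g by fact
  have pencil: "f.pencil i j = g.pencil i j" if "i < n" "j < n" for i j
    using same[OF that] by (auto simp: f.pencil_def g.pencil_def)
  have "{f.pencil i j | i j. i < n \<and> j < n \<and> i \<noteq> j} = {g.pencil i j | i j. i < n \<and> j < n \<and> i \<noteq> j}"
    using pencil by metis
  then have image: "f.lines_through ` f.lattice = g.lines_through ` g.lattice"
    unfolding f.lines_through_lattice g.lines_through_lattice by simp
  have inj_f: "inj_on f.lines_through f.lattice"
    by (rule inj_onI) (metis f.lattice_eq)
  have inj_g: "inj_on g.lines_through g.lattice"
    by (rule inj_onI) (metis g.lattice_eq)
  have bij_f: "bij_betw f.lines_through f.lattice (g.lines_through ` g.lattice)"
    using inj_f image by (simp add: bij_betw_def)
  have bij_g: "bij_betw (the_inv_into g.lattice g.lines_through) (g.lines_through ` g.lattice) g.lattice"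
    by (rule bij_betw_the_inv_into) (simp add: bij_betw_def inj_g)
  let ?h = "the_inv_into g.lattice g.lines_through \<circ> f.lines_through"
  have bij: "bij_betw ?h f.lattice g.lattice" using bij_f bij_g by (rule bij_betw_trans)
  have h: "?h X \<in> g.lattice" "g.lines_through (?h X) = f.lines_through X" if "X \<in> f.lattice" for X
  proof -
    have "f.lines_through X \<in> g.lines_through ` g.lattice" using image that by blast
    then show "g.lines_through (?h X) = f.lines_through X"
      by (simp add: f_the_inv_into_f[OF inj_g])
    show "?h X \<in> g.lattice" using bij that by (auto simp: bij_betw_def)
  qed
  have "Y \<subseteq> X \<longleftrightarrow> ?h Y \<subseteq> ?h X" if "X \<in> f.lattice" "Y \<in> f.lattice" for X Y
    unfolding f.lattice_subset_iff[OF that] g.lattice_subset_iff[OF h(1)[OF that(1)] h(1)[OF that(2)]]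
      h(2)[OF that(1)] h(2)[OF that(2)] ..
  then show ?thesis unfolding isomorphic_lattices_def using bij by blast
qed


section \<open>Resolutions of the module of algebraic relations\<close>

definition coord :: "nat \<Rightarrow> 3" where
  "coord k = (if k = 0 then 1 else if k = 1 then 2 else 3)"

lemma all_coord: "(\<forall>k<3. P (coord k)) \<longleftrightarrow> (\<forall>i. P i)"
  by (auto simp: forall_3 coord_def numeral_3_eq_3 less_Suc_eq)

lemma AR_iff: "a \<in> AR f \<longleftrightarrow> a \<in> free_module [0, 0, 0] \<and> dot (vector [a 0, a 1, a 2]) (grad f) = 0"
  by (simp add: AR_def dot_3 grad_def vector_3)

lemma vector_coord: "k < 3 \<Longrightarrow> vector [a 0, a 1, a 2 :: poly3] $ coord k = a k"
  by (auto simp: coord_def vector_3 numeral_3_eq_3 less_Suc_eq numeral_2_eq_2)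

lemma is_form_twist_part: "is_form (r - d) p \<Longrightarrow> d \<le> r \<Longrightarrow> p \<in> twist_part d r"
  by (auto simp: is_form_def twist_part_def)

lemma is_form_irrelevant: "is_form d p \<Longrightarrow> 0 < d \<Longrightarrow> p \<in> irrelevant_ideal"
proof -
  assume "is_form d p" "0 < d"
  then have "0 \<notin> keys p" by (auto simp: is_form_def)
  then show ?thesis by (simp add: irrelevant_ideal_def in_keys_iff)
qed

lemma sum_2: "(\<Sum>j<2. h j) = h 0 + h (1::nat)"
  by (simp add: eval_nat_numeral)

lemma all_less_3: "(\<forall>i<3. P i) \<longleftrightarrow> P 0 \<and> P 1 \<and> P (2::nat)"
  by (auto simp: eval_nat_numeral less_Suc_eq)

lemma sum_3_nat: "(\<Sum>j<3. h j) = h 0 + h 1 + h (2::nat)"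
  by (simp add: eval_nat_numeral add.assoc)

context relation_data
begin

lemma AR_generated:
  "AR f = {a \<in> free_module [0, 0, 0]. \<exists>c. \<forall>k<3. a k = (\<Sum>i<4. c i * \<rho> i $ coord k)}"
proof -
  have gen: "dot u (grad f) = 0 \<longleftrightarrow> (\<exists>c. \<forall>k. u $ k = (\<Sum>i<4. c i * \<rho> i $ k))" for u
  proof
    assume "\<exists>c. \<forall>k. u $ k = (\<Sum>i<4. c i * \<rho> i $ k)"
    then obtain c where "\<And>k. u $ k = (\<Sum>i<4. c i * \<rho> i $ k)" by blast
    then have "dot u (grad f) = (\<Sum>i<4. c i * dot (\<rho> i) (grad f))"
      by (simp add: dot_3 sum_4 algebra_simps)
    then show "dot u (grad f) = 0" using dot_\<rho> by simp
  qed (rule generated)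
  have vec: "(\<forall>k. vector [a 0, a 1, a 2] $ k = (\<Sum>i<4. c i * \<rho> i $ k))
      \<longleftrightarrow> (\<forall>k<3. a k = (\<Sum>i<4. c i * \<rho> i $ coord k))" for a c
    unfolding all_coord[symmetric] by (simp add: vector_coord[simplified])
  have "a \<in> AR f \<longleftrightarrow> a \<in> free_module [0, 0, 0] \<and> (\<exists>c. \<forall>k<3. a k = (\<Sum>i<4. c i * \<rho> i $ coord k))" for a
    unfolding AR_iff gen vec ..
  then show ?thesis by blast
qed

lemma kernel_iff:
  "(\<forall>k<3. (\<Sum>i<4. a i * \<rho> i $ coord k) = 0) \<longleftrightarrow> (\<exists>v v'. \<forall>i<4. a i = columns v v' i)"
  unfolding all_coord[of "\<lambda>k. (\<Sum>i<4. a i * \<rho> i $ k) = 0"]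
proof (rule iffI)
  assume "\<exists>v v'. \<forall>i<4. a i = columns v v' i"
  then obtain v v' where a: "\<forall>i<4. a i = columns v v' i" by blast
  have "(\<Sum>i<4. a i * \<rho> i $ k) = v * (\<Sum>i<4. b i * \<rho> i $ k) + v' * (\<Sum>i<4. e i * \<rho> i $ k)" for k
    using a by (simp add: columns_def sum_distrib_left algebra_simps flip: sum.distrib)
  then show "\<forall>k. (\<Sum>i<4. a i * \<rho> i $ k) = 0" by (simp add: rel_b rel_e)
qed (rule kernel, blast)

text \<open>The vanishing of \<open>e 0\<close> is minimality: it is the only entry of degree \<open>0\<close> of the matrix.\<close>

lemma resolution_4_2:
  assumes \<rho>: "\<And>i k. i < 4 \<Longrightarrow> is_form (9 - i) (\<rho> i $ k)"
    and b: "\<And>i. i < 4 \<Longrightarrow> is_form (i + 1) (b i)" and e: "\<And>i. i < 4 \<Longrightarrow> is_form i (e i)" and e0: "e 0 = 0"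
  shows "resolution_of_form [0, 0, 0] (AR f) [[9, 8, 7, 6], [10, 9]]"
proof -
  define G where "G i k = \<rho> i $ coord k" for i k
  define R where "R j i = (if j = 0 then b i else e i)" for j i :: nat
  have less_4: "i < 4 \<longleftrightarrow> i = 0 \<or> i = 1 \<or> i = 2 \<or> i = 3" for i :: nat by auto
  have ds: "length [9, 8, 7, 6 :: nat] = 4" "length [10, 9 :: nat] = 2" "length [0, 0, 0 :: nat] = 3" by simp_all
  have nth: "[9, 8, 7, 6] ! i = 9 - i" if "i < 4" for i :: nat using that by (auto simp: less_4)
  show ?thesis
  proof (rule resolution_of_form_matrices[where G = G and R = R], unfold ds)
    fix i k :: nat assume "i < 4" "k < 3"
    then show "G i k \<in> twist_part ([0, 0, 0] ! k) ([9, 8, 7, 6] ! i)"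
      using \<rho> by (auto simp: G_def nth numeral_3_eq_3 less_Suc_eq intro: is_form_twist_part)
  next
    fix j i :: nat assume ij: "j < 2" "i < 4"
    have "10 - (9 - i) = i + 1" "9 - (9 - i) = i" using ij by auto
    then have "b i \<in> twist_part (9 - i) 10" "e i \<in> twist_part (9 - i) 9"
      using b[OF ij(2)] e[OF ij(2)] by (auto intro!: is_form_twist_part)
    then show "R j i \<in> twist_part ([9, 8, 7, 6] ! i) ([10, 9] ! j)"
      using ij by (auto simp: R_def nth less_Suc_eq numeral_2_eq_2)
    have "b i \<in> irrelevant_ideal" using b[OF ij(2)] by (rule is_form_irrelevant) simp
    moreover have "e i \<in> irrelevant_ideal"
      using e[OF ij(2)] e0 is_form_irrelevant by (cases "i = 0") (auto simp: irrelevant_ideal_def)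
    ultimately show "R j i \<in> irrelevant_ideal" by (simp add: R_def)
  next
    show "AR f = matrix_map 4 3 G ` free_module [9, 8, 7, 6]"
    proof (intro equalityI subsetI)
      fix a assume "a \<in> AR f"
      then obtain c where a: "\<forall>i\<ge>3. a i = 0" "\<forall>k<3. a k = (\<Sum>i<4. c i * \<rho> i $ coord k)"
        by (auto simp: AR_generated free_module_def)
      have "a = matrix_map 4 3 G (\<lambda>i. if i < 4 then c i else 0)"
        using a by (auto simp: matrix_map_def G_def fun_eq_iff)
      moreover have "(\<lambda>i. if i < 4 then c i else 0) \<in> free_module [9, 8, 7, 6]"
        by (simp add: free_module_def)
      ultimately show "a \<in> matrix_map 4 3 G ` free_module [9, 8, 7, 6]" by blast
    next
      fix a assume "a \<in> matrix_map 4 3 G ` free_module [9, 8, 7, 6]"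
      then obtain c where "a = matrix_map 4 3 G c" by blast
      then show "a \<in> AR f"
        unfolding AR_generated by (auto simp: matrix_map_def G_def free_module_def intro!: exI[of _ c])
    qed
  next
    fix a assume "a \<in> free_module [9, 8, 7, 6]"
    have "(\<forall>k<3. (\<Sum>i<4. a i * G i k) = 0) \<longleftrightarrow> (\<exists>v v'. \<forall>i<4. a i = columns v v' i)"
      unfolding G_def by (rule kernel_iff)
    also have "\<dots> \<longleftrightarrow> (\<exists>c\<in>free_module [10, 9]. \<forall>i<4. a i = (\<Sum>j<2. c j * R j i))"
    proof
      assume "\<exists>v v'. \<forall>i<4. a i = columns v v' i"
      then obtain v v' where a: "\<forall>i<4. a i = columns v v' i" by blast
      show "\<exists>c\<in>free_module [10, 9]. \<forall>i<4. a i = (\<Sum>j<2. c j * R j i)"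
        by (rule bexI[of _ "\<lambda>j. if j = 0 then v else if j = 1 then v' else 0"])
          (use a in \<open>auto simp: sum_2 R_def columns_def free_module_def algebra_simps\<close>)
    next
      assume "\<exists>c\<in>free_module [10, 9]. \<forall>i<4. a i = (\<Sum>j<2. c j * R j i)"
      then obtain c where "\<forall>i<4. a i = (\<Sum>j<2. c j * R j i)" by blast
      then have "\<forall>i<4. a i = columns (c 0) (c 1) i"
        by (simp add: sum_2 R_def columns_def algebra_simps)
      then show "\<exists>v v'. \<forall>i<4. a i = columns v v' i" by blast
    qed
    finally show "(\<forall>k<3. (\<Sum>i<4. a i * G i k) = 0) \<longleftrightarrow>
        (\<exists>c\<in>free_module [10, 9]. \<forall>i<4. a i = (\<Sum>j<2. c j * R j i))" .
  next
    fix c assume c: "c \<in> free_module [10, 9]" "\<forall>i<4. (\<Sum>j<2. c j * R j i) = 0"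
    then have "columns (c 0) (c 1) i = 0" if "i < 4" for i
      using that by (simp add: sum_2 R_def columns_def algebra_simps)
    then have "c 0 = 0 \<and> c 1 = 0" using columns_inj minor_nz by blast
    moreover have "c j = 0" if "2 \<le> j" for j using c(1) that by (simp add: free_module_def)
    ultimately show "c = (\<lambda>_. 0)"
      by (auto simp: fun_eq_iff) (metis One_nat_def less_2_cases not_le)
  qed
qed

text \<open>The generator \<open>\<rho> 0 = 0\<close> together with the relation \<open>e\<close>, a unit vector, splits off.\<close>

lemma resolution_3_1:
  assumes \<rho>: "\<And>i k. i < 4 \<Longrightarrow> is_form (9 - i) (\<rho> i $ k)"
    and b: "\<And>i. i < 4 \<Longrightarrow> is_form (i + 1) (b i)" and zero: "\<rho> 0 = 0" "b 0 = 0"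
    and e: "e 0 = 1" "e 1 = 0" "e 2 = 0" "e 3 = 0"
  shows "resolution_of_form [0, 0, 0] (AR f) [[8, 7, 6], [10]]"
proof -
  define G where "G i k = \<rho> (i + 1) $ coord k" for i k
  define R where "R j i = b (i + 1)" for j i :: nat
  have less_3: "i < 3 \<longleftrightarrow> i = 0 \<or> i = 1 \<or> i = 2" for i :: nat by auto
  have ds: "length [8, 7, 6 :: nat] = 3" "length [10 :: nat] = 1" "length [0, 0, 0 :: nat] = 3" by simp_all
  have nth: "[8, 7, 6] ! i = 9 - (i + 1)" if "i < 3" for i :: nat using that by (auto simp: less_3)
  have shift: "(\<Sum>i<4. c i * \<rho> i $ k) = (\<Sum>i<3. c (i + 1) * \<rho> (i + 1) $ k)" for c :: "nat \<Rightarrow> poly3" and k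
    by (simp add: sum_4 sum_3_nat zero numeral_2_eq_2 numeral_3_eq_3)
  show ?thesis
  proof (rule resolution_of_form_matrices[where G = G and R = R], unfold ds)
    fix i k :: nat assume "i < 3" "k < 3"
    then show "G i k \<in> twist_part ([0, 0, 0] ! k) ([8, 7, 6] ! i)"
      using \<rho>[of "i + 1"] by (auto simp: G_def nth less_3 intro: is_form_twist_part)
  next
    fix j i :: nat assume ij: "j < 1" "i < 3"
    have "10 - (9 - (i + 1)) = i + 1 + 1" using ij by auto
    then have "b (i + 1) \<in> twist_part (9 - (i + 1)) 10"
      using ij b[of "i + 1"] by (intro is_form_twist_part) auto
    then show "R j i \<in> twist_part ([8, 7, 6] ! i) ([10] ! j)"
      using ij by (simp add: R_def nth)
    have "is_form (i + 2) (b (i + 1))" using b[of "i + 1"] ij by simp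
    then show "R j i \<in> irrelevant_ideal" unfolding R_def by (rule is_form_irrelevant) simp
  next
    show "AR f = matrix_map 3 3 G ` free_module [8, 7, 6]"
    proof (intro equalityI subsetI)
      fix a assume "a \<in> AR f"
      then obtain c where a: "\<forall>i\<ge>3. a i = 0" "\<forall>k<3. a k = (\<Sum>i<4. c i * \<rho> i $ coord k)"
        by (auto simp: AR_generated free_module_def)
      have "a = matrix_map 3 3 G (\<lambda>i. if i < 3 then c (i + 1) else 0)"
        using a unfolding shift by (auto simp: matrix_map_def G_def fun_eq_iff)
      moreover have "(\<lambda>i. if i < 3 then c (i + 1) else 0) \<in> free_module [8, 7, 6]"
        by (simp add: free_module_def)
      ultimately show "a \<in> matrix_map 3 3 G ` free_module [8, 7, 6]" by blast
    next
      fix a assume "a \<in> matrix_map 3 3 G ` free_module [8, 7, 6]"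
      then obtain c where "a = matrix_map 3 3 G c" by blast
      then show "a \<in> AR f"
        unfolding AR_generated shift
        by (auto simp: matrix_map_def G_def free_module_def intro!: exI[of _ "\<lambda>i. c (i - 1)"])
    qed
  next
    fix a assume a: "a \<in> free_module [8, 7, 6]"
    define a' where "a' i = (if i = 0 then 0 else a (i - 1))" for i
    have "(\<forall>k<3. (\<Sum>i<3. a i * G i k) = 0) \<longleftrightarrow> (\<forall>k<3. (\<Sum>i<4. a' i * \<rho> i $ coord k) = 0)"
      unfolding shift by (simp add: G_def a'_def)
    also have "\<dots> \<longleftrightarrow> (\<exists>v v'. \<forall>i<4. a' i = columns v v' i)" by (rule kernel_iff)
    also have "\<dots> \<longleftrightarrow> (\<exists>v. \<forall>i<3. a i = v * b (i + 1))"
    proof -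
      have "(\<forall>i<4. a' i = columns v v' i) \<longleftrightarrow> v' = 0 \<and> (\<forall>i<3. a i = v * b (i + 1))" for v v'
        unfolding all_less_4 all_less_3 columns_def a'_def
        by (auto simp: zero e mult.commute numeral_3_eq_3 numeral_2_eq_2)
      then show ?thesis by blast
    qed
    also have "\<dots> \<longleftrightarrow> (\<exists>c\<in>free_module [10]. \<forall>i<3. a i = (\<Sum>j<1. c j * R j i))"
    proof
      assume "\<exists>v. \<forall>i<3. a i = v * b (i + 1)"
      then obtain v where "\<forall>i<3. a i = v * b (i + 1)" by blast
      then show "\<exists>c\<in>free_module [10]. \<forall>i<3. a i = (\<Sum>j<1. c j * R j i)"
        by (intro bexI[of _ "\<lambda>j. if j = 0 then v else 0"]) (auto simp: R_def free_module_def)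
    next
      assume "\<exists>c\<in>free_module [10]. \<forall>i<3. a i = (\<Sum>j<1. c j * R j i)"
      then show "\<exists>v. \<forall>i<3. a i = v * b (i + 1)" by (auto simp: R_def)
    qed
    finally show "(\<forall>k<3. (\<Sum>i<3. a i * G i k) = 0) \<longleftrightarrow>
        (\<exists>c\<in>free_module [10]. \<forall>i<3. a i = (\<Sum>j<1. c j * R j i))" .
  next
    fix c assume c: "c \<in> free_module [10]" "\<forall>i<3. (\<Sum>j<1. c j * R j i) = 0"
    then have "c 0 * b 1 = 0" by (auto simp: R_def)
    moreover have "b 1 \<noteq> 0" using minor_nz by (auto simp: minor_def zero)
    ultimately have "c 0 = 0" by simp
    moreover have "c j = 0" if "1 \<le> j" for j using c(1) that by (simp add: free_module_def)
    ultimately show "c = (\<lambda>_. 0)" by (auto simp: fun_eq_iff) (metis One_nat_def Suc_leI neq0_conv)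
  qed
qed

end


section \<open>Computing with forms over \<open>\<int>[\<surd>3]\<close>\<close>

text \<open>The pair \<open>(a, b)\<close> stands for \<open>a + b \<surd>3\<close>.\<close>

type_synonym zr = "int \<times> int"

definition embed :: "zr \<Rightarrow> complex" where
  "embed a = of_int (fst a) + of_int (snd a) * complex_of_real (sqrt 3)"

fun zr_add :: "zr \<Rightarrow> zr \<Rightarrow> zr" where
  "zr_add (a, b) (c, d) = (a + c, b + d)"

fun zr_mult :: "zr \<Rightarrow> zr \<Rightarrow> zr" where
  "zr_mult (a, b) (c, d) = (a * c + 3 * (b * d), a * d + b * c)"

fun zr_neg :: "zr \<Rightarrow> zr" where
  "zr_neg (a, b) = (- a, - b)"

lemma sqrt_3_sqrt_3: "complex_of_real (sqrt 3) * complex_of_real (sqrt 3) = 3"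
  by (simp flip: of_real_mult)

lemma embed_add: "embed (zr_add a b) = embed a + embed b"
  by (cases a; cases b) (simp add: embed_def algebra_simps)

lemma embed_mult: "embed (zr_mult a b) = embed a * embed b"
proof (cases a; cases b)
  fix p q s t assume ab: "a = (p, q)" "b = (s, t)"
  have "embed a * embed b = of_int p * of_int s + of_int q * of_int t * (complex_of_real (sqrt 3) * complex_of_real (sqrt 3))
    + (of_int p * of_int t + of_int q * of_int s) * complex_of_real (sqrt 3)"
    by (simp add: ab embed_def algebra_simps)
  then show ?thesis unfolding sqrt_3_sqrt_3 by (simp add: ab embed_def algebra_simps)
qed

lemma embed_neg: "embed (zr_neg a) = - embed a"
  by (cases a) (simp add: embed_def)

lemma embed_0: "embed (0, 0) = 0"
  by (simp add: embed_def)

lemma embed_1: "embed (1, 0) = 1"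
  by (simp add: embed_def)

lemma sqrt_3_irrational: "sqrt 3 \<notin> \<rat>"
proof
  assume "sqrt 3 \<in> \<rat>"
  then obtain m n :: nat where n: "n \<noteq> 0" and sqrt: "\<bar>sqrt 3\<bar> = real m / real n" and "coprime m n"
    by (rule Rats_abs_nat_div_natE)
  then have "real m = sqrt 3 * real n" by (simp add: field_simps)
  then have "(real m)\<^sup>2 = 3 * (real n)\<^sup>2" by (simp add: power_mult_distrib)
  then have "real (m\<^sup>2) = real (3 * n\<^sup>2)" by simp
  then have eq: "m\<^sup>2 = 3 * n\<^sup>2" by (simp only: of_nat_eq_iff)
  have three: "prime (3 :: nat)" by simp
  have "3 dvd m\<^sup>2" using eq by simp
  then have m: "3 dvd m" using three prime_dvd_power by blast
  then obtain k where "m = 3 * k" by blast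
  then have "n\<^sup>2 = 3 * k\<^sup>2" using eq by (simp add: power2_eq_square)
  then have "3 dvd n" using three prime_dvd_power by (metis dvd_triv_left)
  then show False using m \<open>coprime m n\<close> by (auto dest: coprime_common_divisor)
qed

lemma embed_eq_0_iff: "embed a = 0 \<longleftrightarrow> a = (0, 0)"
proof
  assume 0: "embed a = 0"
  obtain p q where a: "a = (p, q)" by (cases a)
  have "complex_of_real (of_int p + of_int q * sqrt 3) = 0"
    using 0 by (simp add: a embed_def)
  then have eq: "of_int p + of_int q * sqrt 3 = 0" using of_real_eq_0_iff by blast
  have "q = 0"
  proof (rule ccontr)
    assume "q \<noteq> 0"
    then have "sqrt 3 = - of_int p / of_int q" using eq by (simp add: field_simps)
    then have "sqrt 3 \<in> \<rat>" by simp
    moreover have "sqrt 3 \<notin> \<rat>" by (rule sqrt_3_irrational)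
    ultimately show False by blast
  qed
  then show "a = (0, 0)" using eq a by simp
qed (simp add: embed_0)


text \<open>A form of degree \<open>d\<close> is a list of rows: entry \<open>j\<close> of row \<open>i\<close> is the coefficient of
  \<open>x\<^sup>i y\<^sup>j z\<^sup>k\<close> with \<open>k = d - i - j\<close>. Missing entries are zero. The degree is not part of the data,
  which keeps the operations on lists simple, and \<open>wf_form\<close> bounds the lengths so that the truncated
  subtractions in \<open>form_val\<close> are exact.\<close>

type_synonym zform = "zr list list"

fun row_val :: "nat \<Rightarrow> zr list \<Rightarrow> poly3" where
  "row_val d [] = 0"
| "row_val d (c # cs) = Const (embed c) * Var 3 ^ d + Var 2 * row_val (d - 1) cs"

fun form_val :: "nat \<Rightarrow> zform \<Rightarrow> poly3" where
  "form_val d [] = 0"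
| "form_val d (r # rs) = row_val d r + Var 1 * form_val (d - 1) rs"

fun wf_form :: "nat \<Rightarrow> zform \<Rightarrow> bool" where
  "wf_form d [] = True"
| "wf_form d (r # rs) = (length r \<le> Suc d \<and> (case d of 0 \<Rightarrow> rs = [] | Suc e \<Rightarrow> wf_form e rs))"

fun row_add :: "zr list \<Rightarrow> zr list \<Rightarrow> zr list" where
  "row_add [] q = q"
| "row_add p [] = p"
| "row_add (a # p) (b # q) = zr_add a b # row_add p q"

fun row_scale :: "zr \<Rightarrow> zr list \<Rightarrow> zr list" where
  "row_scale c [] = []"
| "row_scale c (a # p) = zr_mult c a # row_scale c p"

fun row_mult :: "zr list \<Rightarrow> zr list \<Rightarrow> zr list" where
  "row_mult [] q = []"
| "row_mult (c # p) q = row_add (row_scale c q) ((0, 0) # row_mult p q)"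

fun form_add :: "zform \<Rightarrow> zform \<Rightarrow> zform" where
  "form_add [] q = q"
| "form_add p [] = p"
| "form_add (a # p) (b # q) = row_add a b # form_add p q"

fun row_mult_form :: "zr list \<Rightarrow> zform \<Rightarrow> zform" where
  "row_mult_form r [] = []"
| "row_mult_form r (q # qs) = row_mult r q # row_mult_form r qs"

fun form_mult :: "zform \<Rightarrow> zform \<Rightarrow> zform" where
  "form_mult [] q = []"
| "form_mult (r # p) q = form_add (row_mult_form r q) ([] # form_mult p q)"

fun form_scale :: "zr \<Rightarrow> zform \<Rightarrow> zform" where
  "form_scale c [] = []"
| "form_scale c (r # p) = row_scale c r # form_scale c p"

definition form_sub :: "zform \<Rightarrow> zform \<Rightarrow> zform" where
  "form_sub p q = form_add p (form_scale (-1, 0) q)"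

definition form_zero :: "zform \<Rightarrow> bool" where
  "form_zero p = list_all (list_all (\<lambda>c. c = (0, 0))) p"

lemma row_val_add: "row_val d (row_add p q) = row_val d p + row_val d q"
  by (induction p q arbitrary: d rule: row_add.induct)
    (simp_all add: embed_add Const_add algebra_simps)

lemma row_val_scale: "row_val d (row_scale c p) = Const (embed c) * row_val d p"
  by (induction p arbitrary: d) (simp_all add: embed_mult Const_mult algebra_simps)

lemma row_val_raise: "length q \<le> Suc e \<Longrightarrow> row_val (d + e) q = Var 3 ^ d * row_val e q"
proof (induction q arbitrary: e)
  case (Cons c q)
  show ?case
  proof (cases e)
    case 0
    then show ?thesis using Cons.prems by (simp add: algebra_simps)
  next
    case (Suc e')
    then have "row_val (d + e') q = Var 3 ^ d * row_val e' q" using Cons by simp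
    then show ?thesis by (simp add: Suc power_add algebra_simps)
  qed
qed simp

lemma row_val_mult:
  "length p \<le> Suc d \<Longrightarrow> length q \<le> Suc e \<Longrightarrow>
    row_val (d + e) (row_mult p q) = row_val d p * row_val e q"
proof (induction p arbitrary: d)
  case (Cons c p)
  have "row_val (d + e - 1) (row_mult p q) = row_val (d - 1) p * row_val e q"
  proof (cases d)
    case 0
    then show ?thesis using Cons.prems by simp
  next
    case (Suc d')
    then show ?thesis using Cons by simp
  qed
  then show ?case
    using row_val_raise[OF Cons.prems(2), of d]
    by (simp add: row_val_add row_val_scale embed_0 algebra_simps)
qed simp

lemma form_val_add: "form_val d (form_add p q) = form_val d p + form_val d q"
  by (induction p q arbitrary: d rule: form_add.induct)
    (simp_all add: row_val_add algebra_simps)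

lemma form_val_scale: "form_val d (form_scale c p) = Const (embed c) * form_val d p"
  by (induction p arbitrary: d) (simp_all add: row_val_scale algebra_simps)

lemma form_val_sub: "form_val d (form_sub p q) = form_val d p - form_val d q"
proof -
  have "embed (-1, 0) = -1" by (simp add: embed_def)
  then show ?thesis by (simp add: form_sub_def form_val_add form_val_scale Const_uminus)
qed

lemma form_val_row_mult:
  "length r \<le> Suc d \<Longrightarrow> wf_form e q \<Longrightarrow>
    form_val (d + e) (row_mult_form r q) = row_val d r * form_val e q"
proof (induction q arbitrary: e)
  case (Cons s q)
  have "form_val (d + e - 1) (row_mult_form r q) = row_val d r * form_val (e - 1) q"
    using Cons by (cases e) simp_all
  then show ?case using Cons.prems by (simp add: row_val_mult algebra_simps)
qed simp

lemma form_val_mult: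
  "wf_form d p \<Longrightarrow> wf_form e q \<Longrightarrow>
    form_val (d + e) (form_mult p q) = form_val d p * form_val e q"
proof (induction p arbitrary: d)
  case (Cons r p)
  have "form_val (d + e - 1) (form_mult p q) = form_val (d - 1) p * form_val e q"
    using Cons by (cases d) simp_all
  then show ?case
    using Cons.prems by (simp add: form_val_add form_val_row_mult algebra_simps)
qed simp

lemma form_val_zero: "form_zero p \<Longrightarrow> form_val d p = 0"
proof (induction p arbitrary: d)
  case (Cons r p)
  have "list_all (\<lambda>c. c = (0, 0)) r \<Longrightarrow> row_val d r = 0"
    by (induction r arbitrary: d) (simp_all add: embed_0)
  then show ?case using Cons by (simp add: form_zero_def)
qed simp

lemma row_val_is_form: "length r \<le> Suc d \<Longrightarrow> is_form d (row_val d r)"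
proof (induction r arbitrary: d)
  case (Cons c r)
  have "is_form (0 + d * 1) (Const (embed c) * Var 3 ^ d)"
    by (rule is_form_mult[OF is_form_Const is_form_power[OF is_form_Var]])
  moreover have "is_form d (Var 2 * row_val (d - 1) r)"
  proof (cases d)
    case 0
    then show ?thesis using Cons.prems by simp
  next
    case (Suc e)
    then show ?thesis using is_form_mult[OF is_form_Var Cons.IH, of e 2] Cons.prems by simp
  qed
  ultimately show ?case by (simp add: is_form_add)
qed simp

lemma form_val_is_form: "wf_form d p \<Longrightarrow> is_form d (form_val d p)"
proof (induction p arbitrary: d)
  case (Cons r p)
  have "is_form d (Var 1 * form_val (d - 1) p)"
  proof (cases d)
    case 0
    then show ?thesis using Cons.prems by simp
  next
    case (Suc e)
    then show ?thesis using is_form_mult[OF is_form_Var Cons.IH, of e 1] Cons.prems by simp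
  qed
  then show ?case using Cons.prems by (simp add: is_form_add row_val_is_form)
qed simp

type_synonym zline = "zr \<times> zr \<times> zr"

fun line_coeffs :: "zline \<Rightarrow> complex ^ 3" where
  "line_coeffs (a, b, c) = vector [embed a, embed b, embed c]"

fun line_form :: "zline \<Rightarrow> zform" where
  "line_form (a, b, c) = [[c, b], [a]]"

lemma form_val_line: "form_val 1 (line_form m) = lin (line_coeffs m)"
  by (cases m) (simp add: lin_def sum_3 vector_3 algebra_simps)

lemma wf_line_form: "wf_form (Suc 0) (line_form m)"
  by (cases m) simp


lemma length_row_add: "length (row_add p q) = max (length p) (length q)"
  by (induction p q rule: row_add.induct) simp_all

lemma length_row_scale: "length (row_scale c p) = length p"
  by (induction p) simp_all

lemma length_row_mult:
  "length p \<le> Suc d \<Longrightarrow> length q \<le> Suc e \<Longrightarrow> length (row_mult p q) \<le> Suc (d + e)"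
proof (induction p arbitrary: d)
  case (Cons c p)
  have "length (row_mult p q) \<le> d + e"
    using Cons by (cases d) simp_all
  then show ?case using Cons.prems by (simp add: length_row_add length_row_scale)
qed simp

lemma wf_form_add: "wf_form d p \<Longrightarrow> wf_form d q \<Longrightarrow> wf_form d (form_add p q)"
  by (induction p q arbitrary: d rule: form_add.induct)
    (auto simp: length_row_add split: nat.splits)

lemma wf_form_scale: "wf_form d p \<Longrightarrow> wf_form d (form_scale c p)"
  by (induction p arbitrary: d) (auto simp: length_row_scale split: nat.splits)

lemma wf_form_sub: "wf_form d p \<Longrightarrow> wf_form d q \<Longrightarrow> wf_form d (form_sub p q)"
  by (simp add: form_sub_def wf_form_add wf_form_scale)

lemma wf_row_mult_form:
  "length r \<le> Suc d \<Longrightarrow> wf_form e q \<Longrightarrow> wf_form (d + e) (row_mult_form r q)"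
proof (induction q arbitrary: e)
  case (Cons s q)
  then have *: "length (row_mult r s) \<le> Suc (d + e)" by (simp add: length_row_mult)
  show ?case
  proof (cases e)
    case 0
    then show ?thesis using Cons * by (cases d) simp_all
  next
    case (Suc e')
    then show ?thesis using Cons * by simp
  qed
qed simp

lemma wf_form_mult: "wf_form d p \<Longrightarrow> wf_form e q \<Longrightarrow> wf_form (d + e) (form_mult p q)"
proof (induction p arbitrary: d)
  case (Cons r p)
  have "wf_form (d + e) ([] # form_mult p q)"
    using Cons by (cases d) (simp_all split: nat.split)
  then show ?case
    using Cons.prems by (simp add: wf_form_add wf_row_mult_form)
qed simp

fun lincomb :: "zform list \<Rightarrow> zform list \<Rightarrow> zform" where
  "lincomb [] qs = []"
| "lincomb (p # ps) [] = []"
| "lincomb (p # ps) (q # qs) = form_add (form_mult p q) (lincomb ps qs)"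

lemma form_val_lincomb:
  assumes "length ps = length qs"
    and "\<And>i. i < length ps \<Longrightarrow> wf_form (d i) (ps ! i) \<and> wf_form (e i) (qs ! i) \<and> d i + e i = r"
  shows "form_val r (lincomb ps qs) = (\<Sum>i<length ps. form_val (d i) (ps ! i) * form_val (e i) (qs ! i))"
  using assms
proof (induction ps qs arbitrary: d e rule: list_induct2)
  case (Cons p ps q qs)
  have "form_val r (form_mult p q) = form_val (d 0) p * form_val (e 0) q"
    using Cons.prems[of 0] form_val_mult by fastforce
  moreover have "form_val r (lincomb ps qs)
      = (\<Sum>i<length ps. form_val (d (Suc i)) (ps ! i) * form_val (e (Suc i)) (qs ! i))"
    by (rule Cons.IH) (use Cons.prems[of "Suc _"] in simp)
  ultimately show ?case by (simp add: form_val_add sum.lessThan_Suc_shift del: sum.lessThan_Suc)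
qed simp

text \<open>A form with its three partial derivatives. The product of the lines and its gradient are computed
  together by the product rule.\<close>

type_synonym jet = "zform \<times> zform \<times> zform \<times> zform"

fun jet_mult :: "zline \<Rightarrow> jet \<Rightarrow> jet" where
  "jet_mult (a, b, c) (p, px, py, pz) =
     (form_mult (line_form (a, b, c)) p,
      form_add (form_scale a p) (form_mult (line_form (a, b, c)) px),
      form_add (form_scale b p) (form_mult (line_form (a, b, c)) py),
      form_add (form_scale c p) (form_mult (line_form (a, b, c)) pz))"

fun jet_prod :: "zline list \<Rightarrow> jet" where
  "jet_prod [] = ([[(1, 0)]], [], [], [])"
| "jet_prod [(a, b, c)] = (line_form (a, b, c), [[a]], [[b]], [[c]])"
| "jet_prod (m # m' # ms) = jet_mult m (jet_prod (m' # ms))"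

fun jet_of :: "nat \<Rightarrow> jet \<Rightarrow> poly3 \<Rightarrow> bool" where
  "jet_of d (p, px, py, pz) f \<longleftrightarrow> wf_form (Suc d) p \<and> wf_form d px \<and> wf_form d py \<and> wf_form d pz
     \<and> form_val (Suc d) p = f \<and> form_val d px = grad f $ 1
     \<and> form_val d py = grad f $ 2 \<and> form_val d pz = grad f $ 3"

lemma jet_mult:
  assumes "jet_of d j f" shows "jet_of (Suc d) (jet_mult m j) (lin (line_coeffs m) * f)"
proof -
  obtain a b c where m: "m = (a, b, c)" by (cases m)
  obtain p px py pz where j: "j = (p, px, py, pz)" by (cases j)
  let ?m = "line_form m"
  note jet = assms[unfolded j, simplified]
  have mult: "wf_form (Suc e) (form_mult ?m u)"
    "form_val (Suc e) (form_mult ?m u) = lin (line_coeffs m) * form_val e u" if "wf_form e u" for e u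
    using wf_form_mult[OF wf_line_form that, of m] form_val_mult[OF wf_line_form that, of m]
      form_val_line[of m] by simp_all
  have "grad (lin (line_coeffs m) * f) $ i
      = Const (line_coeffs m $ i) * f + lin (line_coeffs m) * grad f $ i" for i
    by (simp add: grad_def partial_deriv_mult partial_deriv_lin)
  then show ?thesis
    using jet mult[of "Suc d" p] mult[of d px] mult[of d py] mult[of d pz]
    unfolding j m jet_mult.simps jet_of.simps
    by (simp add: wf_form_add wf_form_scale form_val_add form_val_scale vector_3 del: line_form.simps)
qed

lemma jet_prod:
  "ms \<noteq> [] \<Longrightarrow> jet_of (length ms - 1) (jet_prod ms) (prod_list (map (\<lambda>m. lin (line_coeffs m)) ms))"
proof (induction ms rule: jet_prod.induct)
  case (2 a b c)
  show ?case
    using form_val_line[of "(a, b, c)"]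
    by (simp add: grad_def partial_deriv_lin vector_3)
next
  case (3 m m' ms)
  then show ?case
    using jet_mult[of "length ms" "jet_prod (m' # ms)" _ m] by simp
qed simp


section \<open>Certificates\<close>

text \<open>The coefficient of \<open>x\<^sup>d\<close>; it serves to see that a form does not vanish.\<close>

fun top_coeff :: "nat \<Rightarrow> zform \<Rightarrow> zr" where
  "top_coeff d [] = (0, 0)"
| "top_coeff 0 (r # rs) = (case r of [] \<Rightarrow> (0, 0) | c # _ \<Rightarrow> c)"
| "top_coeff (Suc d) (r # rs) = top_coeff d rs"

lemma top_coeff:
  "wf_form d p \<Longrightarrow> eval_poly3 (form_val d p) (axis 1 1) = embed (top_coeff d p)"
proof -
  have row: "eval_poly3 (row_val d r) (axis 1 1)
      = (if d = 0 then case r of [] \<Rightarrow> 0 | c # _ \<Rightarrow> embed c else 0)" for d r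
    by (cases r) (simp_all add: eval_poly3_zero eval_poly3_add eval_poly3_mult eval_poly3_power
        eval_poly3_Var axis_def)
  have axis: "axis 1 1 $ 1 = (1 :: complex)" by (simp add: axis_def)
  show "wf_form d p \<Longrightarrow> ?thesis"
    by (induction d p rule: top_coeff.induct)
      (auto simp: eval_poly3_zero eval_poly3_add eval_poly3_mult eval_poly3_Var axis row embed_0
        split: list.splits)
qed

lemma form_val_Var_powers:
  "form_val q (replicate q [] @ [[k]]) = Const (embed k) * Var 1 ^ q"
  "form_val q [replicate q (0, 0) @ [k]] = Const (embed k) * Var 2 ^ q"
  "form_val q [[k]] = Const (embed k) * Var 3 ^ q"
proof -
  show "form_val q (replicate q [] @ [[k]]) = Const (embed k) * Var 1 ^ q"
    by (induction q) (simp_all add: algebra_simps)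
  have "row_val q (replicate q (0, 0) @ [k]) = Const (embed k) * Var 2 ^ q"
    by (induction q) (simp_all add: embed_0 algebra_simps)
  then show "form_val q [replicate q (0, 0) @ [k]] = Const (embed k) * Var 2 ^ q" by simp
qed simp

definition zminor :: "zform list \<Rightarrow> zform list \<Rightarrow> nat \<Rightarrow> nat \<Rightarrow> zform" where
  "zminor B E i j = form_sub (form_mult (B ! i) (E ! j)) (form_mult (B ! j) (E ! i))"

definition zminors :: "zform list \<Rightarrow> zform list \<Rightarrow> zform list" where
  "zminors B E = [zminor B E 0 1, zminor B E 0 2, zminor B E 0 3,
     zminor B E 1 2, zminor B E 1 3, zminor B E 2 3]"

text \<open>States \<open>N (u \<times> v) = K m \<nabla>F\<close> for the jet of \<open>F\<close>.\<close>

fun cross_check :: "zr \<Rightarrow> zr \<Rightarrow> zform \<Rightarrow> zform \<times> zform \<times> zform \<Rightarrow> zform \<times> zform \<times> zform \<Rightarrow> jet \<Rightarrow> bool" where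
  "cross_check N K m (x, y, z) (x', y', z') (p, px, py, pz) \<longleftrightarrow>
     form_zero (form_sub (form_scale N (form_sub (form_mult y z') (form_mult z y'))) (form_scale K (form_mult m px))) \<and>
     form_zero (form_sub (form_scale N (form_sub (form_mult z x') (form_mult x z'))) (form_scale K (form_mult m py))) \<and>
     form_zero (form_sub (form_scale N (form_sub (form_mult x y') (form_mult y x'))) (form_scale K (form_mult m pz)))"

definition wf_forms :: "nat list \<Rightarrow> zform list \<Rightarrow> bool" where
  "wf_forms ds ps = list_all2 wf_form ds ps"

lemma wf_forms_nth: "wf_forms ds ps \<Longrightarrow> i < length ds \<Longrightarrow> wf_form (ds ! i) (ps ! i)"
  unfolding wf_forms_def by (rule list_all2_nthD)

fun zcross :: "zline \<Rightarrow> zline \<Rightarrow> zline" where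
  "zcross (a, b, c) (a', b', c') =
     (zr_add (zr_mult b c') (zr_neg (zr_mult c b')),
      zr_add (zr_mult c a') (zr_neg (zr_mult a c')),
      zr_add (zr_mult a b') (zr_neg (zr_mult b a')))"

fun zpairing :: "zline \<Rightarrow> zline \<Rightarrow> zr" where
  "zpairing (a, b, c) (a', b', c') = zr_add (zr_mult a a') (zr_add (zr_mult b b') (zr_mult c c'))"

lemma line_coeffs_cross: "line_coeffs (zcross a b) = cross (line_coeffs a) (line_coeffs b)"
  by (cases a; cases b)
    (simp add: vec_eq_iff forall_3 vector_3 embed_add embed_mult embed_neg del: zr_add.simps zr_mult.simps zr_neg.simps)

lemma embed_pairing: "embed (zpairing a b) = pairing (line_coeffs a) (line_coeffs b)"
  by (cases a; cases b)
    (simp add: pairing_def vector_3 embed_add embed_mult del: zr_add.simps zr_mult.simps)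

lemma line_coeffs_eq_0_iff: "line_coeffs a = 0 \<longleftrightarrow> a = ((0, 0), (0, 0), (0, 0))"
  by (cases a) (simp add: vec_eq_iff forall_3 vector_3 embed_eq_0_iff)

definition distinct_lines :: "zline list \<Rightarrow> bool" where
  "distinct_lines ms \<longleftrightarrow> sorted_wrt (\<lambda>a b. zcross a b \<noteq> ((0, 0), (0, 0), (0, 0))) ms \<and>
     list_all (\<lambda>a. a \<noteq> ((0, 0), (0, 0), (0, 0))) ms"

lemma prod_list_map_nth: "prod_list (map g xs) = (\<Prod>i<length xs. g (xs ! i))"
  by (induction xs) (simp_all add: prod.lessThan_Suc_shift del: prod.lessThan_Suc)

lemma line_product_lines:
  assumes "ms \<noteq> []" "c \<noteq> 0" "distinct_lines ms"
    and f: "f = Const c * prod_list (map (\<lambda>m. lin (line_coeffs m)) ms)"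
  shows "line_product (length ms) (\<lambda>i. line_coeffs (ms ! i)) c f"
proof
  show "0 < length ms" "c \<noteq> 0" using assms by simp_all
  have lt: "cross (line_coeffs (ms ! i)) (line_coeffs (ms ! j)) \<noteq> 0" if "i < j" "j < length ms" for i j
    using assms(3) that
    by (simp add: distinct_lines_def sorted_wrt_iff_nth_less line_coeffs_eq_0_iff flip: line_coeffs_cross)
  have anti: "cross u v = - cross v u" for u v :: "complex ^ 3"
    by (simp add: vec_eq_iff forall_3)
  show "cross (line_coeffs (ms ! i)) (line_coeffs (ms ! j)) \<noteq> 0"
    if "i < length ms" "j < length ms" "i \<noteq> j" for i j
    using lt[of i j] lt[of j i] that anti[of "line_coeffs (ms ! i)"] by (cases "i < j") auto
  show "line_coeffs (ms ! i) \<noteq> 0" if "i < length ms" for i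
    using assms(3) that by (simp add: distinct_lines_def list_all_length line_coeffs_eq_0_iff)
  have "prod_list (map (\<lambda>m. lin (line_coeffs m)) ms) = (\<Prod>i<length ms. lin (line_coeffs (ms ! i)))"
    by (rule prod_list_map_nth)
  then show "f = Const c * (\<Prod>i<length ms. lin (line_coeffs (ms ! i)))" using f by simp
qed

text \<open>The lists \<open>B\<close> and \<open>E\<close> are the two columns of the matrix. The coordinates of \<open>\<rho> i\<close>, of degree
  \<open>9 - i\<close>, are at position \<open>i\<close> of \<open>X\<close>, \<open>Y\<close> and \<open>Z\<close>. The lists \<open>P1, P2, P3\<close> are coefficients for
  writing multiples of powers of \<open>x, y, z\<close> as combinations of the six minors, whose degrees are
  \<open>2, 3, 4, 4, 5, 6\<close> in the order of \<open>zminors\<close>.\<close>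

locale certificate =
  fixes ms :: "zline list" and c :: complex and f :: poly3
    and B E X Y Z :: "zform list" and N K :: zr
    and P1 P2 P3 :: "zform list" and k1 k2 k3 :: zr and q1 q2 q3 :: nat
  assumes ms: "length ms = 12" "distinct_lines ms" and c: "c \<noteq> 0"
    and f: "f = Const c * prod_list (map (\<lambda>m. lin (line_coeffs m)) ms)"
    and wf: "wf_forms [1, 2, 3, 4] B" "wf_forms [0, 1, 2, 3] E"
      "wf_forms [9, 8, 7, 6] X" "wf_forms [9, 8, 7, 6] Y" "wf_forms [9, 8, 7, 6] Z"
    and rel_B: "form_zero (lincomb B X)" "form_zero (lincomb B Y)" "form_zero (lincomb B Z)"
    and rel_E: "form_zero (lincomb E X)" "form_zero (lincomb E Y)" "form_zero (lincomb E Z)"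
    and cr: "cross_check N K (zminor B E 0 1) (X ! 2, Y ! 2, Z ! 2) (X ! 3, Y ! 3, Z ! 3) (jet_prod ms)"
    and NK: "N \<noteq> (0, 0)" "K \<noteq> (0, 0)"
    and top: "top_coeff 2 (zminor B E 0 1) \<noteq> (0, 0)"
    and q: "q1 \<ge> 6" "q2 \<ge> 6" "q3 \<ge> 6" and k: "k1 \<noteq> (0, 0)" "k2 \<noteq> (0, 0)" "k3 \<noteq> (0, 0)"
    and wf_P: "wf_forms [q1 - 2, q1 - 3, q1 - 4, q1 - 4, q1 - 5, q1 - 6] P1"
      "wf_forms [q2 - 2, q2 - 3, q2 - 4, q2 - 4, q2 - 5, q2 - 6] P2"
      "wf_forms [q3 - 2, q3 - 3, q3 - 4, q3 - 4, q3 - 5, q3 - 6] P3"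
    and P: "form_zero (form_sub (lincomb P1 (zminors B E)) (replicate q1 [] @ [[k1]]))"
      "form_zero (form_sub (lincomb P2 (zminors B E)) [replicate q2 (0, 0) @ [k2]])"
      "form_zero (form_sub (lincomb P3 (zminors B E)) [[k3]])"
begin

definition b :: "nat \<Rightarrow> poly3" where "b i = form_val (i + 1) (B ! i)"
definition e :: "nat \<Rightarrow> poly3" where "e i = form_val i (E ! i)"
definition \<rho> :: "nat \<Rightarrow> poly3 ^ 3" where
  "\<rho> i = vector [form_val (9 - i) (X ! i), form_val (9 - i) (Y ! i), form_val (9 - i) (Z ! i)]"

sublocale two_columns b e .

lemma line_product: "line_product 12 (\<lambda>i. line_coeffs (ms ! i)) c f"
  using line_product_lines[OF _ c ms(2) f] ms(1) by force

lemma wf_nth: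
  assumes "i < 4"
  shows "wf_form (i + 1) (B ! i)" "wf_form i (E ! i)"
    "wf_form (9 - i) (X ! i)" "wf_form (9 - i) (Y ! i)" "wf_form (9 - i) (Z ! i)"
proof -
  have "[1, 2, 3, 4] ! i = i + 1" "[0, 1, 2, 3] ! i = i" "[9, 8, 7, 6] ! i = 9 - i"
    using assms by (auto simp: eval_nat_numeral less_Suc_eq)
  moreover have "wf_form ([1, 2, 3, 4] ! i) (B ! i)" "wf_form ([0, 1, 2, 3] ! i) (E ! i)"
    "wf_form ([9, 8, 7, 6] ! i) (X ! i)" "wf_form ([9, 8, 7, 6] ! i) (Y ! i)" "wf_form ([9, 8, 7, 6] ! i) (Z ! i)"
    using wf[THEN wf_forms_nth, of i] assms by simp_all
  ultimately show "wf_form (i + 1) (B ! i)" "wf_form i (E ! i)"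
    "wf_form (9 - i) (X ! i)" "wf_form (9 - i) (Y ! i)" "wf_form (9 - i) (Z ! i)"
    by metis+
qed

lemma lengths: "length B = 4" "length E = 4" "length X = 4" "length Y = 4" "length Z = 4"
  using wf by (auto simp: wf_forms_def list_all2_conv_all_nth)

lemma minor_eq:
  assumes "i < 4" "j < 4"
  shows "wf_form (i + j + 1) (zminor B E i j)" "form_val (i + j + 1) (zminor B E i j) = minor i j"
proof -
  have *: "i + 1 + j = i + j + 1" "j + 1 + i = i + j + 1" by simp_all
  note w = wf_nth[OF assms(1)] wf_nth[OF assms(2)]
  have "wf_form (i + j + 1) (form_mult (B ! i) (E ! j))" "wf_form (i + j + 1) (form_mult (B ! j) (E ! i))"
    using wf_form_mult[OF w(1,7)] wf_form_mult[OF w(6,2)] unfolding * .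
  then show "wf_form (i + j + 1) (zminor B E i j)" by (simp add: zminor_def wf_form_sub)
  have "form_val (i + j + 1) (form_mult (B ! i) (E ! j)) = b i * e j"
    "form_val (i + j + 1) (form_mult (B ! j) (E ! i)) = b j * e i"
    using form_val_mult[OF w(1,7)] form_val_mult[OF w(6,2)] unfolding * b_def e_def .
  then show "form_val (i + j + 1) (zminor B E i j) = minor i j"
    by (simp add: zminor_def minor_def form_val_sub)
qed

lemma relations:
  assumes "W = X \<and> k = 1 \<or> W = Y \<and> k = 2 \<or> W = Z \<and> k = 3"
  shows "(\<Sum>i<4. b i * \<rho> i $ k) = 0" "(\<Sum>i<4. e i * \<rho> i $ k) = 0"
proof -
  have \<rho>: "\<rho> i $ k = form_val (9 - i) (W ! i)" for i
    using assms by (auto simp: \<rho>_def vector_3)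
  have W: "length W = 4" "form_zero (lincomb B W)" "form_zero (lincomb E W)"
    using assms lengths rel_B rel_E by auto
  have wf_W: "wf_form (9 - i) (W ! i)" if "i < 4" for i
    using wf_nth[OF that] assms by blast
  have "form_val 10 (lincomb B W) = (\<Sum>i<length B. form_val (i + 1) (B ! i) * form_val (9 - i) (W ! i))"
    using wf_nth wf_W by (intro form_val_lincomb) (auto simp: W lengths)
  then show "(\<Sum>i<4. b i * \<rho> i $ k) = 0"
    using form_val_zero[OF W(2)] by (simp add: lengths b_def \<rho>)
  have "form_val 9 (lincomb E W) = (\<Sum>i<length E. form_val i (E ! i) * form_val (9 - i) (W ! i))"
    using wf_nth wf_W by (intro form_val_lincomb) (auto simp: W lengths)
  then show "(\<Sum>i<4. e i * \<rho> i $ k) = 0"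
    using form_val_zero[OF W(3)] by (simp add: lengths e_def \<rho>)
qed

lemma powers:
  assumes "q \<ge> 6" "k \<noteq> (0, 0)" "wf_forms [q - 2, q - 3, q - 4, q - 4, q - 5, q - 6] P"
    and zero: "form_zero (form_sub (lincomb P (zminors B E)) R)"
    and R: "form_val q R = Const (embed k) * Var i ^ q"
  shows "Var i ^ q \<in> minor_ideal"
proof -
  obtain p0 p1 p2 p3 p4 p5 where P: "P = [p0, p1, p2, p3, p4, p5]"
    and w: "wf_form (q - 2) p0" "wf_form (q - 3) p1" "wf_form (q - 4) p2" "wf_form (q - 4) p3"
      "wf_form (q - 5) p4" "wf_form (q - 6) p5"
    using assms(3) by (auto simp: wf_forms_def list_all2_Cons1)
  have mult: "form_val q (form_mult p (zminor B E i j)) = form_val (q - (i + j + 1)) p * minor i j"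
    if "wf_form (q - (i + j + 1)) p" "i < 4" "j < 4" "i + j + 1 \<le> 6" for p i j
    using form_val_mult[OF that(1) minor_eq(1)[OF that(2,3)]] minor_eq(2)[OF that(2,3)] that(4) assms(1)
    by simp
  have "form_val q (lincomb P (zminors B E)) = form_val (q - 2) p0 * minor 0 1 + form_val (q - 3) p1 * minor 0 2
    + form_val (q - 4) p2 * minor 0 3 + form_val (q - 4) p3 * minor 1 2 + form_val (q - 5) p4 * minor 1 3
    + form_val (q - 6) p5 * minor 2 3"
    using w mult[of 0 1 p0] mult[of 0 2 p1] mult[of 0 3 p2] mult[of 1 2 p3] mult[of 1 3 p4] mult[of 2 3 p5]
    by (simp add: P zminors_def form_val_add numeral_eq_Suc)
  moreover have "form_val q (lincomb P (zminors B E)) = Const (embed k) * Var i ^ q"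
    using form_val_zero[OF zero, of q] by (simp add: form_val_sub R)
  ultimately have eq: "Const (embed k) * Var i ^ q = form_val (q - 2) p0 * minor 0 1 + form_val (q - 3) p1 * minor 0 2
    + form_val (q - 4) p2 * minor 0 3 + form_val (q - 4) p3 * minor 1 2 + form_val (q - 5) p4 * minor 1 3
    + form_val (q - 6) p5 * minor 2 3" by simp
  have "embed k \<noteq> 0" using assms(2) by (simp add: embed_eq_0_iff)
  then have "Var i ^ q = Const (1 / embed k) * (Const (embed k) * Var i ^ q)"
    using Const_inverse[of "embed k"] by (simp flip: mult.assoc)
  moreover have "Const (embed k) * Var i ^ q \<in> minor_ideal"
    unfolding minor_ideal_def mem_Collect_eq
    by (rule exI[of _ "\<lambda>j. form_val (q - ([2, 3, 4, 4, 5, 6] ! j)) ([p0, p1, p2, p3, p4, p5] ! j)"])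
      (simp add: eq numeral_eq_Suc)
  ultimately show ?thesis using minor_ideal_mult by metis
qed

lemma cross_eq:
  "Const (embed N) * cross (\<rho> 2) (\<rho> 3) $ i
    = Const (embed K) * minor 0 1 * grad (prod_list (map (\<lambda>m. lin (line_coeffs m)) ms)) $ i"
proof -
  let ?F = "prod_list (map (\<lambda>m. lin (line_coeffs m)) ms)"
  obtain p px py pz where j: "jet_prod ms = (p, px, py, pz)" by (cases "jet_prod ms")
  have "ms \<noteq> []" using ms(1) by auto
  then have jet: "jet_of 11 (p, px, py, pz) ?F" using jet_prod[of ms] ms(1) by (simp add: j)
  have w2: "wf_form 7 (X ! 2)" "wf_form 7 (Y ! 2)" "wf_form 7 (Z ! 2)"
    and w3: "wf_form 6 (X ! 3)" "wf_form 6 (Y ! 3)" "wf_form 6 (Z ! 3)"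
    using wf_nth(3-5)[of 2] wf_nth(3-5)[of 3] by simp_all
  have \<rho>2: "\<rho> 2 $ 1 = form_val 7 (X ! 2)" "\<rho> 2 $ 2 = form_val 7 (Y ! 2)" "\<rho> 2 $ 3 = form_val 7 (Z ! 2)"
    and \<rho>3: "\<rho> 3 $ 1 = form_val 6 (X ! 3)" "\<rho> 3 $ 2 = form_val 6 (Y ! 3)" "\<rho> 3 $ 3 = form_val 6 (Z ! 3)"
    by (simp_all add: \<rho>_def vector_3)
  have m: "wf_form 2 (zminor B E 0 1)" "form_val 2 (zminor B E 0 1) = minor 0 1"
    using minor_eq[of 0 1] by (simp_all add: numeral_2_eq_2)
  have mult: "form_val 13 (form_mult u v) = form_val 7 u * form_val 6 v"
    "form_val 13 (form_mult v u) = form_val 6 v * form_val 7 u" if "wf_form 7 u" "wf_form 6 v" for u v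
    using form_val_mult[OF that] form_val_mult[OF that(2,1)] by simp_all
  have mult': "form_val 13 (form_mult (zminor B E 0 1) u) = minor 0 1 * form_val 11 u" if "wf_form 11 u" for u
    using form_val_mult[OF m(1) that] m(2) by simp
  have check: "Const (embed N) * (form_val 7 u * form_val 6 v' - form_val 7 v * form_val 6 u')
      = Const (embed K) * (minor 0 1 * form_val 11 w)"
    if "form_zero (form_sub (form_scale N (form_sub (form_mult u v') (form_mult v u')))
        (form_scale K (form_mult (zminor B E 0 1) w)))"
      "wf_form 7 u" "wf_form 7 v" "wf_form 6 u'" "wf_form 6 v'" "wf_form 11 w" for u v u' v' w
    using form_val_zero[OF that(1), of 13] that(2-6)
    by (simp add: form_val_sub form_val_scale mult mult' del: One_nat_def)
  have "wf_form 11 px" "wf_form 11 py" "wf_form 11 pz"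
    and g: "form_val 11 px = grad ?F $ 1" "form_val 11 py = grad ?F $ 2" "form_val 11 pz = grad ?F $ 3"
    using jet by simp_all
  then show ?thesis
    using cr[unfolded j cross_check.simps] check w2 w3 exhaust_3[of i]
    by (auto simp: \<rho>2 \<rho>3 mult.assoc simp flip: g)
qed

lemma relation_data: "relation_data 12 (\<lambda>i. line_coeffs (ms ! i)) c f b e \<rho> (embed K / (embed N * c)) q1 q2 q3"
proof -
  interpret line_product 12 "\<lambda>i. line_coeffs (ms ! i)" c f by (rule line_product)
  have N: "embed N \<noteq> 0" "embed K \<noteq> 0" using NK by (simp_all add: embed_eq_0_iff)
  show ?thesis
  proof unfold_locales
    have ex: "\<exists>W. W = X \<and> k = 1 \<or> W = Y \<and> k = 2 \<or> W = Z \<and> k = 3" for k :: 3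
      using exhaust_3[of k] by blast
    show "(\<Sum>i<4. b i * \<rho> i $ k) = 0" for k
      by (rule exE[OF ex[of k]], rule relations(1))
    show "(\<Sum>i<4. e i * \<rho> i $ k) = 0" for k
      by (rule exE[OF ex[of k]], rule relations(2))
    show "cross (\<rho> 2) (\<rho> 3) $ k = Const (embed K / (embed N * c)) * minor 0 1 * grad f $ k" for k
    proof -
      let ?g = "grad (prod_list (map (\<lambda>m. lin (line_coeffs m)) ms)) $ k"
      have "grad f $ k = Const c * ?g"
        unfolding f by (simp add: grad_def partial_deriv_mult)
      moreover have "Const (embed K / (embed N * c)) * Const c = Const (1 / embed N) * Const (embed K)"
        using c by (simp flip: Const_mult)
      ultimately have "Const (embed K / (embed N * c)) * minor 0 1 * grad f $ k
          = Const (1 / embed N) * (Const (embed K) * minor 0 1 * ?g)" by algebra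
      also have "\<dots> = Const (1 / embed N) * (Const (embed N) * cross (\<rho> 2) (\<rho> 3) $ k)"
        by (simp only: cross_eq)
      also have "\<dots> = cross (\<rho> 2) (\<rho> 3) $ k"
        using Const_inverse[OF N(1)] by (simp flip: mult.assoc)
      finally show ?thesis by simp
    qed
    show "embed K / (embed N * c) \<noteq> 0" using N c by simp
    show "minor 0 1 \<noteq> 0"
    proof
      assume "minor 0 1 = 0"
      then have "embed (top_coeff 2 (zminor B E 0 1)) = 0"
        using top_coeff[of 2 "zminor B E 0 1"] minor_eq[of 0 1]
        by (simp add: numeral_2_eq_2 eval_poly3_zero)
      then show False using top by (simp add: embed_eq_0_iff)
    qed
    show "Var 1 ^ q1 \<in> minor_ideal" "Var 2 ^ q2 \<in> minor_ideal" "Var 3 ^ q3 \<in> minor_ideal"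
      by (rule powers[OF q(1) k(1) wf_P(1) P(1)] powers[OF q(2) k(2) wf_P(2) P(2)]
          powers[OF q(3) k(3) wf_P(3) P(3)]; rule form_val_Var_powers)+
  qed
qed

lemma forms:
  assumes "i < 4"
  shows "is_form (9 - i) (\<rho> i $ k)" "is_form (i + 1) (b i)" "is_form i (e i)"
  using wf_nth[OF assms, THEN form_val_is_form] exhaust_3[of k]
  by (auto simp: \<rho>_def b_def e_def vector_3)

end


section \<open>Generators, relations and minors of the two arrangements\<close>

text \<open>The suffixes \<open>_1\<close> and \<open>_2\<close> refer to the arrangements for the parameters \<open>(-3, 3)\<close> and
  \<open>(s', t')\<close>. The lines are listed in the order of the factors, each up to a constant. The relations
  in \<open>gens_x\<close>, \<open>gens_y\<close>, \<open>gens_z\<close> and the linear relations between them solve systems of linear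
  equations for their coefficients; integral solutions with small coefficients are listed.\<close>

definition lines_1 :: "zline list" where
  "lines_1 =
    [((1,0), (0,0), (0,0)), ((0,0), (1,0), (0,0)), ((0,0), (0,0), (1,0)), ((1,0), (1,0), (1, 0)), ((1,0),
    (1,0), (3,0)), ((1,0), (-1,0), (1,0)), ((0,0), (1,0), (1,0)), ((1,0), (-6, 0), (0,0)), ((7,0), (0,0),
    (6,0)), ((1,0), (-3,0), (3,0)), ((7,0), (3,0), (9,0)), ((7,0), (-21,0), (9,0))]"

definition rel10_1 :: "zform list" where
  "rel10_1 =
    [[], [[(198,0), (-756,0), (126,0)], [(294,0), (-462,0)], [(196,0)]], [[(27,0), (-45,0), (-51,0),
    (21,0)], [(51,0), (-44,0), (-35,0)], [(35,0), (7,0)], [(7,0)]], [[(108,0), (-45, 0), (-153,0), (849,0),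
    (-231,0)], [(135,0), (306,0), (-719,0), (574,0)], [(-42,0), (273,0), (-385,0)], [(-105,0), (42,0)]]]"

definition rel9_1 :: "zform list" where
  "rel9_1 =
    [[[(1,0)]], [], [], []]"

definition gens_x_1 :: "zform list" where
  "gens_x_1 =
    [[], [[], [(-2187,0), (-3888,0), (4698,0), (5319,0), (-10611,0), (-7182,0), (2916,0), (567, 0)],
    [(-8667,0), (-13284,0), (10791,0), (21042,0), (-9675,0), (-12582,0), (567,0)], [(-13419, 0), (-16812,0),
    (6534,0), (23208,0), (1641,0), (-2352,0)], [(-10230,0), (-9520,0), (-1256, 0), (9418,0), (476,0)],
    [(-3977,0), (-2236,0), (-2044,0), (1001,0)], [(-735,0), (-140,0), (-259,0)], [(-49,0)]], [[],
    [(21870,0), (-5832,0), (-76140,0), (31320,0), (-23490,0), (22464, 0), (9072,0)], [(70956,0), (3105,0),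
    (-217440,0), (28890,0), (-20340,0), (13293,0)], [(85383, 0), (33462,0), (-178416,0), (-18318,0),
    (-15519,0)], [(46491,0), (35487,0), (-42035,0), (-6335,0)], [(10759,0), (11620,0), (1155,0)], [(637,0),
    (294,0)]], [[], [(-1458,0), (1782, 0), (-7668,0), (-8100,0), (3942,0), (1134,0)], [(-4401,0), (5436,0),
    (-11394,0), (-10764,0), (1827,0)], [(-4842,0), (6192,0), (-5298,0), (-2436,0)], [(-2418,0), (3080,0),
    (-994,0)], [(-560,0), (518,0)], [(-49,0)]]]"

definition gens_y_1 :: "zform list" where
  "gens_y_1 =
    [[], [[(0,0), (-2187,0), (3888,0), (4374,0), (-4077,0), (405,0), (2106,0), (-864,0), (-189, 0)], [(0,0),
    (-9963,0), (13986,0), (13977,0), (-14274,0), (-1719,0), (4680,0), (-63,0)], [(0,0), (-17955,0),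
    (17046,0), (18450,0), (-14688,0), (-2475,0), (630,0)], [(0,0), (-15918, 0), (7136,0), (13916,0),
    (-6990,0), (168,0)], [(0,0), (-6929,0), (-732,0), (5852,0), (-1127, 0)], [(0,0), (-1239,0), (-994,0),
    (679,0)], [(0,0), (-49,0), (-98,0)]], [[(0,0), (21870,0), (-60264,0), (324,0), (61128,0), (3726,0),
    (-16848,0), (-3024,0)], [(0,0), (80028,0), (-177471,0), (5040,0), (107514,0), (5868,0), (-8883,0)],
    [(0,0), (113355,0), (-182646,0), (-29268,0), (75006,0), (10017,0)], [(0,0), (76191,0), (-75849,0),
    (-38143,0), (14273,0)], [(0,0), (24787,0), (-9352,0), (-12285,0)], [(0,0), (3577,0), (1862,0)]],
    [[(0,0), (-1458, 0), (1134,0), (5292,0), (972,0), (-2106,0), (-378,0)], [(0,0), (-4293,0), (684,0),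
    (8262, 0), (2340,0), (-945,0)], [(0,0), (-4410,0), (-3672,0), (5454,0), (756,0)], [(0,0), (-1362, 0),
    (-4424,0), (1582,0)], [(0,0), (336,0), (-1162,0)], [(0,0), (147,0)]]]"

definition gens_z_1 :: "zform list" where
  "gens_z_1 =
    [[], [[(729,0), (-972,0), (-3726,0), (2943,0), (4401,0), (-810,0), (324,0), (567,0)], [(4779,0),
    (-1458,0), (-16029,0), (5526,0), (15939,0), (324,0), (-2457,0)], [(11475,0), (2448,0), (-24282,0),
    (-3492,0), (10827,0), (4032,0)], [(13278,0), (6716,0), (-16048,0), (-7338,0), (168,0)], [(7855,0),
    (5344,0), (-4172,0), (-2443,0)], [(2247,0), (1750,0), (-63, 0)], [(245,0), (196,0)]], [[(-7290,0),
    (19440,0), (24948,0), (-66312,0), (-3834,0), (30888, 0), (9072,0)], [(-42120,0), (63909,0), (125208,0),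
    (-165870,0), (7848,0), (23121,0)], [(-83745,0), (58122,0), (225252,0), (-127746,0), (-9387,0)],
    [(-74757,0), (-2013,0), (148421, 0), (-23947,0)], [(-30569,0), (-21672,0), (30751,0)], [(-4655,0),
    (-6370,0)]], [[(486,0), (-810,0), (-2052,0), (1404,0), (3294,0), (1134,0)], [(2619,0), (-3060,0),
    (-666,0), (6084, 0), (1071,0)], [(4734,0), (-3744,0), (-234,0), (4284,0)], [(3678,0), (-1736,0),
    (-770,0)], [(1232,0), (-266,0)], [(147,0)]]]"

definition power_x_1 :: "zform list" where
  "power_x_1 =
    [[[(-462186,0), (700974,0), (787122,0), (-324198,0)], [(-935676,0), (787029,0), (608622,0), (-31311,0)],
    [(-680316,0), (0,0), (43806,0)], [(-160461,0)], [(-9947,0)]], [[(3554388,0), (-12268800,0),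
    (2061612,0)], [(5582808,0), (-8932140,0), (255780,0)], [(3605322,0), (-817026, 0)], [(227556,0)]],
    [[(-41256,0), (10584,0)], [(-49014,0), (6174,0)], [(-11172,0)]], [], [], []]"

definition power_y_1 :: "zform list" where
  "power_y_1 =
    [[[(0,0), (0,0), (0,0), (516250568988,0), (1945405752048,0), (2649114507204,0)], [(0,0),
    (-136928055888,0), (997076248944,0), (1965550551204,0), (221164806660,0)], [(3155931468,0),
    (-573000638874,0), (312447439372,0), (-226160526806,0)], [(-174514343775,0), (-845600051352,0),
    (-352324861525,0)], [(-190005853058,0), (-148798048322,0)], [(-20951728987,0)]], [[(0,0), (0, 0), (0,0),
    (-9765993990456,0), (-13596217698888,0)], [(0,0), (0,0), (-13129487506920,0), (34266854784,0)], [(0,0),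
    (5062742780202,0), (-4419952090386,0)], [(1693822492908,0), (2826111609034,0)], [(586648411636,0)]],
    [[(0,0), (0,0), (0,0), (1495039121136,0)], [(0,0), (251034769128,0), (600500182920,0)],
    [(-5785874358,0), (-136548649314,0)], [(-104871463466, 0)]], [], [], []]"

definition power_z_1 :: "zform list" where
  "power_z_1 =
    [[[(3010914,0), (4761855,0), (2591463,0), (-1024443,0), (503475,0)], [(3655197,0), (833672, 0),
    (-1527085,0)], [(0,0), (47089,0), (-503475,0)], [(-113631,0)]], [[(-37143036,0), (-14496048,0),
    (23532348,0), (8055600,0)], [(-6894888,0), (1408064,0), (8055600,0)], [(3181668,0)]], [[(3266550,0),
    (1855140,0), (1006950,0)], [(282730,0), (1006950,0)]], [], [], []]"

definition lines_2 :: "zline list" where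
  "lines_2 =
    [((1,0), (0,0), (0,0)), ((0,0), (1,0), (0,0)), ((0,0), (0,0), (1,0)), ((1,0), (1,0), (1, 0)), ((1,0),
    (1,0), (-1,1)), ((1,0), (3,-1), (1,0)), ((0,0), (1,0), (1,0)), ((2,1), (-1, 1), (0,0)), ((3,0), (0,0),
    (1,-1)), ((2,1), (0,2), (1,1)), ((3,0), (1,1), (2,0)), ((6,3), (0,6), (4,2))]"

definition rel10_2 :: "zform list" where
  "rel10_2 =
    [[[(-2,2), (6,-2)], [(0,2)]], [[(-2,-2), (-8,-2), (0,-4)], [(2,0), (0,2)], [(6,3)]], [[(-1, -1), (0,-4),
    (-1,-3), (-2,0)], [(4,1), (5,3), (2,2)], [(0,0), (2,-1)], [(-3,-1)]], [[(0, 2), (2,-2), (-6,-3), (1,-5),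
    (-6,3)], [(-3,2), (14,-3), (5,7), (9,-3)], [(-3,-2), (-1,6), (-3,1)], [(0,-2), (-3,-2)]]]"

definition rel9_2 :: "zform list" where
  "rel9_2 =
    [[], [[(4,0), (0,4)], [(6,2)]], [[(2,0), (4,0), (2,0)], [(0,0), (2,-2)], [(-2,-1)]], [[(-1, -1), (-2,2),
    (5,3), (6,-4)], [(-5,-2), (12,-2), (-9,1)], [(-3,0), (-3,-3)]]]"

definition gens_x_2 :: "zform list" where
  "gens_x_2 =
    [[[], [(-6,0), (-50,12), (284,-168), (26,58), (-492,364), (-780,400), (-632,288), (12,14), (54,0)],
    [(-4,6), (-16,56), (776,-288), (-308,242), (-1124,306), (-2044,934), (-90,344), (162,156)], [(52,35),
    (263,132), (514,133), (-400,369), (-196,195), (-798,1101), (276,345)], [(18,9), (135,18), (131,369),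
    (1389,-228), (327,47), (-15,108)], [(-198,-118), (-239,-140), (12,142), (189,-727), (-711,-366)],
    [(-222,-131), (-206,-103), (-576,-366), (-849,-477)], [(-51,-30), (-192,-102), (-384,-228)], [(0,0),
    (-63,-36)]], [[], [(-18,-6), (-178,54), (-392, 208), (-432,272), (668,-476), (2344,-1528), (1206,-766),
    (-270,162)], [(-8,-6), (-144,160), (-968,644), (-772,-128), (-360,-816), (228,-488), (1116,-546)],
    [(161,73), (601,263), (-943, 641), (-1205,-275), (-33,-157), (717,63)], [(357,196), (954,342),
    (397,156), (1050,84), (441, 684)], [(309,185), (564,328), (819,387), (732,426)], [(129,76), (255,165),
    (297,165)], [(27, 15), (36,21)]], [[], [(12,0), (276,-112), (84,84), (-696,592), (720,-276),
    (-468,312)], [(12, 4), (642,-282), (234,114), (-2538,1746), (-234,222), (-108,36)], [(-52,-4),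
    (342,-216), (540, -216), (-486,264), (-126,-54)], [(-84,-22), (-63,-27), (-81,-69), (-144,-144)],
    [(-15,-6), (-45,-9), (-171,-81)], [(18,9), (-45,-27)]], [[], [(-12,-12), (-4,-76), (-48,-64), (976,
    -544), (924,-436), (-108,108)], [(4,-8), (288,8), (528,408), (1680,-56), (828,-96)], [(184, 104),
    (1060,532), (1644,908), (1248,216)], [(388,228), (1164,696), (864,480)], [(285,165), (381,231)],
    [(63,36)]]]"

definition gens_y_2 :: "zform list" where
  "gens_y_2 =
    [[[(0,0), (-6,0), (34,-40), (100,-88), (-346,222), (-240,224), (444,-216), (236,-180), (-60, -10),
    (-18,0)], [(0,0), (-28,2), (8,-124), (128,-340), (-296,14), (-360,266), (432,-322), (30,-256),
    (-90,-60)], [(0,0), (-106,-39), (-487,-298), (-492,-649), (646,-685), (546,-247), (312,-633),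
    (-204,-267)], [(0,0), (-24,-19), (-363,-54), (-349,53), (277,246), (417,-247), (-189,-282)], [(0,0),
    (325,165), (281,236), (-20,290), (96,734), (333,174)], [(0,0), (262, 143), (-22,-71), (522,384),
    (903,540)], [(0,0), (-54,-27), (135,33), (684,390)], [(0,0), (-36,-18), (171,99)]], [[(0,0), (-18,-6),
    (14,-66), (328,-224), (256,-48), (-740,596), (-1024,680), (-234,146), (90,-54)], [(0,0), (-68,-18),
    (-72,-24), (680,4), (1756,0), (488, 560), (-588,544), (-288,138)], [(0,0), (-127,-63), (-171,127),
    (977,665), (2535,301), (87, 443), (-915,315)], [(0,0), (-349,-226), (-542,-186), (-79,436), (-414,72),
    (-285,-546)], [(0, 0), (-707,-423), (-1128,-728), (-1089,-681), (-900,-576)], [(0,0), (-657,-374),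
    (-945,-555), (-693,-381)], [(0,0), (-225,-129), (-180,-105)]], [[(0,0), (12,0), (-84,88), (-220,212),
    (768,-360), (288,-132), (-36,24)], [(0,0), (12,-36), (-390,6), (-822,-110), (1206,-1374), (198,-426),
    (-108,36)], [(0,0), (-264,-216), (-1566,-780), (-2520,-1140), (-1170,-756), (-126,-54)], [(0,0),
    (-876,-534), (-2691,-1515), (-1881,-1317), (-144,-144)], [(0,0), (-1023, -594), (-1593,-849),
    (-171,-81)], [(0,0), (-414,-243), (-45,-27)]], [[(0,0), (-12,-12), (-148,-12), (-560,128), (-688,208),
    (-228,44), (36,-36)], [(0,0), (-68,-64), (-480,-184), (-1168,-104), (-1008,-8), (-252,-24)], [(0,0),
    (-264,-184), (-1068,-636), (-1620,-628), (-960,-96)], [(0,0), (-568,-336), (-1404,-888), (-924,-540)],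
    [(0,0), (-555,-315), (-675, -405)], [(0,0), (-189,-108)]]]"

definition gens_z_2 :: "zform list" where
  "gens_z_2 =
    [[[(2,0), (-2,12), (-160,124), (218,-110), (544,-384), (-360,108), (-368,216), (216,-54), (54,0)],
    [(8,-2), (20,12), (-584,436), (272,42), (1432,-594), (560,-114), (-126,216), (162, -48)], [(-8,-13),
    (25,-22), (-252,471), (122,743), (154,449), (-24,-177), (-498,51)], [(-52, -29), (-199,-148), (87,-437),
    (-619,-216), (-1683,-93), (-1149,-72)], [(64,44), (-238,-143), (-320,-702), (-603,-447), (-324,-273)],
    [(298,176), (164,115), (396,198), (627,201)], [(219, 126), (357,225), (633,429)], [(18,9), (225,126)]],
    [[(6,2), (30,22), (-144,160), (-224,128), (476,-428), (664,-536), (-138,42), (-270,162)], [(20,6),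
    (152,-32), (0,-100), (-1012,64), (-864,-136), (-204,-168), (-504,258)], [(-71,-35), (-207,-233),
    (309,-815), (-1485,245), (-789,27), (1653,-1137)], [(-325,-170), (-734,-270), (593,-340), (426,-60),
    (-333,-42)], [(-407,-237), (-156,16), (243,555), (-240,102)], [(-177,-110), (327,129), (99,39)], [(-9,
    -3), (36,21)]], [[(-4,0), (-12,-16), (252,-228), (-408,96), (-840,372), (396,-264)], [(-12, 4),
    (-126,102), (810,-198), (102,642), (-954,1302), (1188,-396)], [(60,36), (414,528), (2268, 1152),
    (3474,1128), (1386,594)], [(252,126), (1785,1005), (3195,2271), (1584,1584)], [(309, 174), (1791,891),
    (1881,891)], [(126,81), (495,297)]], [[(4,4), (60,20), (432,-80), (592, -96), (108,108), (-108,108)],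
    [(12,16), (96,88), (816,-168), (336,72), (-396,312)], [(-72, -32), (-348,-108), (-36,-420), (96,-264)],
    [(-328,-192), (-924,-504), (-684,-300)], [(-435, -255), (-555,-345)], [(-189,-108)]]]"

definition power_x_2 :: "zform list" where
  "power_x_2 =
    [[[(-12,4), (-208,96), (40,8), (24,160), (28,4)], [(-56,-24), (0,120), (68,244), (-240, 124)],
    [(402,212), (-474,-328), (277,-117)], [(215,50), (239,-63)], [(-105,-8)]], [[(0,0), (0,0), (0,0),
    (-48,-224)], [(0,0), (0,0), (-816,-376)], [(0,0), (-954,-674)], [(-216, -66)]], [[], [(0,0),
    (-112,112)], [(356,204)]], [[(0,0), (0,0), (-144,-80)], [(0,0), (72, -312)], [(-156,48)]], [[(0,0),
    (-160,160)], [(160,96)]], [[(0,32)]]]"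

definition power_y_2 :: "zform list" where
  "power_y_2 =
    [[[(0,0), (24,8), (96,32), (-288,-192), (-4464,1360), (-5580,2428)], [(48,32), (432,144), (-1872,-1008),
    (-10938,-2278), (-8034,2)], [(304,192), (-3132,-1916), (-22132,-12528), (-3834, -4328)], [(-242,-134),
    (-32747,-19003), (10279,5425)], [(-6431,-3723), (32144,18715)], [(16953, 9780)]], [[(0,0), (0,0), (0,0),
    (0,0), (-1704,3896)], [(0,0), (0,0), (0,0), (21516,10116)], [(0,0), (0,0), (60288,34152)], [(0,0),
    (85242,49370)], [(43614,25182)]], [[], [], [(0,0), (1168,608)], [(4896,2824)]], [[(0,0), (0,0), (0,0),
    (5712,-2080)], [(0,0), (0,0), (6096, 2480)], [(0,0), (6960,4464)], [(2784,1584)]], [[], [(0,0),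
    (192,-64)], [(352,224)]], [[(0,0), (-192,-128)], [(-576,-320)]]]"

definition power_z_2 :: "zform list" where
  "power_z_2 =
    [[[(-200,104), (-1632,880), (-648,528), (-1080,1248), (-144,348)], [(216,-232), (792,324), (-396,1650),
    (-3996,3222)], [(936,72), (2439,2421), (6246,-3270)], [(1260,492), (-3159, -1842)], [(-2448,-1251)]],
    [[(0,0), (0,0), (0,0), (-1656,-288)], [(0,0), (0,0), (-2448, -4428)], [(0,0), (-10566,-5526)],
    [(-6156,-3312)]], [[], [(0,0), (-2232,1704)], [(504,-456)]], [[(0,0), (0,0), (72,-648)], [(0,0),
    (-432,-1008)], [(-756,-36)]], [[(0,0), (-1152,768)], [(576,-192)]], [[(-288,288)]]]"

lemma arrangement_1:
  "length lines_1 = 12"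
  "distinct_lines lines_1"
  by code_simp+

lemma degrees_1:
  "wf_forms [1, 2, 3, 4] rel10_1"
  "wf_forms [0, 1, 2, 3] rel9_1"
  "wf_forms [9, 8, 7, 6] gens_x_1"
  "wf_forms [9, 8, 7, 6] gens_y_1"
  "wf_forms [9, 8, 7, 6] gens_z_1"
  by code_simp+

lemma relations_1:
  "form_zero (lincomb rel10_1 gens_x_1)"
  "form_zero (lincomb rel10_1 gens_y_1)"
  "form_zero (lincomb rel10_1 gens_z_1)"
  "form_zero (lincomb rel9_1 gens_x_1)"
  "form_zero (lincomb rel9_1 gens_y_1)"
  "form_zero (lincomb rel9_1 gens_z_1)"
  by code_simp+

lemma cross_1:
  "cross_check (1, 0) (-2, 0) (zminor rel10_1 rel9_1 0 1) (gens_x_1 ! 2, gens_y_1 ! 2, gens_z_1 ! 2) (gens_x_1 ! 3, gens_y_1 ! 3, gens_z_1 ! 3) (jet_prod lines_1)"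
  "top_coeff 2 (zminor rel10_1 rel9_1 0 1) \<noteq> (0, 0)"
  by code_simp+

lemma powers_1:
  "wf_forms [6 - 2, 6 - 3, 6 - 4, 6 - 4, 6 - 5, 6 - 6] power_x_1"
  "wf_forms [7 - 2, 7 - 3, 7 - 4, 7 - 4, 7 - 5, 7 - 6] power_y_1"
  "wf_forms [6 - 2, 6 - 3, 6 - 4, 6 - 4, 6 - 5, 6 - 6] power_z_1"
  "form_zero (form_sub (lincomb power_x_1 (zminors rel10_1 rel9_1)) (replicate 6 [] @ [[(356720, 0)]]))"
  "form_zero (form_sub (lincomb power_y_1 (zminors rel10_1 rel9_1)) [replicate 7 (0, 0) @ [(297086180751360, 0)]])"
  "form_zero (form_sub (lincomb power_z_1 (zminors rel10_1 rel9_1)) [[(53913600, 0)]])"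
  by code_simp+

lemma arrangement_2:
  "length lines_2 = 12"
  "distinct_lines lines_2"
  by code_simp+

lemma degrees_2:
  "wf_forms [1, 2, 3, 4] rel10_2"
  "wf_forms [0, 1, 2, 3] rel9_2"
  "wf_forms [9, 8, 7, 6] gens_x_2"
  "wf_forms [9, 8, 7, 6] gens_y_2"
  "wf_forms [9, 8, 7, 6] gens_z_2"
  by code_simp+

lemma relations_2:
  "form_zero (lincomb rel10_2 gens_x_2)"
  "form_zero (lincomb rel10_2 gens_y_2)"
  "form_zero (lincomb rel10_2 gens_z_2)"
  "form_zero (lincomb rel9_2 gens_x_2)"
  "form_zero (lincomb rel9_2 gens_y_2)"
  "form_zero (lincomb rel9_2 gens_z_2)"
  by code_simp+

lemma cross_2:
  "cross_check (1, 0) (1, 0) (zminor rel10_2 rel9_2 0 1) (gens_x_2 ! 2, gens_y_2 ! 2, gens_z_2 ! 2) (gens_x_2 ! 3, gens_y_2 ! 3, gens_z_2 ! 3) (jet_prod lines_2)"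
  "top_coeff 2 (zminor rel10_2 rel9_2 0 1) \<noteq> (0, 0)"
  by code_simp+

lemma powers_2:
  "wf_forms [6 - 2, 6 - 3, 6 - 4, 6 - 4, 6 - 5, 6 - 6] power_x_2"
  "wf_forms [7 - 2, 7 - 3, 7 - 4, 7 - 4, 7 - 5, 7 - 6] power_y_2"
  "wf_forms [6 - 2, 6 - 3, 6 - 4, 6 - 4, 6 - 5, 6 - 6] power_z_2"
  "form_zero (form_sub (lincomb power_x_2 (zminors rel10_2 rel9_2)) (replicate 6 [] @ [[(72, 48)]]))"
  "form_zero (form_sub (lincomb power_y_2 (zminors rel10_2 rel9_2)) [replicate 7 (0, 0) @ [(240768, -139008)]])"
  "form_zero (form_sub (lincomb power_z_2 (zminors rel10_2 rel9_2)) [[(1216, -704)]])"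
  by code_simp+

text \<open>Entry \<open>i, j, k\<close> tells whether line \<open>k\<close> passes through the intersection of the lines
  \<open>i\<close> and \<open>j\<close>, provided that these are distinct.\<close>

definition incidences :: "zline list \<Rightarrow> bool list list list" where
  "incidences ms =
     map (\<lambda>a. map (\<lambda>p. map (\<lambda>m. zpairing m p = (0, 0)) ms) (map (zcross a) ms)) ms"

lemma same_incidences: "incidences lines_1 = incidences lines_2"
  by code_simp


section \<open>The two arrangements\<close>

definition factor_coeffs :: "complex \<Rightarrow> complex \<Rightarrow> (complex \<times> complex \<times> complex) list" where
  "factor_coeffs s t = [(1, 0, 0), (0, 1, 0), (0, 0, 1), (1, 1, 1), (1, 1, t), (t, s, t), (0, 1, 1),
     (1, s - t, 0), (- s + t + 1, 0, - s + t), (1, s, t),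
     (- s * t^2 + s * t + t^3 - t, - s * t + t^2, - s * t^2 + t^3),
     (s^2 * t - s * t^2 - 2 * s * t + t^2 + t,
      s^3 * t - s^3 - 2 * s^2 * t^2 + s^2 * t + s^2 + s * t^3 - s * t, s^2 * t - 2 * s * t^2 + t^3)]"

fun scaled_by :: "complex \<times> zline \<Rightarrow> complex \<times> complex \<times> complex \<Rightarrow> bool" where
  "scaled_by (k, a', b', c') (a, b, c) \<longleftrightarrow> a = k * embed a' \<and> b = k * embed b' \<and> c = k * embed c'"

lemma Q'_eq:
  assumes "list_all2 scaled_by kms (factor_coeffs s t)"
  shows "Q' s t = Const (prod_list (map fst kms)) * prod_list (map (\<lambda>m. lin (line_coeffs m)) (map snd kms))"
proof -
  let ?F = "\<lambda>(a, b, c). Const a * Var 1 + Const b * Var 2 + Const c * Var 3"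
  have Q: "Q' s t = prod_list (map ?F (factor_coeffs s t))"
    unfolding Q'_def Let_def A_form_def B_form_def factor_coeffs_def by (simp add: mult.assoc)
  show ?thesis
    unfolding Q using assms
  proof induction
    case (Cons km kms q qs)
    obtain a b c where q: "q = (a, b, c)" by (cases q)
    obtain k a' b' c' where km: "km = (k, a', b', c')" by (cases km)
    have "?F q = Const k * lin (line_coeffs (a', b', c'))"
      using Cons.hyps(1) by (simp add: q km lin_def sum_3 vector_3 Const_mult algebra_simps)
    then show ?case using Cons.IH by (simp add: km Const_mult mult_ac)
  qed simp
qed

lemma Q'_1: "Q' (-3) 3 = Const 216 * prod_list (map (\<lambda>m. lin (line_coeffs m)) lines_1)"
proof -
  let ?ks = "[1, 1, 1, 1, 1, 3, 1, 1, 1, 1, 6, 12]"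
  have "list_all2 scaled_by (zip ?ks lines_1) (factor_coeffs (-3) 3)"
    by (simp add: lines_1_def factor_coeffs_def embed_def)
  from Q'_eq[OF this] show ?thesis by (simp add: lines_1_def)
qed

text \<open>The product of the constants that normalize the lines of the second arrangement.\<close>

definition unit_2 :: complex where
  "unit_2 = (let r = complex_of_real (sqrt 3) in
     (r - 1) * (2 - r) * (2 - r) * (2 - r) * (19 - 11 * r) * (153 * r - 265))"

lemma unit_2_nz: "unit_2 \<noteq> 0"
proof -
  have "embed (zr_mult (-1, 1) (zr_mult (2, -1) (zr_mult (2, -1) (zr_mult (2, -1)
      (zr_mult (19, -11) (-265, 153)))))) = unit_2"
    unfolding embed_mult by (simp add: embed_def unit_2_def Let_def algebra_simps)
  moreover have "zr_mult (-1, 1) (zr_mult (2, -1) (zr_mult (2, -1) (zr_mult (2, -1)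
      (zr_mult (19, -11) (-265, 153))))) \<noteq> (0, 0)" by simp
  ultimately show ?thesis using embed_eq_0_iff by metis
qed

lemma Q'_2:
  assumes "s = complex_of_real ((1 - sqrt 3) * (sqrt 3 - 3))" "t = complex_of_real (sqrt 3 - 1)"
  shows "Q' s t = Const unit_2 * prod_list (map (\<lambda>m. lin (line_coeffs m)) lines_2)"
proof -
  define r where "r = complex_of_real (sqrt 3)"
  have r: "r * r = 3" unfolding r_def by (rule sqrt_3_sqrt_3)
  then have r': "r * (r * x) = 3 * x" for x by (simp flip: mult.assoc)
  have s: "s = (1 - r) * (r - 3)" and t: "t = r - 1" by (simp_all add: assms r_def)
  have e: "embed a = of_int (fst a) + of_int (snd a) * r" for a by (simp add: embed_def r_def)
  let ?ks = "[1, 1, 1, 1, 1, r - 1, 1, 2 - r, 2 - r, 2 - r, 19 - 11 * r, 153 * r - 265]"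
  have "list_all2 scaled_by (zip ?ks lines_2) (factor_coeffs s t)"
    unfolding lines_2_def factor_coeffs_def s t
    by (simp add: e power2_eq_square power3_eq_cube algebra_simps r r')
  from Q'_eq[OF this] show ?thesis by (simp add: lines_2_def unit_2_def Let_def r_def mult.assoc)
qed

theorem mainTheorem3:
  fixes s' t' :: complex
  defines "s' \<equiv> complex_of_real ((1 - sqrt 3) * (sqrt 3 - 3))"
      and "t' \<equiv> complex_of_real (sqrt 3 - 1)"
  shows "defines_line_arrangement 12 (Q' (-3) 3) \<and>
    defines_line_arrangement 12 (Q' s' t') \<and>
    isomorphic_lattices (lines_of (Q' (-3) 3)) (lines_of (Q' s' t')) \<and>
    resolution_of_form [0, 0, 0] (AR (Q' (-3) 3)) [[8, 7, 6], [10]] \<and>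
    resolution_of_form [0, 0, 0] (AR (Q' s' t')) [[9, 8, 7, 6], [10, 9]] \<and>
    ziegler_pair2 (Q' (-3) 3) (Q' s' t')"
proof -
  interpret A: certificate lines_1 216 "Q' (-3) 3" rel10_1 rel9_1 gens_x_1 gens_y_1 gens_z_1
    "(1, 0)" "(-2, 0)" power_x_1 power_y_1 power_z_1 "(356720, 0)" "(297086180751360, 0)" "(53913600, 0)" 6 7 6
    by unfold_locales (rule arrangement_1 degrees_1 relations_1 cross_1 powers_1 Q'_1 | simp)+
  interpret B: certificate lines_2 unit_2 "Q' s' t'" rel10_2 rel9_2 gens_x_2 gens_y_2 gens_z_2
    "(1, 0)" "(1, 0)" power_x_2 power_y_2 power_z_2 "(72, 48)" "(240768, -139008)" "(1216, -704)" 6 7 6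
    by unfold_locales
      (rule arrangement_2 degrees_2 relations_2 cross_2 powers_2 unit_2_nz Q'_2[OF s'_def[THEN meta_eq_to_obj_eq] t'_def[THEN meta_eq_to_obj_eq]] | simp)+
  interpret A: line_product 12 "\<lambda>i. line_coeffs (lines_1 ! i)" 216 "Q' (-3) 3"
    by (rule A.line_product)
  interpret B: line_product 12 "\<lambda>i. line_coeffs (lines_2 ! i)" unit_2 "Q' s' t'"
    by (rule B.line_product)
  have iso: "isomorphic_lattices (lines_of (Q' (-3) 3)) (lines_of (Q' s' t'))"
  proof (rule isomorphic_lattices_of_pencils[OF A.line_product B.line_product])
    fix i j k :: nat assume ijk: "i < 12" "j < 12" "k < 12"
    have entry: "incidences ms ! i ! j ! k \<longleftrightarrow> 
        pairing (line_coeffs (ms ! k)) (cross (line_coeffs (ms ! i)) (line_coeffs (ms ! j))) = 0"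
      if "length ms = 12" for ms
      using ijk that
      by (simp add: incidences_def embed_eq_0_iff flip: line_coeffs_cross embed_pairing)
    show "pairing (line_coeffs (lines_1 ! k)) (cross (line_coeffs (lines_1 ! i)) (line_coeffs (lines_1 ! j))) = 0
      \<longleftrightarrow> pairing (line_coeffs (lines_2 ! k)) (cross (line_coeffs (lines_2 ! i)) (line_coeffs (lines_2 ! j))) = 0"
      unfolding entry[OF arrangement_1(1), symmetric] entry[OF arrangement_2(1), symmetric] same_incidences ..
  qed
  have res_A: "resolution_of_form [0, 0, 0] (AR (Q' (-3) 3)) [[8, 7, 6], [10]]"
  proof (rule relation_data.resolution_3_1[OF A.relation_data])
    have "gens_x_1 ! 0 = []" "gens_y_1 ! 0 = []" "gens_z_1 ! 0 = []" "rel10_1 ! 0 = []"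
      "rel9_1 ! 0 = [[(1, 0)]]" "rel9_1 ! Suc 0 = []" "rel9_1 ! 2 = []" "rel9_1 ! 3 = []"
      by (simp_all add: gens_x_1_def gens_y_1_def gens_z_1_def rel10_1_def rel9_1_def)
    then show "A.\<rho> 0 = 0" "A.b 0 = 0" "A.e 0 = 1" "A.e 1 = 0" "A.e 2 = 0" "A.e 3 = 0"
      by (simp_all add: A.\<rho>_def A.b_def A.e_def vec_eq_iff forall_3 vector_3 embed_1)
  qed (rule A.forms; assumption)+
  have res_B: "resolution_of_form [0, 0, 0] (AR (Q' s' t')) [[9, 8, 7, 6], [10, 9]]"
  proof (rule relation_data.resolution_4_2[OF B.relation_data])
    have "rel9_2 ! 0 = []" by (simp add: rel9_2_def)
    then show "B.e 0 = 0" by (simp add: B.e_def)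
  qed (rule B.forms; assumption)+
  have "graded_betti [0, 0, 0] (AR (Q' (-3) 3)) 0 9 \<noteq> graded_betti [0, 0, 0] (AR (Q' s' t')) 0 9"
    using graded_betti_0[OF res_A] graded_betti_0[OF res_B] by simp
  then have "ziegler_pair2 (Q' (-3) 3) (Q' s' t')"
    unfolding ziegler_pair2_def using A.line_arrangement B.line_arrangement iso
    by (metis zero_less_numeral)
  then show ?thesis using A.line_arrangement B.line_arrangement iso res_A res_B by blast
qed

end
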